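(* Let $R$ be a commutative ring, let $P=(H,K)$ and $Q=(Y,Z)$ be Hopf $\alpha$-pairings over $R$ and let $(\xi,\theta):(Y,Z)\to(H,K)$ be a morphism of Hopf pairings. For every $N\in\mathrm{Rat}^{K}(_{H}\mathcal{M})$ consider $N\otimes_RZ$ with the right $K$-comodule structure $$N\otimes_RZ\to N\otimes_RZ\otimes_RK,\quad n\otimes z\mapsto\sum n_{\langle0\rangle}\otimes z_2\otimes n_{\langle1\rangle}S_K(\theta(z_1)),$$ and the induced left $H$-module structure. Then for the coinduction functor $$\mathrm{Coind}_P^Q(-):\mathrm{Rat}^K(_H\mathcal{M})\to\mathrm{Rat}^Z(_Y\mathcal{M}),\quad N\mapsto\mathrm{HOM}_{H-}(Y,N):=\mathrm{Rat}^Z(_Y\mathrm{Hom}_{H-}(Y,N)),$$ there are isomorphisms, functorial in $N$, $$(N\otimes_RZ)^{coK}\simeq(N\otimes_RZ)^{H}\simeq\mathrm{HOM}_R(Y,N)^{H}=\mathrm{Rat}^Z(_Y(\mathrm{Hom}_R(Y,N)^{H}))=\mathrm{HOM}_{H-}(Y,N)=\mathrm{Coind}_P^Q(N)\simeq N\square_KZ\simeq\mathrm{Hom}_{H^e-}(H,N\otimes_RZ),$$ where $\mathrm{HOM}_R(Y,N):=\mathrm{Rat}^Z(_Y\mathrm{Hom}_R(Y,N))$.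
   Context: A bialgebra $R$-pairing $P=(H,K)$: $R$-bialgebras $H,K$ with an $R$-bilinear form $\langle-,-\rangle:H\times K\to R$ such that $\kappa_P:H\to K^*$, $h\mapsto\langle h,-\rangle$ and $\chi_P:K\to H^*$, $k\mapsto\langle-,k\rangle$ are $R$-algebra morphisms (duals carry the convolution product). It is a Hopf $R$-pairing if $H,K$ are Hopf $R$-algebras, and a Hopf $\alpha$-pairing if moreover for every $R$-module $M$ the map $\alpha^P_M:M\otimes_RK\to\mathrm{Hom}_R(H,M)$, $\sum m_i\otimes k_i\mapsto[h\mapsto\sum m_i\langle h,k_i\rangle]$ is injective. A morphism $(\xi,\theta):(Y,Z)\to(H,K)$ consists of bialgebra morphisms $\xi:H\to Y$, $\theta:Z\to K$ with $\langle\xi(h),z\rangle=\langle h,\theta(z)\rangle$. For a left $H$-module $M$ with $\rho_M(m)=[h\mapsto hm]$: $\mathrm{Rat}^K(_HM)=\rho_M^{-1}(\alpha_M^P(M\otimes_RK))$; $M$ is $K$-rational if this equals $M$, and then $M$ is a right $K$-comodule via $\varrho_M=(\alpha_M^P)^{-1}\circ\rho_M$. $\mathrm{Rat}^K(_H\mathcal{M})$ is the full subcategory of $K$-rational left $H$-modules. Conversely a right $K$-comodule has the induced left $H$-action $hm=\sum m_{\langle0\rangle}\langle h,m_{\langle1\rangle}\rangle$. The same applies to $Q=(Y,Z)$. $M^H=\{m\in M: hm=\varepsilon(h)m\ \forall h\in H\}$ for a left $H$-module $M$, and $M^{coK}=\{m\in M:\varrho_M(m)=m\otimes1_K\}$ for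 a right $K$-comodule $M$. $\mathrm{Hom}_R(Y,N)$ is a left $Y$-module by $(yf)(y')=f(y'y)$ and a left $H$-module by $(hf)(y)=\sum h_1f(S_Y(\xi(h_2))y)$; these actions commute, and $H$-invariants are taken for the latter. $\mathrm{Hom}_{H-}(Y,N)$ is formed with $Y$ as left $H$-module via $\xi$, and is a left $Y$-module by $(yf)(y')=f(y'y)$. $Z$ is a left $K$-comodule via $(\theta\otimes\mathrm{id})\Delta_Z$; $N\square_KZ$ is the kernel of $\varrho_N\otimes\mathrm{id}_Z-\mathrm{id}_N\otimes\varrho_Z:N\otimes_RZ\to N\otimes_RK\otimes_RZ$. In the last term, $H^e=H\otimes_RH^{op}$ acts on $H$ by $(h\otimes h')x=hxh'$ and on $N\otimes_RZ$ by $(h\otimes h')(n\otimes z)=hn\otimes\sum\langle\xi(h'),z_1\rangle z_2$. *)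

theory Defs
  imports "HOL-Algebra.Algebra"
begin

section \<open>Modules over a commutative ring\<close>

text \<open>A module over \<open>R\<close> is a record satisfying \<^locale>\<open>module\<close>; its fields \<open>mult\<close> and \<open>one\<close>
  carry no meaning unless it is an algebra.\<close>

definition regular_module :: "('r, 'z) ring_scheme \<Rightarrow> ('r, 'r) module" where
  "regular_module R = \<lparr>carrier = carrier R, monoid.mult = (\<otimes>\<^bsub>R\<^esub>), monoid.one = \<one>\<^bsub>R\<^esub>,
     ring.zero = \<zero>\<^bsub>R\<^esub>, ring.add = (\<oplus>\<^bsub>R\<^esub>), module.smult = (\<otimes>\<^bsub>R\<^esub>)\<rparr>"

definition submod :: "('r, 'm) module \<Rightarrow> 'm set \<Rightarrow> ('r, 'm) module" where
  "submod M S = M\<lparr>carrier := S\<rparr>"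

definition linear_maps ::
  "('r, 'z) ring_scheme \<Rightarrow> ('r, 'm, 'x) module_scheme \<Rightarrow> ('r, 'n, 'y) module_scheme \<Rightarrow> ('m \<Rightarrow> 'n) set" where
  "linear_maps R M N = {f \<in> carrier M \<rightarrow> carrier N.
     (\<forall>x\<in>carrier M. \<forall>y\<in>carrier M. f (x \<oplus>\<^bsub>M\<^esub> y) = f x \<oplus>\<^bsub>N\<^esub> f y) \<and>
     (\<forall>r\<in>carrier R. \<forall>x\<in>carrier M. f (r \<odot>\<^bsub>M\<^esub> x) = r \<odot>\<^bsub>N\<^esub> f x)}"

text \<open>\<open>Hom\<^sub>R(M, N)\<close>; maps are normalised to be \<^const>\<open>undefined\<close> outside \<open>carrier M\<close>, so that
  equality of elements is equality of maps.\<close>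

definition hom_module ::
  "('r, 'z) ring_scheme \<Rightarrow> ('r, 'm, 'x) module_scheme \<Rightarrow> ('r, 'n, 'y) module_scheme \<Rightarrow> ('r, 'm \<Rightarrow> 'n) module" where
  "hom_module R M N = \<lparr>carrier = linear_maps R M N \<inter> extensional (carrier M),
     monoid.mult = undefined, monoid.one = undefined,
     ring.zero = (\<lambda>x\<in>carrier M. \<zero>\<^bsub>N\<^esub>),
     ring.add = (\<lambda>f g. \<lambda>x\<in>carrier M. f x \<oplus>\<^bsub>N\<^esub> g x),
     module.smult = (\<lambda>r f. \<lambda>x\<in>carrier M. r \<odot>\<^bsub>N\<^esub> f x)\<rparr>"


section \<open>Tensor products\<close>

text \<open>\<open>M \<otimes>\<^sub>R N\<close> is the free abelian group on \<open>M \<times> N\<close> modulo the subgroup generated by the usual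
  relations.\<close>

type_synonym ('m, 'n) tensor = "('m \<times> 'n \<Rightarrow>\<^sub>0 int) set"

definition tensor_relators ::
  "('r, 'z) ring_scheme \<Rightarrow> ('r, 'm, 'x) module_scheme \<Rightarrow> ('r, 'n, 'y) module_scheme \<Rightarrow> ('m \<times> 'n \<Rightarrow>\<^sub>0 int) set" where
  "tensor_relators R M N =
     {frag_of (x \<oplus>\<^bsub>M\<^esub> x', y) - frag_of (x, y) - frag_of (x', y) | x x' y.
        x \<in> carrier M \<and> x' \<in> carrier M \<and> y \<in> carrier N} \<union>
     {frag_of (x, y \<oplus>\<^bsub>N\<^esub> y') - frag_of (x, y) - frag_of (x, y') | x y y'.
        x \<in> carrier M \<and> y \<in> carrier N \<and> y' \<in> carrier N} \<union>
     {frag_of (r \<odot>\<^bsub>M\<^esub> x, y) - frag_of (x, r \<odot>\<^bsub>N\<^esub> y) | r x y.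
        r \<in> carrier R \<and> x \<in> carrier M \<and> y \<in> carrier N}"

definition tensor_null ::
  "('r, 'z) ring_scheme \<Rightarrow> ('r, 'm, 'x) module_scheme \<Rightarrow> ('r, 'n, 'y) module_scheme \<Rightarrow> ('m \<times> 'n \<Rightarrow>\<^sub>0 int) set" where
  "tensor_null R M N =
     generate (free_Abelian_group (carrier M \<times> carrier N)) (tensor_relators R M N)"

definition tensor_class ::
  "('r, 'z) ring_scheme \<Rightarrow> ('r, 'm, 'x) module_scheme \<Rightarrow> ('r, 'n, 'y) module_scheme \<Rightarrow>
   ('m \<times> 'n \<Rightarrow>\<^sub>0 int) \<Rightarrow> ('m, 'n) tensor" where
  "tensor_class R M N c =
     tensor_null R M N #>\<^bsub>free_Abelian_group (carrier M \<times> carrier N)\<^esub> c"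

definition tens ::
  "('r, 'z) ring_scheme \<Rightarrow> ('r, 'm, 'x) module_scheme \<Rightarrow> ('r, 'n, 'y) module_scheme \<Rightarrow>
   'm \<Rightarrow> 'n \<Rightarrow> ('m, 'n) tensor" where
  "tens R M N x y = tensor_class R M N (frag_of (x, y))"

definition tensor ::
  "('r, 'z) ring_scheme \<Rightarrow> ('r, 'm, 'x) module_scheme \<Rightarrow> ('r, 'n, 'y) module_scheme \<Rightarrow>
   ('r, ('m, 'n) tensor) module" where
  "tensor R M N =
     (let F = free_Abelian_group (carrier M \<times> carrier N); Q = F Mod tensor_null R M N in
      \<lparr>carrier = carrier Q, monoid.mult = undefined, monoid.one = undefined,
       ring.zero = \<one>\<^bsub>Q\<^esub>, ring.add = (\<otimes>\<^bsub>Q\<^esub>),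
       module.smult = (\<lambda>r t. the_elem ((\<lambda>c. tensor_class R M N
          (frag_extend (\<lambda>(x, y). frag_of (r \<odot>\<^bsub>M\<^esub> x, y)) c)) ` t))\<rparr>)"

text \<open>The additive map \<open>M \<otimes>\<^sub>R N \<rightarrow> L\<close> with \<open>x \<otimes> y \<mapsto> f x y\<close>, for an \<open>R\<close>-balanced biadditive \<open>f\<close>.
  In Sweedler notation, \<open>tensor_lift L f (\<Delta> c) = \<Sum> f c\<^sub>1 c\<^sub>2\<close>.\<close>

definition frag_eval :: "('l, 'x) ring_scheme \<Rightarrow> ('m \<Rightarrow> 'n \<Rightarrow> 'l) \<Rightarrow> ('m \<times> 'n \<Rightarrow>\<^sub>0 int) \<Rightarrow> 'l" where
  "frag_eval L f c =
     (\<Oplus>\<^bsub>L\<^esub>p\<in>Poly_Mapping.keys c. add_pow L (Poly_Mapping.lookup c p) (f (fst p) (snd p)))"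

definition tensor_lift :: "('l, 'x) ring_scheme \<Rightarrow> ('m \<Rightarrow> 'n \<Rightarrow> 'l) \<Rightarrow> ('m, 'n) tensor \<Rightarrow> 'l" where
  "tensor_lift L f t = the_elem (frag_eval L f ` t)"

definition tensor_map ::
  "('r, 'z) ring_scheme \<Rightarrow> ('r, 'p, 'x) module_scheme \<Rightarrow> ('r, 'q, 'y) module_scheme \<Rightarrow>
   ('m \<Rightarrow> 'p) \<Rightarrow> ('n \<Rightarrow> 'q) \<Rightarrow> ('m, 'n) tensor \<Rightarrow> ('p, 'q) tensor" where
  "tensor_map R P Q f g = tensor_lift (tensor R P Q) (\<lambda>x y. tens R P Q (f x) (g y))"

definition tensor_assoc ::
  "('r, 'z) ring_scheme \<Rightarrow> ('r, 'l, 'w) module_scheme \<Rightarrow> ('r, 'm, 'x) module_scheme \<Rightarrow>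
   ('r, 'n, 'y) module_scheme \<Rightarrow> (('l, 'm) tensor, 'n) tensor \<Rightarrow> ('l, ('m, 'n) tensor) tensor" where
  "tensor_assoc R L M N =
     (let T = tensor R L (tensor R M N) in
      tensor_lift T (\<lambda>s z. tensor_lift T (\<lambda>x y. tens R L (tensor R M N) x (tens R M N y z)) s))"


section \<open>Algebras, coalgebras, Hopf algebras\<close>

text \<open>The library's \<^locale>\<open>algebra\<close> is commutative.\<close>

locale assoc_algebra =
  fixes R :: "('r, 'z) ring_scheme" and A :: "('r, 'a, 'x) module_scheme"
  assumes module: "module R A"
    and ring: "ring A"
    and smult_mult_left: "\<lbrakk>r \<in> carrier R; x \<in> carrier A; y \<in> carrier A\<rbrakk> \<Longrightarrow>
      (r \<odot>\<^bsub>A\<^esub> x) \<otimes>\<^bsub>A\<^esub> y = r \<odot>\<^bsub>A\<^esub> (x \<otimes>\<^bsub>A\<^esub> y)"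
    and smult_mult_right: "\<lbrakk>r \<in> carrier R; x \<in> carrier A; y \<in> carrier A\<rbrakk> \<Longrightarrow>
      x \<otimes>\<^bsub>A\<^esub> (r \<odot>\<^bsub>A\<^esub> y) = r \<odot>\<^bsub>A\<^esub> (x \<otimes>\<^bsub>A\<^esub> y)"

definition algebra_homs ::
  "('r, 'z) ring_scheme \<Rightarrow> ('r, 'a, 'x) module_scheme \<Rightarrow> ('r, 'b, 'y) module_scheme \<Rightarrow> ('a \<Rightarrow> 'b) set" where
  "algebra_homs R A B = ring_hom A B \<inter> linear_maps R A B"

definition tensor_algebra ::
  "('r, 'z) ring_scheme \<Rightarrow> ('r, 'a, 'x) module_scheme \<Rightarrow> ('r, 'b, 'y) module_scheme \<Rightarrow>
   ('r, ('a, 'b) tensor) module" where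
  "tensor_algebra R A B =
     (let T = tensor R A B in
      T\<lparr>monoid.mult := (\<lambda>s t. tensor_lift T (\<lambda>a b. tensor_lift T (\<lambda>a' b'.
                  tens R A B (a \<otimes>\<^bsub>A\<^esub> a') (b \<otimes>\<^bsub>B\<^esub> b')) t) s),
        monoid.one := tens R A B \<one>\<^bsub>A\<^esub> \<one>\<^bsub>B\<^esub>\<rparr>)"

definition opposite :: "('a, 'x) monoid_scheme \<Rightarrow> ('a, 'x) monoid_scheme" where
  "opposite A = A\<lparr>monoid.mult := (\<lambda>x y. y \<otimes>\<^bsub>A\<^esub> x)\<rparr>"

record ('r, 'h) hopf = "('r, 'h) module" +
  comult :: "'h \<Rightarrow> ('h, 'h) tensor"
  counit :: "'h \<Rightarrow> 'r"
  antipode :: "'h \<Rightarrow> 'h"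

locale coalgebra =
  fixes R :: "('r, 'z) ring_scheme" and C :: "('r, 'c) hopf"
  assumes module: "module R C"
    and comult_linear: "comult C \<in> linear_maps R C (tensor R C C)"
    and counit_linear: "counit C \<in> linear_maps R C (regular_module R)"
    and coassoc: "c \<in> carrier C \<Longrightarrow>
      tensor_assoc R C C C (tensor_map R (tensor R C C) C (comult C) (\<lambda>x. x) (comult C c)) =
      tensor_map R C (tensor R C C) (\<lambda>x. x) (comult C) (comult C c)"
    and counit_left: "c \<in> carrier C \<Longrightarrow>
      tensor_lift C (\<lambda>x y. counit C x \<odot>\<^bsub>C\<^esub> y) (comult C c) = c"
    and counit_right: "c \<in> carrier C \<Longrightarrow>
      tensor_lift C (\<lambda>x y. counit C y \<odot>\<^bsub>C\<^esub> x) (comult C c) = c"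

locale bialgebra =
  fixes R :: "('r, 'z) ring_scheme" and H :: "('r, 'h) hopf"
  assumes assoc_algebra: "assoc_algebra R H"
    and coalgebra: "coalgebra R H"
    and comult_hom: "comult H \<in> algebra_homs R H (tensor_algebra R H H)"
    and counit_hom: "counit H \<in> algebra_homs R H (regular_module R)"

locale hopf_algebra = bialgebra R H
  for R :: "('r, 'z) ring_scheme" and H :: "('r, 'h) hopf" +
  assumes antipode_linear: "antipode H \<in> linear_maps R H H"
    and antipode_left: "h \<in> carrier H \<Longrightarrow>
      tensor_lift H (\<lambda>x y. antipode H x \<otimes>\<^bsub>H\<^esub> y) (comult H h) = counit H h \<odot>\<^bsub>H\<^esub> \<one>\<^bsub>H\<^esub>"
    and antipode_right: "h \<in> carrier H \<Longrightarrow>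
      tensor_lift H (\<lambda>x y. x \<otimes>\<^bsub>H\<^esub> antipode H y) (comult H h) = counit H h \<odot>\<^bsub>H\<^esub> \<one>\<^bsub>H\<^esub>"

definition bialgebra_homs ::
  "('r, 'z) ring_scheme \<Rightarrow> ('r, 'h) hopf \<Rightarrow> ('r, 'k) hopf \<Rightarrow> ('h \<Rightarrow> 'k) set" where
  "bialgebra_homs R H K = {f \<in> algebra_homs R H K. \<forall>h\<in>carrier H.
     comult K (f h) = tensor_map R K K f f (comult H h) \<and> counit K (f h) = counit H h}"

text \<open>\<open>C\<^sup>* = Hom\<^sub>R(C, R)\<close> with the convolution product.\<close>

definition dual_algebra :: "('r, 'z) ring_scheme \<Rightarrow> ('r, 'c) hopf \<Rightarrow> ('r, 'c \<Rightarrow> 'r) module" where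
  "dual_algebra R C = (hom_module R C (regular_module R))
     \<lparr>monoid.mult := (\<lambda>f g. \<lambda>c\<in>carrier C. tensor_lift R (\<lambda>x y. f x \<otimes>\<^bsub>R\<^esub> g y) (comult C c)),
      monoid.one := (\<lambda>c\<in>carrier C. counit C c)\<rparr>"


section \<open>Pairings\<close>

locale bialgebra_pairing =
  fixes R :: "('r, 'z) ring_scheme" and H :: "('r, 'h) hopf" and K :: "('r, 'k) hopf"
    and \<beta> :: "'h \<Rightarrow> 'k \<Rightarrow> 'r"
  assumes bialgebra_H: "bialgebra R H"
    and bialgebra_K: "bialgebra R K"
    and linear_left: "k \<in> carrier K \<Longrightarrow> (\<lambda>h. \<beta> h k) \<in> linear_maps R H (regular_module R)"
    and linear_right: "h \<in> carrier H \<Longrightarrow> \<beta> h \<in> linear_maps R K (regular_module R)"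
    and kappa_hom: "(\<lambda>h. \<lambda>k\<in>carrier K. \<beta> h k) \<in> algebra_homs R H (dual_algebra R K)"
    and chi_hom: "(\<lambda>k. \<lambda>h\<in>carrier H. \<beta> h k) \<in> algebra_homs R K (dual_algebra R H)"

locale hopf_pairing = bialgebra_pairing R H K \<beta>
  for R :: "('r, 'z) ring_scheme" and H :: "('r, 'h) hopf" and K :: "('r, 'k) hopf"
    and \<beta> :: "'h \<Rightarrow> 'k \<Rightarrow> 'r" +
  assumes hopf_H: "hopf_algebra R H"
    and hopf_K: "hopf_algebra R K"

definition alpha_map ::
  "('r, 'z) ring_scheme \<Rightarrow> ('r, 'h) hopf \<Rightarrow> ('h \<Rightarrow> 'k \<Rightarrow> 'r) \<Rightarrow> ('r, 'm, 'x) module_scheme \<Rightarrow>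
   ('m, 'k) tensor \<Rightarrow> 'h \<Rightarrow> 'm" where
  "alpha_map R H \<beta> M =
     tensor_lift (hom_module R H M) (\<lambda>m k. \<lambda>h\<in>carrier H. \<beta> h k \<odot>\<^bsub>M\<^esub> m)"

text \<open>A hypothesis cannot quantify over all types. The element type \<^typ>\<open>(nat \<Rightarrow> 'r) set\<close> carries a copy
  of every finitely generated \<open>R\<close>-module, and this is enough: the lemma
  \<open>hopf_alpha_pairing.alpha_inj_all\<close> below gives injectivity for \<open>R\<close>-modules over every type.\<close>

locale hopf_alpha_pairing = hopf_pairing R H K \<beta>
  for R :: "('r, 'z) ring_scheme" and H :: "('r, 'h) hopf" and K :: "('r, 'k) hopf"
    and \<beta> :: "'h \<Rightarrow> 'k \<Rightarrow> 'r" +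
  assumes alpha_inj: "\<And>M :: ('r, (nat \<Rightarrow> 'r) set) module. module R M \<Longrightarrow>
      inj_on (alpha_map R H \<beta> M) (carrier (tensor R M K))"

text \<open>A morphism \<open>(\<xi>, \<theta>) : (Y, Z) \<rightarrow> (H, K)\<close>, where \<open>\<beta>\<close> is the form of \<open>(H, K)\<close> and \<open>\<gamma>\<close> that
  of \<open>(Y, Z)\<close>.\<close>

locale pairing_morphism =
  fixes R :: "('r, 'z) ring_scheme"
    and Y :: "('r, 'y) hopf" and Z :: "('r, 'c) hopf" and \<gamma> :: "'y \<Rightarrow> 'c \<Rightarrow> 'r"
    and H :: "('r, 'h) hopf" and K :: "('r, 'k) hopf" and \<beta> :: "'h \<Rightarrow> 'k \<Rightarrow> 'r"
    and \<xi> :: "'h \<Rightarrow> 'y" and \<theta> :: "'c \<Rightarrow> 'k"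
  assumes xi_hom: "\<xi> \<in> bialgebra_homs R H Y"
    and theta_hom: "\<theta> \<in> bialgebra_homs R Z K"
    and adjoint: "\<lbrakk>h \<in> carrier H; z \<in> carrier Z\<rbrakk> \<Longrightarrow> \<gamma> (\<xi> h) z = \<beta> h (\<theta> z)"


section \<open>Modules over algebras and rational modules\<close>

text \<open>A left module over an \<open>R\<close>-algebra is an \<open>R\<close>-module together with an action.\<close>

type_synonym ('r, 'a, 'm) lmod = "('r, 'm) module \<times> ('a \<Rightarrow> 'm \<Rightarrow> 'm)"

locale left_module =
  fixes R :: "('r, 'z) ring_scheme" and A :: "('r, 'a, 'x) module_scheme"
    and M :: "('r, 'm) module" and act :: "'a \<Rightarrow> 'm \<Rightarrow> 'm"
  assumes module: "module R M"
    and act_linear: "a \<in> carrier A \<Longrightarrow> act a \<in> linear_maps R M M"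
    and act_linear_left: "m \<in> carrier M \<Longrightarrow> (\<lambda>a. act a m) \<in> linear_maps R A M"
    and act_mult: "\<lbrakk>a \<in> carrier A; b \<in> carrier A; m \<in> carrier M\<rbrakk> \<Longrightarrow>
      act (a \<otimes>\<^bsub>A\<^esub> b) m = act a (act b m)"
    and act_one: "m \<in> carrier M \<Longrightarrow> act \<one>\<^bsub>A\<^esub> m = m"

definition equivariant_maps ::
  "('r, 'z) ring_scheme \<Rightarrow> ('r, 'a, 'x) module_scheme \<Rightarrow>
   ('r, 'm, 'y) module_scheme \<Rightarrow> ('a \<Rightarrow> 'm \<Rightarrow> 'm) \<Rightarrow>
   ('r, 'n, 'w) module_scheme \<Rightarrow> ('a \<Rightarrow> 'n \<Rightarrow> 'n) \<Rightarrow> ('m \<Rightarrow> 'n) set" where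
  "equivariant_maps R A M actM N actN =
     {f \<in> linear_maps R M N. \<forall>a\<in>carrier A. \<forall>m\<in>carrier M. f (actM a m) = actN a (f m)}"

text \<open>\<open>Hom\<^bsub>A-\<^esub>(M, N)\<close> as a submodule of \<open>Hom\<^sub>R(M, N)\<close>.\<close>

definition equivariant_hom_module ::
  "('r, 'z) ring_scheme \<Rightarrow> ('r, 'a, 'x) module_scheme \<Rightarrow>
   ('r, 'm, 'y) module_scheme \<Rightarrow> ('a \<Rightarrow> 'm \<Rightarrow> 'm) \<Rightarrow>
   ('r, 'n, 'w) module_scheme \<Rightarrow> ('a \<Rightarrow> 'n \<Rightarrow> 'n) \<Rightarrow> ('r, 'm \<Rightarrow> 'n) module" where
  "equivariant_hom_module R A M actM N actN =
     submod (hom_module R M N) (equivariant_maps R A M actM N actN \<inter> extensional (carrier M))"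

definition rational_part ::
  "('r, 'z) ring_scheme \<Rightarrow> ('r, 'h) hopf \<Rightarrow> ('r, 'k) hopf \<Rightarrow> ('h \<Rightarrow> 'k \<Rightarrow> 'r) \<Rightarrow>
   ('r, 'm) module \<Rightarrow> ('h \<Rightarrow> 'm \<Rightarrow> 'm) \<Rightarrow> 'm set" where
  "rational_part R H K \<beta> M act =
     {m \<in> carrier M. (\<lambda>h\<in>carrier H. act h m) \<in> alpha_map R H \<beta> M ` carrier (tensor R M K)}"

definition rational_objects ::
  "('r, 'z) ring_scheme \<Rightarrow> ('r, 'h) hopf \<Rightarrow> ('r, 'k) hopf \<Rightarrow> ('h \<Rightarrow> 'k \<Rightarrow> 'r) \<Rightarrow>
   ('r, 'h, 'm) lmod set" where
  "rational_objects R H K \<beta> =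
     {(M, act). left_module R H M act \<and> rational_part R H K \<beta> M act = carrier M}"

definition lmod_homs ::
  "('r, 'z) ring_scheme \<Rightarrow> ('r, 'a, 'x) module_scheme \<Rightarrow> ('r, 'a, 'm) lmod \<Rightarrow> ('r, 'a, 'n) lmod \<Rightarrow>
   ('m \<Rightarrow> 'n) set" where
  "lmod_homs R A M N = equivariant_maps R A (fst M) (snd M) (fst N) (snd N)"

text \<open>The \<open>K\<close>-coaction \<open>M \<rightarrow> M \<otimes>\<^sub>R K\<close> of a \<open>K\<close>-rational left \<open>H\<close>-module.\<close>

definition rational_coaction ::
  "('r, 'z) ring_scheme \<Rightarrow> ('r, 'h) hopf \<Rightarrow> ('r, 'k) hopf \<Rightarrow> ('h \<Rightarrow> 'k \<Rightarrow> 'r) \<Rightarrow>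
   ('r, 'm) module \<Rightarrow> ('h \<Rightarrow> 'm \<Rightarrow> 'm) \<Rightarrow> 'm \<Rightarrow> ('m, 'k) tensor" where
  "rational_coaction R H K \<beta> M act m =
     the_inv_into (carrier (tensor R M K)) (alpha_map R H \<beta> M) (\<lambda>h\<in>carrier H. act h m)"

definition induced_action ::
  "('h \<Rightarrow> 'k \<Rightarrow> 'r) \<Rightarrow> ('r, 'm) module \<Rightarrow> ('m \<Rightarrow> ('m, 'k) tensor) \<Rightarrow> 'h \<Rightarrow> 'm \<Rightarrow> 'm" where
  "induced_action \<beta> M \<rho> h m = tensor_lift M (\<lambda>x k. \<beta> h k \<odot>\<^bsub>M\<^esub> x) (\<rho> m)"

definition invariants :: "('r, 'h) hopf \<Rightarrow> ('r, 'm) module \<Rightarrow> ('h \<Rightarrow> 'm \<Rightarrow> 'm) \<Rightarrow> 'm set" where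
  "invariants H M act = {m \<in> carrier M. \<forall>h\<in>carrier H. act h m = counit H h \<odot>\<^bsub>M\<^esub> m}"

definition coinvariants ::
  "('r, 'z) ring_scheme \<Rightarrow> ('r, 'k) hopf \<Rightarrow> ('r, 'm) module \<Rightarrow> ('m \<Rightarrow> ('m, 'k) tensor) \<Rightarrow> 'm set" where
  "coinvariants R K M \<rho> = {m \<in> carrier M. \<rho> m = tens R M K m \<one>\<^bsub>K\<^esub>}"


section \<open>Structures on \<open>N \<otimes>\<^sub>R Z\<close> and \<open>Hom\<^sub>R(Y, N)\<close>\<close>

text \<open>The right \<open>K\<close>-coaction \<open>n \<otimes> z \<mapsto> \<Sum> n\<^sub>0 \<otimes> z\<^sub>2 \<otimes> n\<^sub>1 S(\<theta> z\<^sub>1)\<close>.\<close>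

definition twisted_coaction ::
  "('r, 'z) ring_scheme \<Rightarrow> ('r, 'h) hopf \<Rightarrow> ('r, 'k) hopf \<Rightarrow> ('h \<Rightarrow> 'k \<Rightarrow> 'r) \<Rightarrow>
   ('r, 'c) hopf \<Rightarrow> ('c \<Rightarrow> 'k) \<Rightarrow> ('r, 'h, 'n) lmod \<Rightarrow>
   ('n, 'c) tensor \<Rightarrow> (('n, 'c) tensor, 'k) tensor" where
  "twisted_coaction R H K \<beta> Z \<theta> = (\<lambda>(N, act).
     let T = tensor R N Z; TK = tensor R T K in
     tensor_lift TK (\<lambda>n z.
       tensor_lift TK (\<lambda>n0 n1.
         tensor_lift TK (\<lambda>z1 z2. tens R T K (tens R N Z n0 z2) (n1 \<otimes>\<^bsub>K\<^esub> antipode K (\<theta> z1)))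
           (comult Z z))
         (rational_coaction R H K \<beta> N act n)))"

text \<open>The right \<open>Z\<close>-coaction \<open>n \<otimes> z \<mapsto> \<Sum> n \<otimes> z\<^sub>1 \<otimes> z\<^sub>2\<close>, and the \<open>Y\<close>-action
  \<open>y (n \<otimes> z) = \<Sum> n \<otimes> z\<^sub>1 \<langle>y, z\<^sub>2\<rangle>\<close> it induces.\<close>

definition cofree_coaction ::
  "('r, 'z) ring_scheme \<Rightarrow> ('r, 'n) module \<Rightarrow> ('r, 'c) hopf \<Rightarrow>
   ('n, 'c) tensor \<Rightarrow> (('n, 'c) tensor, 'c) tensor" where
  "cofree_coaction R N Z =
     (let T = tensor R N Z; TZ = tensor R T Z in
      tensor_lift TZ (\<lambda>n z.
        tensor_lift TZ (\<lambda>z1 z2. tens R T Z (tens R N Z n z1) z2) (comult Z z)))"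

definition cofree_action ::
  "('r, 'z) ring_scheme \<Rightarrow> ('r, 'c) hopf \<Rightarrow> ('y \<Rightarrow> 'c \<Rightarrow> 'r) \<Rightarrow> ('r, 'n) module \<Rightarrow>
   'y \<Rightarrow> ('n, 'c) tensor \<Rightarrow> ('n, 'c) tensor" where
  "cofree_action R Z \<gamma> N = induced_action \<gamma> (tensor R N Z) (cofree_coaction R N Z)"

definition translation_action :: "('a, 'x) monoid_scheme \<Rightarrow> 'a \<Rightarrow> ('a \<Rightarrow> 'n) \<Rightarrow> 'a \<Rightarrow> 'n" where
  "translation_action Y y f = (\<lambda>y'\<in>carrier Y. f (y' \<otimes>\<^bsub>Y\<^esub> y))"

text \<open>\<open>(h f)(y) = \<Sum> h\<^sub>1 f(S(\<xi> h\<^sub>2) y)\<close>\<close>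

definition twisted_hom_action ::
  "('r, 'h) hopf \<Rightarrow> ('r, 'y) hopf \<Rightarrow> ('h \<Rightarrow> 'y) \<Rightarrow> ('r, 'h, 'n) lmod \<Rightarrow>
   'h \<Rightarrow> ('y \<Rightarrow> 'n) \<Rightarrow> 'y \<Rightarrow> 'n" where
  "twisted_hom_action H Y \<xi> = (\<lambda>(N, act) h f. \<lambda>y\<in>carrier Y.
     tensor_lift N (\<lambda>h1 h2. act h1 (f (antipode Y (\<xi> h2) \<otimes>\<^bsub>Y\<^esub> y))) (comult H h))"

definition cotensor ::
  "('r, 'z) ring_scheme \<Rightarrow> ('r, 'h) hopf \<Rightarrow> ('r, 'k) hopf \<Rightarrow> ('h \<Rightarrow> 'k \<Rightarrow> 'r) \<Rightarrow>
   ('r, 'c) hopf \<Rightarrow> ('c \<Rightarrow> 'k) \<Rightarrow> ('r, 'h, 'n) lmod \<Rightarrow> ('n, 'c) tensor set" where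
  "cotensor R H K \<beta> Z \<theta> = (\<lambda>(N, act).
     let \<rho>N = rational_coaction R H K \<beta> N act;
         \<rho>Z = (\<lambda>z. tensor_map R K Z \<theta> (\<lambda>x. x) (comult Z z));
         NKZ = tensor R N (tensor R K Z)
     in a_kernel (tensor R N Z) NKZ (\<lambda>t.
          tensor_assoc R N K Z (tensor_map R (tensor R N K) Z \<rho>N (\<lambda>x. x) t)
          \<ominus>\<^bsub>NKZ\<^esub> tensor_map R N (tensor R K Z) (\<lambda>x. x) \<rho>Z t))"

text \<open>The enveloping algebra \<open>H\<^sup>e = H \<otimes>\<^sub>R H\<^sup>o\<^sup>p\<close> and its actions on \<open>H\<close> and on \<open>N \<otimes>\<^sub>R Z\<close>.\<close>

definition enveloping_algebra ::
  "('r, 'z) ring_scheme \<Rightarrow> ('r, 'h) hopf \<Rightarrow> ('r, ('h, 'h) tensor) module" where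
  "enveloping_algebra R H = tensor_algebra R H (opposite H)"

definition enveloping_action :: "('r, 'h) hopf \<Rightarrow> ('h, 'h) tensor \<Rightarrow> 'h \<Rightarrow> 'h" where
  "enveloping_action H e x = tensor_lift H (\<lambda>h h'. h \<otimes>\<^bsub>H\<^esub> x \<otimes>\<^bsub>H\<^esub> h') e"

definition enveloping_tensor_action ::
  "('r, 'z) ring_scheme \<Rightarrow> ('r, 'c) hopf \<Rightarrow> ('y \<Rightarrow> 'c \<Rightarrow> 'r) \<Rightarrow> ('h \<Rightarrow> 'y) \<Rightarrow> ('r, 'h, 'n) lmod \<Rightarrow>
   ('h, 'h) tensor \<Rightarrow> ('n, 'c) tensor \<Rightarrow> ('n, 'c) tensor" where
  "enveloping_tensor_action R Z \<gamma> \<xi> = (\<lambda>(N, act) e t.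
     let T = tensor R N Z in
     tensor_lift T (\<lambda>h h'. tensor_lift T (\<lambda>n z.
       tens R N Z (act h n) (tensor_lift Z (\<lambda>z1 z2. \<gamma> (\<xi> h') z1 \<odot>\<^bsub>Z\<^esub> z2) (comult Z z))) t) e)"


section \<open>The functors\<close>

text \<open>Each functor sends an object \<open>N\<close> of \<open>Rat\<^sup>K(\<^sub>H\<M>)\<close> to an \<open>R\<close>-module with a left \<open>Y\<close>-action.\<close>

definition coinv_tensor_fun ::
  "('r, 'z) ring_scheme \<Rightarrow> ('r, 'h) hopf \<Rightarrow> ('r, 'k) hopf \<Rightarrow> ('h \<Rightarrow> 'k \<Rightarrow> 'r) \<Rightarrow>
   ('r, 'c) hopf \<Rightarrow> ('y \<Rightarrow> 'c \<Rightarrow> 'r) \<Rightarrow> ('c \<Rightarrow> 'k) \<Rightarrow>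
   ('r, 'h, 'n) lmod \<Rightarrow> ('r, 'y, ('n, 'c) tensor) lmod" where
  "coinv_tensor_fun R H K \<beta> Z \<gamma> \<theta> N =
     (let T = tensor R (fst N) Z in
      (submod T (coinvariants R K T (twisted_coaction R H K \<beta> Z \<theta> N)),
       cofree_action R Z \<gamma> (fst N)))"

definition inv_tensor_fun ::
  "('r, 'z) ring_scheme \<Rightarrow> ('r, 'h) hopf \<Rightarrow> ('r, 'k) hopf \<Rightarrow> ('h \<Rightarrow> 'k \<Rightarrow> 'r) \<Rightarrow>
   ('r, 'c) hopf \<Rightarrow> ('y \<Rightarrow> 'c \<Rightarrow> 'r) \<Rightarrow> ('c \<Rightarrow> 'k) \<Rightarrow>
   ('r, 'h, 'n) lmod \<Rightarrow> ('r, 'y, ('n, 'c) tensor) lmod" where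
  "inv_tensor_fun R H K \<beta> Z \<gamma> \<theta> N =
     (let T = tensor R (fst N) Z in
      (submod T (invariants H T (induced_action \<beta> T (twisted_coaction R H K \<beta> Z \<theta> N))),
       cofree_action R Z \<gamma> (fst N)))"

definition HOM_R_inv_fun ::
  "('r, 'z) ring_scheme \<Rightarrow> ('r, 'h) hopf \<Rightarrow> ('r, 'y) hopf \<Rightarrow> ('r, 'c) hopf \<Rightarrow>
   ('y \<Rightarrow> 'c \<Rightarrow> 'r) \<Rightarrow> ('h \<Rightarrow> 'y) \<Rightarrow> ('r, 'h, 'n) lmod \<Rightarrow> ('r, 'y, 'y \<Rightarrow> 'n) lmod" where
  "HOM_R_inv_fun R H Y Z \<gamma> \<xi> N =
     (let M = hom_module R Y (fst N);
          HOM = submod M (rational_part R Y Z \<gamma> M (translation_action Y)) in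
      (submod HOM (invariants H HOM (twisted_hom_action H Y \<xi> N)), translation_action Y))"

definition Rat_Hom_inv_fun ::
  "('r, 'z) ring_scheme \<Rightarrow> ('r, 'h) hopf \<Rightarrow> ('r, 'y) hopf \<Rightarrow> ('r, 'c) hopf \<Rightarrow>
   ('y \<Rightarrow> 'c \<Rightarrow> 'r) \<Rightarrow> ('h \<Rightarrow> 'y) \<Rightarrow> ('r, 'h, 'n) lmod \<Rightarrow> ('r, 'y, 'y \<Rightarrow> 'n) lmod" where
  "Rat_Hom_inv_fun R H Y Z \<gamma> \<xi> N =
     (let M = hom_module R Y (fst N);
          M' = submod M (invariants H M (twisted_hom_action H Y \<xi> N)) in
      (submod M' (rational_part R Y Z \<gamma> M' (translation_action Y)), translation_action Y))"

text \<open>\<open>Coind(N) = HOM\<^bsub>H-\<^esub>(Y, N) = Rat\<^sup>Z(\<^sub>Y Hom\<^bsub>H-\<^esub>(Y, N))\<close>\<close>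

definition coind ::
  "('r, 'z) ring_scheme \<Rightarrow> ('r, 'h) hopf \<Rightarrow> ('r, 'y) hopf \<Rightarrow> ('r, 'c) hopf \<Rightarrow>
   ('y \<Rightarrow> 'c \<Rightarrow> 'r) \<Rightarrow> ('h \<Rightarrow> 'y) \<Rightarrow> ('r, 'h, 'n) lmod \<Rightarrow> ('r, 'y, 'y \<Rightarrow> 'n) lmod" where
  "coind R H Y Z \<gamma> \<xi> N =
     (let M = equivariant_hom_module R H Y (\<lambda>h y. \<xi> h \<otimes>\<^bsub>Y\<^esub> y) (fst N) (snd N) in
      (submod M (rational_part R Y Z \<gamma> M (translation_action Y)), translation_action Y))"

definition cotensor_fun ::
  "('r, 'z) ring_scheme \<Rightarrow> ('r, 'h) hopf \<Rightarrow> ('r, 'k) hopf \<Rightarrow> ('h \<Rightarrow> 'k \<Rightarrow> 'r) \<Rightarrow>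
   ('r, 'c) hopf \<Rightarrow> ('y \<Rightarrow> 'c \<Rightarrow> 'r) \<Rightarrow> ('c \<Rightarrow> 'k) \<Rightarrow>
   ('r, 'h, 'n) lmod \<Rightarrow> ('r, 'y, ('n, 'c) tensor) lmod" where
  "cotensor_fun R H K \<beta> Z \<gamma> \<theta> N =
     (submod (tensor R (fst N) Z) (cotensor R H K \<beta> Z \<theta> N), cofree_action R Z \<gamma> (fst N))"

definition bimod_hom_fun ::
  "('r, 'z) ring_scheme \<Rightarrow> ('r, 'h) hopf \<Rightarrow> ('r, 'c) hopf \<Rightarrow>
   ('y \<Rightarrow> 'c \<Rightarrow> 'r) \<Rightarrow> ('h \<Rightarrow> 'y) \<Rightarrow> ('r, 'h, 'n) lmod \<Rightarrow> ('r, 'y, 'h \<Rightarrow> ('n, 'c) tensor) lmod" where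
  "bimod_hom_fun R H Z \<gamma> \<xi> N =
     (equivariant_hom_module R (enveloping_algebra R H) H (enveloping_action H)
        (tensor R (fst N) Z) (enveloping_tensor_action R Z \<gamma> \<xi> N),
      (\<lambda>y g. \<lambda>x\<in>carrier H. cofree_action R Z \<gamma> (fst N) y (g x)))"

text \<open>The maps induced by \<open>f : N \<rightarrow> N'\<close>: \<open>f \<otimes> id\<close> on (submodules of) \<open>N \<otimes>\<^sub>R Z\<close>, and composition
  with \<open>f\<close> or \<open>f \<otimes> id\<close> on the \<open>Hom\<close> modules.\<close>

definition tensor_mor ::
  "('r, 'z) ring_scheme \<Rightarrow> ('r, 'c) hopf \<Rightarrow> ('r, 'h, 'n) lmod \<Rightarrow> ('r, 'h, 'n) lmod \<Rightarrow>
   ('n \<Rightarrow> 'n) \<Rightarrow> ('n, 'c) tensor \<Rightarrow> ('n, 'c) tensor" where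
  "tensor_mor R Z N N' f = tensor_map R (fst N') Z f (\<lambda>x. x)"

definition hom_mor ::
  "('r, 'y) hopf \<Rightarrow> ('r, 'h, 'n) lmod \<Rightarrow> ('r, 'h, 'n) lmod \<Rightarrow>
   ('n \<Rightarrow> 'n) \<Rightarrow> ('y \<Rightarrow> 'n) \<Rightarrow> 'y \<Rightarrow> 'n" where
  "hom_mor Y N N' f g = compose (carrier Y) f g"

definition bimod_hom_mor ::
  "('r, 'z) ring_scheme \<Rightarrow> ('r, 'h) hopf \<Rightarrow> ('r, 'c) hopf \<Rightarrow>
   ('r, 'h, 'n) lmod \<Rightarrow> ('r, 'h, 'n) lmod \<Rightarrow>
   ('n \<Rightarrow> 'n) \<Rightarrow> ('h \<Rightarrow> ('n, 'c) tensor) \<Rightarrow> 'h \<Rightarrow> ('n, 'c) tensor" where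
  "bimod_hom_mor R H Z N N' f g = compose (carrier H) (tensor_mor R Z N N' f) g"

definition lmod_functor ::
  "('r, 'z) ring_scheme \<Rightarrow>
   ('r, 'a, 'x) module_scheme \<Rightarrow> ('r, 'a, 'm) lmod set \<Rightarrow>
   ('r, 'b, 'y) module_scheme \<Rightarrow> ('r, 'b, 'n) lmod set \<Rightarrow>
   (('r, 'a, 'm) lmod \<Rightarrow> ('r, 'b, 'n) lmod) \<Rightarrow>
   (('r, 'a, 'm) lmod \<Rightarrow> ('r, 'a, 'm) lmod \<Rightarrow> ('m \<Rightarrow> 'm) \<Rightarrow> 'n \<Rightarrow> 'n) \<Rightarrow> bool" where
  "lmod_functor R A \<C> B \<D> F Fm \<longleftrightarrow>
     (\<forall>M\<in>\<C>. F M \<in> \<D>) \<and>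
     (\<forall>M\<in>\<C>. \<forall>M'\<in>\<C>. \<forall>f\<in>lmod_homs R A M M'. Fm M M' f \<in> lmod_homs R B (F M) (F M')) \<and>
     (\<forall>M\<in>\<C>. \<forall>x\<in>carrier (fst (F M)). Fm M M (\<lambda>m. m) x = x) \<and>
     (\<forall>M\<in>\<C>. \<forall>M'\<in>\<C>. \<forall>M''\<in>\<C>. \<forall>f\<in>lmod_homs R A M M'. \<forall>g\<in>lmod_homs R A M' M''.
        \<forall>x\<in>carrier (fst (F M)). Fm M M'' (g \<circ> f) x = Fm M' M'' g (Fm M M' f x))"

definition natural_iso ::
  "('r, 'z) ring_scheme \<Rightarrow>
   ('r, 'a, 'x) module_scheme \<Rightarrow> ('r, 'a, 'm) lmod set \<Rightarrow> ('r, 'b, 'y) module_scheme \<Rightarrow>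
   (('r, 'a, 'm) lmod \<Rightarrow> ('r, 'b, 'n) lmod) \<Rightarrow>
   (('r, 'a, 'm) lmod \<Rightarrow> ('r, 'a, 'm) lmod \<Rightarrow> ('m \<Rightarrow> 'm) \<Rightarrow> 'n \<Rightarrow> 'n) \<Rightarrow>
   (('r, 'a, 'm) lmod \<Rightarrow> ('r, 'b, 'p) lmod) \<Rightarrow>
   (('r, 'a, 'm) lmod \<Rightarrow> ('r, 'a, 'm) lmod \<Rightarrow> ('m \<Rightarrow> 'm) \<Rightarrow> 'p \<Rightarrow> 'p) \<Rightarrow> bool" where
  "natural_iso R A \<C> B F Fm G Gm \<longleftrightarrow> (\<exists>\<eta>.
     (\<forall>M\<in>\<C>. \<eta> M \<in> lmod_homs R B (F M) (G M) \<and>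
        bij_betw (\<eta> M) (carrier (fst (F M))) (carrier (fst (G M)))) \<and>
     (\<forall>M\<in>\<C>. \<forall>M'\<in>\<C>. \<forall>f\<in>lmod_homs R A M M'. \<forall>x\<in>carrier (fst (F M)).
        \<eta> M' (Fm M M' f x) = Gm M M' f (\<eta> M x)))"


section \<open>The \<open>\<alpha>\<close>-condition over arbitrary element types\<close>

lemma abelian_group_hom_module:
  assumes "module R M" "module R N"
  shows "abelian_group (hom_module R M N)"
proof -
  interpret M: module R M by fact
  interpret N: module R N by fact
  show ?thesis
  proof (rule abelian_groupI)
    fix f assume "f \<in> carrier (hom_module R M N)"
    then have f: "f \<in> linear_maps R M N" "f \<in> extensional (carrier M)" by (auto simp: hom_module_def)
    let ?g = "\<lambda>x\<in>carrier M. \<ominus>\<^bsub>N\<^esub> f x"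
    have "?g \<in> carrier (hom_module R M N)"
      using f by (auto simp: hom_module_def linear_maps_def Pi_iff N.minus_add N.a_comm N.smult_r_minus)
    moreover have "?g \<oplus>\<^bsub>hom_module R M N\<^esub> f = \<zero>\<^bsub>hom_module R M N\<^esub>"
      using f by (auto simp: hom_module_def linear_maps_def Pi_iff N.l_neg)
    ultimately show "\<exists>g\<in>carrier (hom_module R M N). g \<oplus>\<^bsub>hom_module R M N\<^esub> f = \<zero>\<^bsub>hom_module R M N\<^esub>" by blast
  next
    fix f assume "f \<in> carrier (hom_module R M N)"
    then show "\<zero>\<^bsub>hom_module R M N\<^esub> \<oplus>\<^bsub>hom_module R M N\<^esub> f = f"
      by (auto simp: hom_module_def linear_maps_def Pi_iff fun_eq_iff extensional_def)
  qed (auto simp: hom_module_def linear_maps_def Pi_iff N.a_ac N.smult_r_distr fun_eq_iff)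
qed

lemma hom_module_minus:
  assumes "module R M" "module R N" "f \<in> carrier (hom_module R M N)" "g \<in> carrier (hom_module R M N)"
    and "x \<in> carrier M"
  shows "(f \<ominus>\<^bsub>hom_module R M N\<^esub> g) x = f x \<ominus>\<^bsub>N\<^esub> g x"
proof -
  interpret N: module R N by fact
  interpret L: abelian_group "hom_module R M N" by (rule abelian_group_hom_module) fact+
  let ?u = "f \<ominus>\<^bsub>hom_module R M N\<^esub> g"
  have cl: "u x \<in> carrier N" if "u \<in> carrier (hom_module R M N)" for u
    using that assms(5) by (auto simp: hom_module_def linear_maps_def)
  have "?u \<oplus>\<^bsub>hom_module R M N\<^esub> g = f"
    using assms(3,4) by (simp add: L.minus_eq L.a_assoc L.l_neg)
  moreover have "(u \<oplus>\<^bsub>hom_module R M N\<^esub> g) x = u x \<oplus>\<^bsub>N\<^esub> g x" for u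
    using assms(5) by (simp add: hom_module_def)
  ultimately have "f x \<ominus>\<^bsub>N\<^esub> g x = ?u x \<oplus>\<^bsub>N\<^esub> g x \<ominus>\<^bsub>N\<^esub> g x" by metis
  moreover have "?u x \<in> carrier N" "g x \<in> carrier N"
    using assms(3,4) cl by auto
  ultimately show ?thesis by (simp add: N.minus_eq N.a_assoc N.r_neg)
qed

lemma int_add_pow_0: "add_pow L (0 :: int) x = \<zero>\<^bsub>L\<^esub>"
  by (simp add: add_pow_def)

lemma keys_diff_subset:
  "\<lbrakk>Poly_Mapping.keys a \<subseteq> S; Poly_Mapping.keys b \<subseteq> S\<rbrakk> \<Longrightarrow> Poly_Mapping.keys (a - b :: _ \<Rightarrow>\<^sub>0 int) \<subseteq> S"
  using keys_diff[of a b] by blast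

lemma frag_eval_superset:
  assumes "abelian_group L" "f \<in> U \<rightarrow> V \<rightarrow> carrier L"
    and "finite T" "Poly_Mapping.keys c \<subseteq> T" "T \<subseteq> U \<times> V"
  shows "frag_eval L f c = (\<Oplus>\<^bsub>L\<^esub>p\<in>T. add_pow L (Poly_Mapping.lookup c p) (f (fst p) (snd p)))"
proof -
  interpret abelian_group L by fact
  show ?thesis
    unfolding frag_eval_def
    using assms(2-)
    by (intro add.finprod_mono_neutral_cong_left) (auto simp: in_keys_iff Pi_iff int_add_pow_0)
qed

lemma frag_eval_closed:
  assumes "abelian_group L" "f \<in> U \<rightarrow> V \<rightarrow> carrier L" "Poly_Mapping.keys c \<subseteq> U \<times> V"
  shows "frag_eval L f c \<in> carrier L"
proof -
  interpret abelian_group L by fact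
  show ?thesis
    unfolding frag_eval_def using assms(2-) by (intro finsum_closed) fastforce
qed

lemma frag_eval_add:
  assumes "abelian_group L" "f \<in> U \<rightarrow> V \<rightarrow> carrier L"
    and "Poly_Mapping.keys a \<subseteq> U \<times> V" "Poly_Mapping.keys b \<subseteq> U \<times> V"
  shows "frag_eval L f (a + b) = frag_eval L f a \<oplus>\<^bsub>L\<^esub> frag_eval L f b"
proof -
  interpret abelian_group L by fact
  let ?T = "Poly_Mapping.keys a \<union> Poly_Mapping.keys b"
  have T: "finite ?T" "?T \<subseteq> U \<times> V" using assms by auto
  have f: "f (fst p) (snd p) \<in> carrier L" if "p \<in> ?T" for p
    using that T assms(2) by fastforce
  show ?thesis
    using frag_eval_superset[OF assms(1,2) T(1) _ T(2)] Poly_Mapping.keys_add[of a b] f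
    by (simp add: Poly_Mapping.lookup_add add.int_pow_mult finsum_addf cong: finsum_cong)
qed

lemma frag_eval_frag_of:
  assumes "abelian_group L" "f x y \<in> carrier L"
  shows "frag_eval L f (frag_of (x, y)) = f x y"
proof -
  interpret abelian_group L by fact
  show ?thesis using assms(2) by (simp add: frag_eval_def)
qed

lemma frag_eval_hom:
  assumes "abelian_group L" "f \<in> U \<rightarrow> V \<rightarrow> carrier L"
  shows "group_hom (free_Abelian_group (U \<times> V)) (add_monoid L) (frag_eval L f)"
proof -
  interpret abelian_group L by fact
  show ?thesis
    using frag_eval_closed[OF assms] frag_eval_add[OF assms] add.is_group
    by (auto simp: group_hom_def group_hom_axioms_def hom_def a_group)
qed

lemma frag_eval_diff:
  assumes "abelian_group L" "f \<in> U \<rightarrow> V \<rightarrow> carrier L"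
    and "Poly_Mapping.keys a \<subseteq> U \<times> V" "Poly_Mapping.keys b \<subseteq> U \<times> V"
  shows "frag_eval L f (a - b) = frag_eval L f a \<ominus>\<^bsub>L\<^esub> frag_eval L f b"
proof -
  interpret group_hom "free_Abelian_group (U \<times> V)" "add_monoid L" "frag_eval L f"
    by (rule frag_eval_hom) fact+
  have "frag_eval L f (a + - b) = frag_eval L f a \<oplus>\<^bsub>L\<^esub> frag_eval L f (- b)"
    using assms by (intro frag_eval_add) auto
  moreover have "frag_eval L f (- b) = \<ominus>\<^bsub>L\<^esub> frag_eval L f b"
    using hom_inv[of b] assms(4) by (simp add: a_inv_def)
  ultimately show ?thesis by (simp add: a_minus_def)
qed

definition balanced ::
  "('r, 'z) ring_scheme \<Rightarrow> ('r, 'm, 'x) module_scheme \<Rightarrow> ('r, 'n, 'y) module_scheme \<Rightarrow>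
   ('l, 'w) ring_scheme \<Rightarrow> ('m \<Rightarrow> 'n \<Rightarrow> 'l) \<Rightarrow> bool" where
  "balanced R M N L f \<longleftrightarrow> f \<in> carrier M \<rightarrow> carrier N \<rightarrow> carrier L \<and>
     (\<forall>x\<in>carrier M. \<forall>x'\<in>carrier M. \<forall>y\<in>carrier N. f (x \<oplus>\<^bsub>M\<^esub> x') y = f x y \<oplus>\<^bsub>L\<^esub> f x' y) \<and>
     (\<forall>x\<in>carrier M. \<forall>y\<in>carrier N. \<forall>y'\<in>carrier N. f x (y \<oplus>\<^bsub>N\<^esub> y') = f x y \<oplus>\<^bsub>L\<^esub> f x y') \<and>
     (\<forall>r\<in>carrier R. \<forall>x\<in>carrier M. \<forall>y\<in>carrier N. f (r \<odot>\<^bsub>M\<^esub> x) y = f x (r \<odot>\<^bsub>N\<^esub> y))"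

lemma tensor_relators_subset:
  assumes "module R M" "module R N"
  shows "tensor_relators R M N \<subseteq> carrier (free_Abelian_group (carrier M \<times> carrier N))"
proof -
  interpret M: module R M by fact
  interpret N: module R N by fact
  show ?thesis
    unfolding tensor_relators_def
    by (rule subsetI, elim UnE CollectE exE conjE; simp only: carrier_free_Abelian_group_iff;
        intro keys_diff_subset; simp)
qed

lemma tensor_null_subgroup:
  assumes "module R M" "module R N"
  shows "subgroup (tensor_null R M N) (free_Abelian_group (carrier M \<times> carrier N))"
  unfolding tensor_null_def
  using group.generate_is_subgroup[OF group_free_Abelian_group tensor_relators_subset[OF assms]] .

lemma frag_eval_null:
  assumes "module R M" "module R N" "abelian_group L" "balanced R M N L f"
    and "c \<in> tensor_null R M N"
  shows "frag_eval L f c = \<zero>\<^bsub>L\<^esub>"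
proof -
  interpret M: module R M by fact
  interpret N: module R N by fact
  interpret L: abelian_group L by fact
  have f: "f \<in> carrier M \<rightarrow> carrier N \<rightarrow> carrier L"
    using assms(4) by (simp add: balanced_def)
  then have fc: "\<And>x y. x \<in> carrier M \<Longrightarrow> y \<in> carrier N \<Longrightarrow> f x y \<in> carrier L" by auto
  let ?F = "free_Abelian_group (carrier M \<times> carrier N)"
  interpret h: group_hom ?F "add_monoid L" "frag_eval L f"
    by (rule frag_eval_hom) fact+
  have cl: "frag_of p \<in> carrier ?F" if "p \<in> carrier M \<times> carrier N" for p using that by simp
  have d: "frag_eval L f (a - b) = frag_eval L f a \<ominus>\<^bsub>L\<^esub> frag_eval L f b"
    if "Poly_Mapping.keys a \<subseteq> carrier M \<times> carrier N" "Poly_Mapping.keys b \<subseteq> carrier M \<times> carrier N" for a b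
    using frag_eval_diff[OF assms(3) f that] .
  have z: "a \<oplus>\<^bsub>L\<^esub> (b \<oplus>\<^bsub>L\<^esub> (\<ominus>\<^bsub>L\<^esub> a \<oplus>\<^bsub>L\<^esub> \<ominus>\<^bsub>L\<^esub> b)) = \<zero>\<^bsub>L\<^esub>"
    if "a \<in> carrier L" "b \<in> carrier L" for a b
    using L.r_neg[of "a \<oplus>\<^bsub>L\<^esub> b"] that by (simp add: L.minus_add L.a_assoc)
  have "tensor_relators R M N \<subseteq> kernel ?F (add_monoid L) (frag_eval L f)"
  proof
    fix u assume u: "u \<in> tensor_relators R M N"
    then have "frag_eval L f u = \<zero>\<^bsub>L\<^esub>"
      using assms(4) unfolding tensor_relators_def balanced_def
      by (auto simp: d keys_diff_subset frag_eval_frag_of[OF assms(3)] fc L.minus_eq L.minus_add L.a_assoc L.r_neg z)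
    then show "u \<in> kernel ?F (add_monoid L) (frag_eval L f)"
      using subsetD[OF tensor_relators_subset[OF assms(1,2)] u] by (simp add: kernel_def)
  qed
  then have "tensor_null R M N \<subseteq> kernel ?F (add_monoid L) (frag_eval L f)"
    unfolding tensor_null_def
    by (rule h.generate_subgroup_incl[OF _ h.subgroup_kernel])
  then show ?thesis using assms(5) by (auto simp: kernel_def)
qed

lemma tensor_lift_class:
  assumes "module R M" "module R N" "abelian_group L" "balanced R M N L f"
    and "Poly_Mapping.keys c \<subseteq> carrier M \<times> carrier N"
  shows "tensor_lift L f (tensor_class R M N c) = frag_eval L f c"
proof -
  interpret L: abelian_group L by fact
  have f: "f \<in> carrier M \<rightarrow> carrier N \<rightarrow> carrier L"
    using assms(4) by (simp add: balanced_def)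
  note sub = tensor_null_subgroup[OF assms(1,2)]
  have "frag_eval L f (k + c) = frag_eval L f c" if "k \<in> tensor_null R M N" for k
  proof -
    have "Poly_Mapping.keys k \<subseteq> carrier M \<times> carrier N"
      using subgroup.mem_carrier[OF sub that] by simp
    then show ?thesis
      using frag_eval_add[OF assms(3) f _ assms(5)] frag_eval_null[OF assms(1-4) that]
        frag_eval_closed[OF assms(3) f assms(5)] by simp
  qed
  then have "frag_eval L f ` tensor_class R M N c = {frag_eval L f c}"
    using subgroup.one_closed[OF sub]
    by (force simp: tensor_class_def r_coset_def)
  then show ?thesis by (simp add: tensor_lift_def)
qed

lemma tensor_class_eq_iff:
  assumes "module R M" "module R N"
    and "Poly_Mapping.keys c \<subseteq> carrier M \<times> carrier N" "Poly_Mapping.keys d \<subseteq> carrier M \<times> carrier N"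
  shows "tensor_class R M N c = tensor_class R M N d \<longleftrightarrow> c - d \<in> tensor_null R M N"
proof -
  let ?F = "free_Abelian_group (carrier M \<times> carrier N)"
  interpret F: group ?F by simp
  note sub = tensor_null_subgroup[OF assms(1,2)]
  have "c - d \<in> tensor_null R M N \<longleftrightarrow> c \<in> tensor_class R M N d"
    by (auto simp: tensor_class_def r_coset_def intro!: bexI[of _ "c - d"])
  also have "\<dots> \<longleftrightarrow> tensor_class R M N c = tensor_class R M N d"
    unfolding tensor_class_def using assms(3,4) sub
    by (metis F.rcos_self F.repr_independence carrier_free_Abelian_group_iff)
  finally show ?thesis by simp
qed

lemma carrier_tensor:
  "carrier (tensor R M N) = tensor_class R M N ` {c. Poly_Mapping.keys c \<subseteq> carrier M \<times> carrier N}"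
  by (auto simp: tensor_def Let_def carrier_FactGroup tensor_class_def)

lemma alpha_balanced:
  assumes "module R H" "module R K" "module R M"
    and "\<And>k. k \<in> carrier K \<Longrightarrow> (\<lambda>h. \<beta> h k) \<in> linear_maps R H (regular_module R)"
    and "\<And>h. h \<in> carrier H \<Longrightarrow> \<beta> h \<in> linear_maps R K (regular_module R)"
  shows "balanced R M K (hom_module R H M) (\<lambda>m k. \<lambda>h\<in>carrier H. \<beta> h k \<odot>\<^bsub>M\<^esub> m)"
proof -
  interpret H: module R H by fact
  interpret K: module R K by fact
  interpret M: module R M by fact
  have b: "\<beta> h k \<in> carrier R" if "h \<in> carrier H" "k \<in> carrier K" for h k
    using assms(4)[of k] that by (auto simp: linear_maps_def regular_module_def)
  have l: "\<beta> (h \<oplus>\<^bsub>H\<^esub> h') k = \<beta> h k \<oplus>\<^bsub>R\<^esub> \<beta> h' k"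
    if "h \<in> carrier H" "h' \<in> carrier H" "k \<in> carrier K" for h h' k
    using assms(4)[of k] that by (auto simp: linear_maps_def regular_module_def)
  have l': "\<beta> (r \<odot>\<^bsub>H\<^esub> h) k = r \<otimes>\<^bsub>R\<^esub> \<beta> h k"
    if "h \<in> carrier H" "k \<in> carrier K" "r \<in> carrier R" for h k r
    using assms(4)[of k] that by (auto simp: linear_maps_def regular_module_def)
  have r: "\<beta> h (k \<oplus>\<^bsub>K\<^esub> k') = \<beta> h k \<oplus>\<^bsub>R\<^esub> \<beta> h k'"
    if "h \<in> carrier H" "k \<in> carrier K" "k' \<in> carrier K" for h k k'
    using assms(5)[of h] that by (auto simp: linear_maps_def regular_module_def)
  have r': "\<beta> h (r \<odot>\<^bsub>K\<^esub> k) = r \<otimes>\<^bsub>R\<^esub> \<beta> h k"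
    if "h \<in> carrier H" "k \<in> carrier K" "r \<in> carrier R" for h k r
    using assms(5)[of h] that by (auto simp: linear_maps_def regular_module_def)
  show ?thesis
    unfolding balanced_def
  proof (intro conjI ballI)
    show "(\<lambda>m k. \<lambda>h\<in>carrier H. \<beta> h k \<odot>\<^bsub>M\<^esub> m) \<in> carrier M \<rightarrow> carrier K \<rightarrow> carrier (hom_module R H M)"
      by (auto simp: hom_module_def linear_maps_def b l l' M.smult_l_distr M.smult_assoc1)
  qed (auto simp: hom_module_def fun_eq_iff b r r' M.smult_r_distr M.smult_l_distr
         M.smult_assoc1[symmetric] H.R.m_comm)
qed

lemma frag_extend_null:
  assumes "module R M" "module R M'" "module R N" "f \<in> linear_maps R M M'"
    and "c \<in> tensor_null R M N"
  shows "frag_extend (\<lambda>(x, y). frag_of (f x, y)) c \<in> tensor_null R M' N"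
proof -
  interpret M: module R M by fact
  interpret M': module R M' by fact
  interpret N: module R N by fact
  let ?F = "free_Abelian_group (carrier M \<times> carrier N)"
  let ?e = "frag_extend (\<lambda>(x, y). frag_of (f x, y))"
  interpret F: group ?F by simp
  interpret S: subgroup "tensor_null R M' N" "free_Abelian_group (carrier M' \<times> carrier N)"
    by (rule tensor_null_subgroup) fact+
  have f: "f x \<in> carrier M'" if "x \<in> carrier M" for x
    using assms(4) that by (auto simp: linear_maps_def)
  have keys: "Poly_Mapping.keys u \<subseteq> carrier M' \<times> carrier N" if "u \<in> tensor_null R M' N" for u
    using S.mem_carrier[OF that] by simp
  have "subgroup {u \<in> carrier ?F. ?e u \<in> tensor_null R M' N} ?F"
  proof (rule F.subgroupI)
    show "{u \<in> carrier ?F. ?e u \<in> tensor_null R M' N} \<noteq> {}"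
      using S.one_closed by (auto intro!: exI[of _ 0])
  next
    fix a assume a: "a \<in> {u \<in> carrier ?F. ?e u \<in> tensor_null R M' N}"
    then have "- ?e a \<in> tensor_null R M' N"
      using S.m_inv_closed[of "?e a"] keys by simp
    with a show "inv\<^bsub>?F\<^esub> a \<in> {u \<in> carrier ?F. ?e u \<in> tensor_null R M' N}"
      by (simp add: frag_extend_minus)
  next
    fix a b
    assume "a \<in> {u \<in> carrier ?F. ?e u \<in> tensor_null R M' N}"
      and "b \<in> {u \<in> carrier ?F. ?e u \<in> tensor_null R M' N}"
    then show "a \<otimes>\<^bsub>?F\<^esub> b \<in> {u \<in> carrier ?F. ?e u \<in> tensor_null R M' N}"
      using S.m_closed[of "?e a" "?e b"] F.m_closed[of a b] by (simp add: frag_extend_add)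
  qed blast
  moreover have "tensor_relators R M N \<subseteq> {u \<in> carrier ?F. ?e u \<in> tensor_null R M' N}"
  proof
    fix u assume u: "u \<in> tensor_relators R M N"
    have lin: "f (x \<oplus>\<^bsub>M\<^esub> x') = f x \<oplus>\<^bsub>M'\<^esub> f x'" "f (r \<odot>\<^bsub>M\<^esub> x) = r \<odot>\<^bsub>M'\<^esub> f x"
      if "x \<in> carrier M" "x' \<in> carrier M" "r \<in> carrier R" for x x' r
      using assms(4) that by (auto simp: linear_maps_def)
    from u consider
      (add_left) x x' y where "u = frag_of (x \<oplus>\<^bsub>M\<^esub> x', y) - frag_of (x, y) - frag_of (x', y)"
        "x \<in> carrier M" "x' \<in> carrier M" "y \<in> carrier N"
    | (add_right) x y y' where "u = frag_of (x, y \<oplus>\<^bsub>N\<^esub> y') - frag_of (x, y) - frag_of (x, y')"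
        "x \<in> carrier M" "y \<in> carrier N" "y' \<in> carrier N"
    | (smult) r x y where "u = frag_of (r \<odot>\<^bsub>M\<^esub> x, y) - frag_of (x, r \<odot>\<^bsub>N\<^esub> y)"
        "r \<in> carrier R" "x \<in> carrier M" "y \<in> carrier N"
      unfolding tensor_relators_def by blast
    then have "?e u \<in> tensor_relators R M' N"
    proof cases
      case add_left
      then have "?e u = frag_of (f x \<oplus>\<^bsub>M'\<^esub> f x', y) - frag_of (f x, y) - frag_of (f x', y)"
        by (simp add: frag_extend_diff lin(1)[OF _ _ M.R.zero_closed])
      with add_left f show ?thesis unfolding tensor_relators_def by blast
    next
      case add_right
      then have "?e u = frag_of (f x, y \<oplus>\<^bsub>N\<^esub> y') - frag_of (f x, y) - frag_of (f x, y')"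
        by (simp add: frag_extend_diff)
      with add_right f show ?thesis unfolding tensor_relators_def by blast
    next
      case smult
      then have "?e u = frag_of (r \<odot>\<^bsub>M'\<^esub> f x, y) - frag_of (f x, r \<odot>\<^bsub>N\<^esub> y)"
        by (simp add: frag_extend_diff lin(2)[OF _ M.zero_closed])
      with smult f show ?thesis unfolding tensor_relators_def by blast
    qed
    then show "u \<in> {u \<in> carrier ?F. ?e u \<in> tensor_null R M' N}"
      using subsetD[OF tensor_relators_subset[OF assms(1,3)] u]
      by (simp add: tensor_null_def generate.incl)
  qed
  ultimately have "tensor_null R M N \<subseteq> {u \<in> carrier ?F. ?e u \<in> tensor_null R M' N}"
    unfolding tensor_null_def[of R M N] by (intro F.generate_subgroup_incl)
  then show ?thesis using assms(5) by blast
qed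

lemma module_transport:
  fixes M :: "('r, 'm, 'x) module_scheme" and e :: "'m \<Rightarrow> 'f"
  assumes "module R M" "inj_on e (carrier M)"
  obtains F :: "('r, 'f) module" and d
  where "module R F" "d \<in> linear_maps R F M" "inj_on d (carrier F)"
    and "\<And>x. x \<in> carrier M \<Longrightarrow> e x \<in> carrier F \<and> d (e x) = x"
proof -
  interpret M: module R M by fact
  define d where "d = the_inv_into (carrier M) e"
  have de: "d (e x) = x" if "x \<in> carrier M" for x
    using assms(2) that by (simp add: d_def the_inv_into_f_f)
  define F :: "('r, 'f) module" where
    "F = \<lparr>carrier = e ` carrier M, monoid.mult = undefined, monoid.one = undefined,
       ring.zero = e \<zero>\<^bsub>M\<^esub>, ring.add = (\<lambda>x y. e (d x \<oplus>\<^bsub>M\<^esub> d y)),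
       module.smult = (\<lambda>r x. e (r \<odot>\<^bsub>M\<^esub> d x))\<rparr>"
  have sel: "carrier F = e ` carrier M" "\<zero>\<^bsub>F\<^esub> = e \<zero>\<^bsub>M\<^esub>"
    "x \<oplus>\<^bsub>F\<^esub> y = e (d x \<oplus>\<^bsub>M\<^esub> d y)" "r \<odot>\<^bsub>F\<^esub> x = e (r \<odot>\<^bsub>M\<^esub> d x)" for x y r
    by (simp_all add: F_def)
  have "abelian_group F"
  proof (rule abelian_groupI)
    fix x assume "x \<in> carrier F"
    then obtain m where "m \<in> carrier M" "x = e m" by (auto simp: sel)
    then show "\<exists>y\<in>carrier F. y \<oplus>\<^bsub>F\<^esub> x = \<zero>\<^bsub>F\<^esub>"
      by (intro bexI[of _ "e (\<ominus>\<^bsub>M\<^esub> m)"]) (auto simp: sel de M.l_neg)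
  qed (auto simp: sel de M.a_ac)
  then have "module R F"
    by (intro moduleI M.R.is_cring)
       (auto simp: sel de M.smult_l_distr M.smult_r_distr M.smult_assoc1)
  moreover have "d \<in> linear_maps R F M" "inj_on d (carrier F)"
    by (auto simp: linear_maps_def inj_on_def sel de)
  ultimately show ?thesis
    using that[of F d] by (simp add: sel de)
qed

lemma alpha_natural:
  fixes \<beta> :: "'h \<Rightarrow> 'k \<Rightarrow> 'r"
  assumes mods: "module R H" "module R K" "module R F" "module R M"
    and left: "\<And>k. k \<in> carrier K \<Longrightarrow> (\<lambda>h. \<beta> h k) \<in> linear_maps R H (regular_module R)"
    and right: "\<And>h. h \<in> carrier H \<Longrightarrow> \<beta> h \<in> linear_maps R K (regular_module R)"
    and d: "d \<in> linear_maps R F M" and c: "Poly_Mapping.keys c \<subseteq> carrier F \<times> carrier K"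
    and h: "h \<in> carrier H"
  shows "frag_eval (hom_module R H M) (\<lambda>m k. \<lambda>h\<in>carrier H. \<beta> h k \<odot>\<^bsub>M\<^esub> m)
           (frag_extend (\<lambda>(x, k). frag_of (d x, k)) c) h =
         d (frag_eval (hom_module R H F) (\<lambda>m k. \<lambda>h\<in>carrier H. \<beta> h k \<odot>\<^bsub>F\<^esub> m) c h)"
proof -
  let ?gM = "\<lambda>m k. \<lambda>h\<in>carrier H. \<beta> h k \<odot>\<^bsub>M\<^esub> m" and ?gF = "\<lambda>m k. \<lambda>h\<in>carrier H. \<beta> h k \<odot>\<^bsub>F\<^esub> m"
  let ?e = "frag_extend (\<lambda>(x, k). frag_of (d x, k))"
  interpret M: module R M by fact
  interpret F: module R F by fact
  have gM: "?gM \<in> carrier M \<rightarrow> carrier K \<rightarrow> carrier (hom_module R H M)"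
    by (rule conjunct1[OF alpha_balanced[OF mods(1,2,4) left right, unfolded balanced_def]])
  have gF: "?gF \<in> carrier F \<rightarrow> carrier K \<rightarrow> carrier (hom_module R H F)"
    by (rule conjunct1[OF alpha_balanced[OF mods(1,2,3) left right, unfolded balanced_def]])
  note aM = abelian_group_hom_module[OF mods(1,4)] and aF = abelian_group_hom_module[OF mods(1,3)]
  have dc: "d x \<in> carrier M" if "x \<in> carrier F" for x using d that by (auto simp: linear_maps_def)
  have keys: "Poly_Mapping.keys (?e u) \<subseteq> carrier M \<times> carrier K"
    if "Poly_Mapping.keys u \<subseteq> carrier F \<times> carrier K" for u
    by (rule order_trans[OF keys_frag_extend]) (use that dc in \<open>auto split: prod.splits\<close>)
  have val: "u h \<in> carrier N" if "u \<in> carrier (hom_module R H N)" for u and N :: "('r, 'q, 'w) module_scheme"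
    using that h by (auto simp: hom_module_def linear_maps_def)
  have diffF: "d (x \<ominus>\<^bsub>F\<^esub> y) = d x \<ominus>\<^bsub>M\<^esub> d y" if "x \<in> carrier F" "y \<in> carrier F" for x y
  proof -
    have "d (x \<ominus>\<^bsub>F\<^esub> y) \<oplus>\<^bsub>M\<^esub> d y = d (x \<ominus>\<^bsub>F\<^esub> y \<oplus>\<^bsub>F\<^esub> y)"
      using d that by (auto simp: linear_maps_def)
    also have "x \<ominus>\<^bsub>F\<^esub> y \<oplus>\<^bsub>F\<^esub> y = x" using that by (simp add: F.minus_eq F.a_assoc F.l_neg)
    finally have "d (x \<ominus>\<^bsub>F\<^esub> y) \<oplus>\<^bsub>M\<^esub> d y \<ominus>\<^bsub>M\<^esub> d y = d x \<ominus>\<^bsub>M\<^esub> d y" by simp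
    then show ?thesis using that dc by (simp add: M.minus_eq M.a_assoc M.r_neg)
  qed
  show ?thesis
  proof (rule free_Abelian_group_induct[OF c])
    have "d \<zero>\<^bsub>F\<^esub> = \<zero>\<^bsub>M\<^esub>"
      using diffF[of "\<zero>\<^bsub>F\<^esub>" "\<zero>\<^bsub>F\<^esub>"] dc
      by (simp only: a_minus_def F.r_neg M.r_neg F.zero_closed)
    then show "frag_eval (hom_module R H M) ?gM (?e 0) h = d (frag_eval (hom_module R H F) ?gF 0 h)"
      using h aM aF by (simp add: frag_eval_def abelian_group_def abelian_monoid.finsum_empty)
        (simp add: hom_module_def)
  next
    fix a b
    assume ab: "Poly_Mapping.keys a \<subseteq> carrier F \<times> carrier K" "Poly_Mapping.keys b \<subseteq> carrier F \<times> carrier K"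
      and IH: "frag_eval (hom_module R H M) ?gM (?e a) h = d (frag_eval (hom_module R H F) ?gF a h)"
        "frag_eval (hom_module R H M) ?gM (?e b) h = d (frag_eval (hom_module R H F) ?gF b h)"
    note clM = frag_eval_closed[OF aM gM keys] and clF = frag_eval_closed[OF aF gF]
    have "frag_eval (hom_module R H M) ?gM (?e (a - b)) h =
        frag_eval (hom_module R H M) ?gM (?e a) h \<ominus>\<^bsub>M\<^esub> frag_eval (hom_module R H M) ?gM (?e b) h"
      using ab by (simp add: frag_extend_diff frag_eval_diff[OF aM gM] keys
          hom_module_minus[OF mods(1,4)] clM h)
    also have "\<dots> = d (frag_eval (hom_module R H F) ?gF (a - b) h)"
      using ab by (simp add: IH frag_eval_diff[OF aF gF] hom_module_minus[OF mods(1,3)] clF h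
          diffF val)
    finally show "frag_eval (hom_module R H M) ?gM (?e (a - b)) h =
        d (frag_eval (hom_module R H F) ?gF (a - b) h)" .
  next
    fix p assume p: "p \<in> carrier F \<times> carrier K"
    obtain x k where xk: "p = (x, k)" "x \<in> carrier F" "k \<in> carrier K" using p by auto
    have "?gM (d x) k \<in> carrier (hom_module R H M)" "?gF x k \<in> carrier (hom_module R H F)"
      using gM gF xk dc by auto
    moreover have "\<beta> h k \<in> carrier R"
      using left[OF xk(3)] h by (auto simp: linear_maps_def regular_module_def)
    ultimately show "frag_eval (hom_module R H M) ?gM (?e (frag_of p)) h =
        d (frag_eval (hom_module R H F) ?gF (frag_of p) h)"
      using h d xk by (simp add: frag_eval_frag_of[OF aM] frag_eval_frag_of[OF aF] linear_maps_def)
  qed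
qed

context hopf_alpha_pairing
begin

lemma alpha_inj_all:
  fixes M :: "('r, 'm, 'x) module_scheme"
  assumes M: "module R M"
  shows "inj_on (alpha_map R H \<beta> M) (carrier (tensor R M K))"
proof (rule inj_onI)
  interpret M: module R M by fact
  have H: "module R H" and K: "module R K"
    using bialgebra_H bialgebra_K by (auto simp: bialgebra_def assoc_algebra_def)
  fix s t
  assume "s \<in> carrier (tensor R M K)" "t \<in> carrier (tensor R M K)"
    and st: "alpha_map R H \<beta> M s = alpha_map R H \<beta> M t"
  then obtain a b where ab: "s = tensor_class R M K a" "Poly_Mapping.keys a \<subseteq> carrier M \<times> carrier K"
      "t = tensor_class R M K b" "Poly_Mapping.keys b \<subseteq> carrier M \<times> carrier K"
    by (auto simp: carrier_tensor)
  define P where "P = fst ` (Poly_Mapping.keys a \<union> Poly_Mapping.keys b)"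
  have P: "finite P" "P \<subseteq> carrier M" using ab by (auto simp: P_def)
  obtain n p where p: "bij_betw p {..<n::nat} P"
    using ex_bij_betw_nat_finite[OF P(1)] by (auto simp: atLeast0LessThan)
  have pc: "p i \<in> carrier M" if "i < n" for i
    using bij_betwE[OF p] P that by auto
  define E where "E = {..<n} \<rightarrow>\<^sub>E carrier R"
  define lc where "lc r = (\<Oplus>\<^bsub>M\<^esub>i\<in>{..<n}. r i \<odot>\<^bsub>M\<^esub> p i)" for r
  have Ec: "r i \<in> carrier R" if "r \<in> E" "i < n" for r i using that by (auto simp: E_def)
  have lc_closed: "lc r \<in> carrier M" if "r \<in> E" for r
    unfolding lc_def using that pc Ec by (intro M.finsum_closed) auto
  have lc_add: "lc (\<lambda>i\<in>{..<n}. r i \<oplus>\<^bsub>R\<^esub> r' i) = lc r \<oplus>\<^bsub>M\<^esub> lc r'" if "r \<in> E" "r' \<in> E" for r r'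
  proof -
    have "lc (\<lambda>i\<in>{..<n}. r i \<oplus>\<^bsub>R\<^esub> r' i) = (\<Oplus>\<^bsub>M\<^esub>i\<in>{..<n}. r i \<odot>\<^bsub>M\<^esub> p i \<oplus>\<^bsub>M\<^esub> r' i \<odot>\<^bsub>M\<^esub> p i)"
      unfolding lc_def using that pc Ec
      by (intro M.finsum_cong') (auto simp: M.smult_l_distr)
    also have "\<dots> = lc r \<oplus>\<^bsub>M\<^esub> lc r'"
      unfolding lc_def using that pc Ec by (intro M.finsum_addf) auto
    finally show ?thesis .
  qed
  have lc_smult: "lc (\<lambda>i\<in>{..<n}. q \<otimes>\<^bsub>R\<^esub> r i) = q \<odot>\<^bsub>M\<^esub> lc r" if "r \<in> E" "q \<in> carrier R" for q r
  proof -
    have "lc (\<lambda>i\<in>{..<n}. q \<otimes>\<^bsub>R\<^esub> r i) = (\<Oplus>\<^bsub>M\<^esub>i\<in>{..<n}. q \<odot>\<^bsub>M\<^esub> (r i \<odot>\<^bsub>M\<^esub> p i))"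
      unfolding lc_def using that pc Ec
      by (intro M.finsum_cong') (auto simp: M.smult_assoc1)
    also have "\<dots> = q \<odot>\<^bsub>M\<^esub> lc r"
      unfolding lc_def using that pc Ec by (intro M.finsum_smult_ldistr[symmetric]) auto
    finally show ?thesis .
  qed
  have E_add: "(\<lambda>i\<in>{..<n}. r i \<oplus>\<^bsub>R\<^esub> r' i) \<in> E" if "r \<in> E" "r' \<in> E" for r r'
    using that by (auto simp: E_def)
  have E_smult: "(\<lambda>i\<in>{..<n}. q \<otimes>\<^bsub>R\<^esub> r i) \<in> E" if "r \<in> E" "q \<in> carrier R" for q r
    using that by (auto simp: E_def)
  have sub: "submodule (lc ` E) R M"
  proof (rule M.submoduleI)
    have z: "(\<lambda>i\<in>{..<n}. \<zero>\<^bsub>R\<^esub>) \<in> E" by (auto simp: E_def)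
    have "lc (\<lambda>i\<in>{..<n}. \<zero>\<^bsub>R\<^esub> \<otimes>\<^bsub>R\<^esub> (\<lambda>i\<in>{..<n}. \<zero>\<^bsub>R\<^esub>) i) = \<zero>\<^bsub>M\<^esub>"
      using lc_smult[OF z M.R.zero_closed] lc_closed[OF z] by simp
    then show "\<zero>\<^bsub>M\<^esub> \<in> lc ` E"
      using E_smult[OF z M.R.zero_closed] by (metis image_eqI)
  next
    fix x assume "x \<in> lc ` E"
    then obtain r where r: "r \<in> E" "x = lc r" by auto
    have "lc (\<lambda>i\<in>{..<n}. \<ominus>\<^bsub>R\<^esub> \<one>\<^bsub>R\<^esub> \<otimes>\<^bsub>R\<^esub> r i) = \<ominus>\<^bsub>M\<^esub> x"
      using lc_smult[OF r(1)] lc_closed[OF r(1)] r(2) by (simp add: M.smult_l_minus)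
    then show "\<ominus>\<^bsub>M\<^esub> x \<in> lc ` E"
      using E_smult[OF r(1)] by (metis image_eqI M.R.a_inv_closed M.R.one_closed)
  next
    fix x y assume "x \<in> lc ` E" "y \<in> lc ` E"
    then show "x \<oplus>\<^bsub>M\<^esub> y \<in> lc ` E" using lc_add E_add by (auto simp flip: lc_add)
  next
    fix q x assume "q \<in> carrier R" "x \<in> lc ` E"
    then show "q \<odot>\<^bsub>M\<^esub> x \<in> lc ` E" using lc_smult E_smult by (auto simp flip: lc_smult)
  qed (use lc_closed in auto)
  let ?M' = "M\<lparr>carrier := lc ` E\<rparr>"
  have P_lc: "P \<subseteq> lc ` E"
  proof
    fix x assume "x \<in> P"
    then obtain j where j: "j < n" "x = p j" using p by (auto simp: bij_betw_def)
    let ?r = "\<lambda>i\<in>{..<n}. if i = j then \<one>\<^bsub>R\<^esub> else \<zero>\<^bsub>R\<^esub>"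
    have "lc ?r = (\<Oplus>\<^bsub>M\<^esub>i\<in>{..<n}. if j = i then p i else \<zero>\<^bsub>M\<^esub>)"
      unfolding lc_def using pc by (intro M.finsum_cong') auto
    also have "\<dots> = x" using j pc by (subst M.add.finprod_singleton) auto
    finally show "x \<in> lc ` E" by (intro image_eqI[of _ _ ?r]) (auto simp: E_def)
  qed
  define e where "e x = {r \<in> E. lc r = x}" for x
  have "inj_on e (carrier ?M')"
    by (auto simp: inj_on_def e_def)
  then obtain F :: "('r, (nat \<Rightarrow> 'r) set) module" and d
    where F: "module R F" and d': "d \<in> linear_maps R F ?M'" and dinj: "inj_on d (carrier F)"
      and de: "\<And>x. x \<in> lc ` E \<Longrightarrow> e x \<in> carrier F \<and> d (e x) = x"
    using module_transport[OF submodule.submodule_is_module[OF sub M]] by auto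
  have d: "d \<in> linear_maps R F M"
    using d' submodule.axioms(1)[OF sub, THEN subgroup.subset] by (auto simp: linear_maps_def Pi_iff)
  let ?d = "frag_extend (\<lambda>(x, k). frag_of (d x, k))" and ?e = "frag_extend (\<lambda>(x, k). frag_of (e x, k))"
  have keys: "Poly_Mapping.keys (?e c) \<subseteq> carrier F \<times> carrier K" and inv: "?d (?e c) = c"
    if "c \<in> {a, b}" for c
  proof -
    have c: "x \<in> lc ` E" "k \<in> carrier K" if "(x, k) \<in> Poly_Mapping.keys c" for x k
    proof -
      have "x \<in> P" using that \<open>c \<in> {a, b}\<close> by (force simp: P_def)
      then show "x \<in> lc ` E" using P_lc by blast
      show "k \<in> carrier K" using ab that \<open>c \<in> {a, b}\<close> by auto
    qed
    show "Poly_Mapping.keys (?e c) \<subseteq> carrier F \<times> carrier K"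
      by (rule order_trans[OF keys_frag_extend]) (use c de in \<open>auto split: prod.splits\<close>)
    have "?d (?e c) = ?d (frag_extend (frag_of \<circ> (\<lambda>(x, k). (e x, k))) c)"
      by (intro arg_cong[of _ _ ?d] frag_extend_eq) auto
    also have "\<dots> = frag_extend frag_of c"
      unfolding frag_extend_compose by (intro frag_extend_eq) (use c de in auto)
    finally show "?d (?e c) = c" using frag_expansion[of c] by simp
  qed
  note balF = alpha_balanced[OF H K F linear_left linear_right]
    and balM = alpha_balanced[OF H K M linear_left linear_right]
  note aF = abelian_group_hom_module[OF H F] and aM = abelian_group_hom_module[OF H M]
  let ?g = "\<lambda>m k. \<lambda>h\<in>carrier H. \<beta> h k \<odot>\<^bsub>F\<^esub> m" and ?gM = "\<lambda>m k. \<lambda>h\<in>carrier H. \<beta> h k \<odot>\<^bsub>M\<^esub> m"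
  have gF: "?g \<in> carrier F \<rightarrow> carrier K \<rightarrow> carrier (hom_module R H F)"
    by (rule conjunct1[OF balF[unfolded balanced_def]])
  have alF: "alpha_map R H \<beta> F (tensor_class R F K (?e c)) = frag_eval (hom_module R H F) ?g (?e c)"
    if "c \<in> {a, b}" for c
    unfolding alpha_map_def using tensor_lift_class[OF F K aF balF keys[OF that]] .
  have evM: "frag_eval (hom_module R H M) ?gM a = frag_eval (hom_module R H M) ?gM b"
    using st ab tensor_lift_class[OF M K aM balM] by (simp add: alpha_map_def)
  have "frag_eval (hom_module R H F) ?g (?e a) = frag_eval (hom_module R H F) ?g (?e b)"
  proof (rule extensionalityI[where A = "carrier H"])
    have cl: "frag_eval (hom_module R H F) ?g (?e c) \<in> carrier (hom_module R H F)" if "c \<in> {a, b}" for c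
      using frag_eval_closed[OF aF gF keys[OF that]] .
    then show "frag_eval (hom_module R H F) ?g (?e a) \<in> extensional (carrier H)"
      and "frag_eval (hom_module R H F) ?g (?e b) \<in> extensional (carrier H)"
      by (auto simp: hom_module_def)
    fix h assume h: "h \<in> carrier H"
    have nat: "frag_eval (hom_module R H M) ?gM c h = d (frag_eval (hom_module R H F) ?g (?e c) h)"
      if "c \<in> {a, b}" for c
      using alpha_natural[OF H K F M linear_left linear_right d keys[OF that] h] inv[OF that] by simp
    have "frag_eval (hom_module R H F) ?g (?e c) h \<in> carrier F" if "c \<in> {a, b}" for c
      using cl[OF that] h by (auto simp: hom_module_def linear_maps_def)
    then show "frag_eval (hom_module R H F) ?g (?e a) h = frag_eval (hom_module R H F) ?g (?e b) h"
      using nat[of a] nat[of b] evM dinj by (auto dest: inj_onD)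
  qed
  then have "alpha_map R H \<beta> F (tensor_class R F K (?e a)) = alpha_map R H \<beta> F (tensor_class R F K (?e b))"
    using alF[of a] alF[of b] by (metis insertI1 insertI2)
  then have "tensor_class R F K (?e a) = tensor_class R F K (?e b)"
    by (rule inj_onD[OF alpha_inj[OF F]]) (use keys in \<open>simp_all add: carrier_tensor\<close>)
  then have "?e a - ?e b \<in> tensor_null R F K"
    using tensor_class_eq_iff[OF F K keys[of a] keys[of b]] by simp
  from frag_extend_null[OF F M K d this] have "a - b \<in> tensor_null R M K"
    using inv[of a] inv[of b] by (simp add: frag_extend_diff)
  then show "s = t"
    using tensor_class_eq_iff[OF M K ab(2,4)] ab(1,3) by simp
qed

end

end

theory Submission
  imports Defs
begin

text \<open>For \<open>t = \<Sum> n\<^sub>i \<otimes> z\<^sub>i\<close> in \<open>N \<otimes>\<^sub>R Z\<close> write \<open>ev y t = \<Sum> \<langle>y, z\<^sub>i\<rangle> n\<^sub>i\<close>. The \<open>\<alpha>\<close>-condition for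
  \<open>(Y, Z)\<close> says that \<open>t\<close> is determined by the map \<open>y \<mapsto> ev y t\<close> in \<open>Hom\<^sub>R(Y, N)\<close>, so identities
  between tensors can be checked after evaluation, where they become identities between sums over
  coproducts with values in \<open>N\<close>. All functors of the theorem are governed by one submodule,
  \<open>E(N) = {t. h (ev y t) = ev (\<xi>(h) y) t for all h, y}\<close>, the tensors whose associated map \<open>Y \<rightarrow> N\<close> is
  \<open>H\<close>-linear: those inside \<open>N \<otimes>\<^sub>R Z\<close> are equal to \<open>E(N)\<close>, those inside \<open>Hom\<^sub>R(Y, N)\<close> are equal to
  \<open>\<alpha>(E(N))\<close>, and the map \<open>\<alpha>\<close> itself is the isomorphism between the two groups.

  The cotensor product is the equaliser of two maps into \<open>N \<otimes> K \<otimes> Z\<close>. At \<open>(h, y)\<close> these evaluate to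
  \<open>h (ev y t)\<close> and \<open>ev (\<xi>(h) y) t\<close>, and evaluation is injective there by the \<open>\<alpha>\<close>-conditions of both
  pairings (\<open>cotensor_equivariant\<close>).

  The \<open>H\<close>-action induced by the twisted coaction satisfies \<open>ev y (h t) = \<Sum> h\<^sub>1 ev (S(\<xi> h\<^sub>2) y) t\<close>
  (\<open>eval_twisted\<close>), hence \<open>\<alpha>\<close> carries it to the twisted action on \<open>Hom\<^sub>R(Y, N)\<close>. This rests on
  \<open>\<langle>S(\<xi> h), z\<rangle> = \<langle>h, S(\<theta> z)\<rangle>\<close>: both sides are convolution inverses of \<open>\<langle>\<xi> h, z\<rangle>\<close>
  (\<open>antipode_adjoint\<close>). The antipode axioms then identify the invariants with the \<open>H\<close>-linear maps
  (\<open>twisted_act_invariant_iff\<close>), while coinvariants and invariants agree by the \<open>\<alpha>\<close>-condition for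
  \<open>(H, K)\<close>.

  On the side of \<open>Hom\<close>, a rational map is recovered from its rational expansion by evaluating at
  \<open>1\<close>, so \<open>Rat(Hom\<^sub>R(Y, N))\<close> is the image of \<open>\<alpha>\<close> (\<open>rational_part_hom\<close>). Moreover
  \<open>Rat(S) = S \<inter> Rat(M)\<close> for every stable submodule \<open>S\<close> of \<open>M\<close> (\<open>rational_part_submod\<close>): the
  \<open>\<alpha>\<close>-condition for \<open>M/S\<close> and right exactness of the tensor product force a tensor in \<open>M \<otimes> Z\<close> with
  all evaluations in \<open>S\<close> to come from \<open>S \<otimes> Z\<close>. Therefore invariants and rational parts may be taken
  in either order.

  Finally a bimodule map \<open>g : H \<rightarrow> N \<otimes> Z\<close> is determined by \<open>g(1)\<close>, and \<open>h g(1) = g(1) h\<close> evaluates to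
  the condition that defines \<open>E(N)\<close> (\<open>bimod_hom_at_one\<close>).\<close>

section \<open>Linear and bilinear maps\<close>

lemma linear_mapsI:
  assumes "\<And>x. x \<in> carrier M \<Longrightarrow> f x \<in> carrier N"
    and "\<And>x y. \<lbrakk>x \<in> carrier M; y \<in> carrier M\<rbrakk> \<Longrightarrow> f (x \<oplus>\<^bsub>M\<^esub> y) = f x \<oplus>\<^bsub>N\<^esub> f y"
    and "\<And>r x. \<lbrakk>r \<in> carrier R; x \<in> carrier M\<rbrakk> \<Longrightarrow> f (r \<odot>\<^bsub>M\<^esub> x) = r \<odot>\<^bsub>N\<^esub> f x"
  shows "f \<in> linear_maps R M N"
  using assms by (auto simp: linear_maps_def)

lemma linear_closed: "\<lbrakk>f \<in> linear_maps R M N; x \<in> carrier M\<rbrakk> \<Longrightarrow> f x \<in> carrier N"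
  by (auto simp: linear_maps_def)

lemma linear_add:
  "\<lbrakk>f \<in> linear_maps R M N; x \<in> carrier M; y \<in> carrier M\<rbrakk> \<Longrightarrow> f (x \<oplus>\<^bsub>M\<^esub> y) = f x \<oplus>\<^bsub>N\<^esub> f y"
  by (auto simp: linear_maps_def)

lemma linear_smult:
  "\<lbrakk>f \<in> linear_maps R M N; r \<in> carrier R; x \<in> carrier M\<rbrakk> \<Longrightarrow> f (r \<odot>\<^bsub>M\<^esub> x) = r \<odot>\<^bsub>N\<^esub> f x"
  by (auto simp: linear_maps_def)

lemma linear_zero:
  assumes "module R M" "module R N" "f \<in> linear_maps R M N"
  shows "f \<zero>\<^bsub>M\<^esub> = \<zero>\<^bsub>N\<^esub>"
proof -
  interpret M: module R M by fact
  interpret N: module R N by fact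
  have "f (\<zero>\<^bsub>R\<^esub> \<odot>\<^bsub>M\<^esub> \<zero>\<^bsub>M\<^esub>) = \<zero>\<^bsub>R\<^esub> \<odot>\<^bsub>N\<^esub> f \<zero>\<^bsub>M\<^esub>"
    using assms(3) by (rule linear_smult) auto
  then show ?thesis using linear_closed[OF assms(3)] by simp
qed

lemma linear_neg:
  assumes "module R M" "module R N" "f \<in> linear_maps R M N" "x \<in> carrier M"
  shows "f (\<ominus>\<^bsub>M\<^esub> x) = \<ominus>\<^bsub>N\<^esub> f x"
proof -
  interpret M: module R M by fact
  interpret N: module R N by fact
  have "f ((\<ominus>\<^bsub>R\<^esub> \<one>\<^bsub>R\<^esub>) \<odot>\<^bsub>M\<^esub> x) = (\<ominus>\<^bsub>R\<^esub> \<one>\<^bsub>R\<^esub>) \<odot>\<^bsub>N\<^esub> f x"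
    using assms(3) by (rule linear_smult) (use assms(4) in auto)
  then show ?thesis using linear_closed[OF assms(3)] assms(4)
    by (simp add: M.smult_l_minus N.smult_l_minus)
qed

lemma linear_id: "(\<lambda>x. x) \<in> linear_maps R M M"
  by (auto simp: linear_maps_def)

lemma linear_compose:
  "\<lbrakk>g \<in> linear_maps R N L; f \<in> linear_maps R M N\<rbrakk> \<Longrightarrow> (\<lambda>x. g (f x)) \<in> linear_maps R M L"
  by (auto simp: linear_maps_def Pi_iff)

lemma linear_cong:
  assumes "module R M" "f \<in> linear_maps R M N" "\<And>x. x \<in> carrier M \<Longrightarrow> g x = f x"
  shows "g \<in> linear_maps R M N"
proof -
  interpret M: module R M by fact
  show ?thesis
    by (rule linear_mapsI) (simp_all add: assms linear_closed[OF assms(2)] linear_add[OF assms(2)]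
        linear_smult[OF assms(2)])
qed

lemma linear_smult_right:
  assumes "module R L" "c \<in> carrier R" "f \<in> linear_maps R M L"
  shows "(\<lambda>x. c \<odot>\<^bsub>L\<^esub> f x) \<in> linear_maps R M L"
proof -
  interpret L: module R L by fact
  show ?thesis
    by (rule linear_mapsI)
      (use assms(2) in \<open>auto simp: linear_closed[OF assms(3)] linear_add[OF assms(3)]
        linear_smult[OF assms(3)] L.smult_r_distr L.R.m_comm simp flip: L.smult_assoc1\<close>)
qed

lemma linear_smult_left:
  assumes "module R L" "n \<in> carrier L" "p \<in> linear_maps R M (regular_module R)"
  shows "(\<lambda>x. p x \<odot>\<^bsub>L\<^esub> n) \<in> linear_maps R M L"
proof -
  interpret L: module R L by fact
  have p: "p x \<in> carrier R" if "x \<in> carrier M" for x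
    using linear_closed[OF assms(3) that] by (simp add: regular_module_def)
  show ?thesis
    by (rule linear_mapsI)
      (use assms(2) in \<open>auto simp: p linear_add[OF assms(3)] linear_smult[OF assms(3)]
        L.smult_l_distr L.smult_assoc1, auto simp: regular_module_def p L.smult_l_distr L.smult_assoc1\<close>)
qed

lemma module_regular: "cring R \<Longrightarrow> module R (regular_module R)"
proof -
  assume "cring R"
  then interpret cring R .
  have "abelian_group (regular_module R)"
    by (rule abelian_groupI) (auto simp: regular_module_def a_ac intro: l_neg)
  then show ?thesis
    by (intro moduleI) (auto simp: regular_module_def l_distr r_distr m_assoc is_cring)
qed

lemma regular_module_simps [simp]:
  "carrier (regular_module R) = carrier R" "a \<odot>\<^bsub>regular_module R\<^esub> b = a \<otimes>\<^bsub>R\<^esub> b"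
  "a \<oplus>\<^bsub>regular_module R\<^esub> b = a \<oplus>\<^bsub>R\<^esub> b" "a \<otimes>\<^bsub>regular_module R\<^esub> b = a \<otimes>\<^bsub>R\<^esub> b"
  "\<one>\<^bsub>regular_module R\<^esub> = \<one>\<^bsub>R\<^esub>" "\<zero>\<^bsub>regular_module R\<^esub> = \<zero>\<^bsub>R\<^esub>"
  by (simp_all add: regular_module_def)

definition bilinear ::
  "('r, 'z) ring_scheme \<Rightarrow> ('r, 'm, 'x) module_scheme \<Rightarrow> ('r, 'n, 'y) module_scheme \<Rightarrow>
   ('r, 'l, 'w) module_scheme \<Rightarrow> ('m \<Rightarrow> 'n \<Rightarrow> 'l) \<Rightarrow> bool" where
  "bilinear R M N L f \<longleftrightarrow> (\<forall>x\<in>carrier M. (\<lambda>y. f x y) \<in> linear_maps R N L) \<and>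
     (\<forall>y\<in>carrier N. (\<lambda>x. f x y) \<in> linear_maps R M L)"

lemma bilinearI:
  assumes "\<And>x. x \<in> carrier M \<Longrightarrow> (\<lambda>y. f x y) \<in> linear_maps R N L"
    and "\<And>y. y \<in> carrier N \<Longrightarrow> (\<lambda>x. f x y) \<in> linear_maps R M L"
  shows "bilinear R M N L f"
  using assms by (simp add: bilinear_def)

lemma bilinear_left: "\<lbrakk>bilinear R M N L f; y \<in> carrier N\<rbrakk> \<Longrightarrow> (\<lambda>x. f x y) \<in> linear_maps R M L"
  and bilinear_right: "\<lbrakk>bilinear R M N L f; x \<in> carrier M\<rbrakk> \<Longrightarrow> (\<lambda>y. f x y) \<in> linear_maps R N L"
  by (auto simp: bilinear_def)

lemma bilinear_closed:
  "\<lbrakk>bilinear R M N L f; x \<in> carrier M; y \<in> carrier N\<rbrakk> \<Longrightarrow> f x y \<in> carrier L"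
  by (auto simp: bilinear_def linear_maps_def)

lemma bilinear_balanced:
  assumes "bilinear R M N L f"
  shows "balanced R M N L f"
  using assms unfolding balanced_def bilinear_def linear_maps_def by auto

lemma bilinear_compose:
  "\<lbrakk>\<phi> \<in> linear_maps R L L'; bilinear R M N L f\<rbrakk> \<Longrightarrow> bilinear R M N L' (\<lambda>x y. \<phi> (f x y))"
  by (auto simp: bilinear_def intro: linear_compose)


section \<open>The tensor product as a module\<close>

lemma tensor_class_add:
  assumes "module R M" "module R N"
    and "Poly_Mapping.keys c \<subseteq> carrier M \<times> carrier N" "Poly_Mapping.keys d \<subseteq> carrier M \<times> carrier N"
  shows "tensor_class R M N c \<oplus>\<^bsub>tensor R M N\<^esub> tensor_class R M N d = tensor_class R M N (c + d)"
proof -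
  let ?F = "free_Abelian_group (carrier M \<times> carrier N)"
  interpret F: comm_group ?F by (rule abelian_free_Abelian_group)
  have "tensor_null R M N \<lhd> ?F"
    using tensor_null_subgroup[OF assms(1,2)] by (rule F.subgroup_imp_normal)
  then show ?thesis
    using normal.rcos_sum[of _ ?F c d] assms(3,4) by (simp add: tensor_def Let_def tensor_class_def)
qed

lemma tensor_zero: "\<lbrakk>module R M; module R N\<rbrakk> \<Longrightarrow> \<zero>\<^bsub>tensor R M N\<^esub> = tensor_class R M N 0"
proof -
  assume "module R M" "module R N"
  then interpret S: subgroup "tensor_null R M N" "free_Abelian_group (carrier M \<times> carrier N)"
    by (rule tensor_null_subgroup)
  show ?thesis
    by (auto simp: tensor_def Let_def tensor_class_def r_coset_def)
qed

lemma abelian_group_tensor: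
  assumes "module R M" "module R N"
  shows "abelian_group (tensor R M N)"
proof -
  let ?F = "free_Abelian_group (carrier M \<times> carrier N)"
  interpret F: comm_group ?F by (rule abelian_free_Abelian_group)
  interpret Q: comm_group "?F Mod tensor_null R M N"
    by (rule F.abelian_FactGroup[OF tensor_null_subgroup[OF assms]])
  have sel: "carrier (tensor R M N) = carrier (?F Mod tensor_null R M N)"
    "(\<oplus>\<^bsub>tensor R M N\<^esub>) = (\<otimes>\<^bsub>?F Mod tensor_null R M N\<^esub>)"
    "\<zero>\<^bsub>tensor R M N\<^esub> = \<one>\<^bsub>?F Mod tensor_null R M N\<^esub>"
    by (simp_all add: tensor_def Let_def del: mult_FactGroup)
  show ?thesis
    by (rule abelian_groupI; unfold sel)
      (assumption | rule Q.m_closed Q.one_closed Q.m_assoc Q.m_comm Q.l_one Q.l_inv_ex)+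
qed

lemma tens_closed:
  "\<lbrakk>x \<in> carrier M; y \<in> carrier N\<rbrakk> \<Longrightarrow> tens R M N x y \<in> carrier (tensor R M N)"
  by (auto simp: carrier_tensor tens_def)

text \<open>Scaling the first factor maps null tensors to null tensors, so the set whose unique element
  defines scalar multiplication is indeed a singleton.\<close>

lemma tensor_class_smult:
  assumes "module R M" "module R N" "r \<in> carrier R"
    and "Poly_Mapping.keys c \<subseteq> carrier M \<times> carrier N"
  shows "r \<odot>\<^bsub>tensor R M N\<^esub> tensor_class R M N c =
    tensor_class R M N (frag_extend (\<lambda>(x, y). frag_of (r \<odot>\<^bsub>M\<^esub> x, y)) c)"
proof -
  interpret M: module R M by fact
  interpret S: subgroup "tensor_null R M N" "free_Abelian_group (carrier M \<times> carrier N)"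
    using assms(1,2) by (rule tensor_null_subgroup)
  let ?e = "frag_extend (\<lambda>(x, y). frag_of (r \<odot>\<^bsub>M\<^esub> x, y))"
  have keys: "Poly_Mapping.keys (?e u) \<subseteq> carrier M \<times> carrier N"
    if "Poly_Mapping.keys u \<subseteq> carrier M \<times> carrier N" for u
    by (rule order_trans[OF keys_frag_extend]) (use that assms(3) in \<open>auto split: prod.splits\<close>)
  have "tensor_class R M N (?e (k + c)) = tensor_class R M N (?e c)" if "k \<in> tensor_null R M N" for k
  proof -
    have k: "Poly_Mapping.keys k \<subseteq> carrier M \<times> carrier N"
      using S.mem_carrier[OF that] by simp
    have "?e k \<in> tensor_null R M N"
      using frag_extend_null[OF assms(1,1,2) linear_smult_right[OF assms(1,3) linear_id] that] .
    moreover have "Poly_Mapping.keys (?e k + ?e c) \<subseteq> carrier M \<times> carrier N"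
      using keys[OF k] keys[OF assms(4)] Poly_Mapping.keys_add[of "?e k" "?e c"] by blast
    ultimately show ?thesis
      using keys[OF assms(4)] by (simp add: frag_extend_add tensor_class_eq_iff[OF assms(1,2)])
  qed
  then have "(\<lambda>u. tensor_class R M N (?e u)) ` tensor_class R M N c = {tensor_class R M N (?e c)}"
    using S.one_closed unfolding tensor_class_def[of R M N c] r_coset_def by force
  then show ?thesis by (simp add: tensor_def Let_def)
qed

lemma tensor_smult_tens:
  assumes "module R M" "module R N" "r \<in> carrier R" "x \<in> carrier M" "y \<in> carrier N"
  shows "r \<odot>\<^bsub>tensor R M N\<^esub> tens R M N x y = tens R M N (r \<odot>\<^bsub>M\<^esub> x) y"
  using tensor_class_smult[OF assms(1-3), of "frag_of (x, y)"] assms(4,5) by (simp add: tens_def)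

lemma tens_add_left:
  assumes "module R M" "module R N" "x \<in> carrier M" "x' \<in> carrier M" "y \<in> carrier N"
  shows "tens R M N (x \<oplus>\<^bsub>M\<^esub> x') y = tens R M N x y \<oplus>\<^bsub>tensor R M N\<^esub> tens R M N x' y"
proof -
  interpret M: module R M by fact
  have "frag_of (x \<oplus>\<^bsub>M\<^esub> x', y) - frag_of (x, y) - frag_of (x', y) \<in> tensor_null R M N"
    unfolding tensor_null_def using assms by (intro generate.incl) (auto simp: tensor_relators_def)
  then show ?thesis
    using assms order_trans[OF Poly_Mapping.keys_add[of "frag_of (x, y)" "frag_of (x', y)"]]
    by (simp add: tens_def tensor_class_add tensor_class_eq_iff diff_diff_add)
qed

lemma tens_add_right:
  assumes "module R M" "module R N" "x \<in> carrier M" "y \<in> carrier N" "y' \<in> carrier N"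
  shows "tens R M N x (y \<oplus>\<^bsub>N\<^esub> y') = tens R M N x y \<oplus>\<^bsub>tensor R M N\<^esub> tens R M N x y'"
proof -
  interpret N: module R N by fact
  have "frag_of (x, y \<oplus>\<^bsub>N\<^esub> y') - frag_of (x, y) - frag_of (x, y') \<in> tensor_null R M N"
    unfolding tensor_null_def using assms by (intro generate.incl) (auto simp: tensor_relators_def)
  then show ?thesis
    using assms order_trans[OF Poly_Mapping.keys_add[of "frag_of (x, y)" "frag_of (x, y')"]]
    by (simp add: tens_def tensor_class_add tensor_class_eq_iff diff_diff_add)
qed

lemma tens_smult_swap:
  assumes "module R M" "module R N" "r \<in> carrier R" "x \<in> carrier M" "y \<in> carrier N"
  shows "tens R M N (r \<odot>\<^bsub>M\<^esub> x) y = tens R M N x (r \<odot>\<^bsub>N\<^esub> y)"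
proof -
  interpret M: module R M by fact
  interpret N: module R N by fact
  have "frag_of (r \<odot>\<^bsub>M\<^esub> x, y) - frag_of (x, r \<odot>\<^bsub>N\<^esub> y) \<in> tensor_null R M N"
    unfolding tensor_null_def using assms by (intro generate.incl) (auto simp: tensor_relators_def)
  then show ?thesis using assms by (simp add: tens_def tensor_class_eq_iff)
qed

text \<open>Elements of a tensor product are differences of finite sums of pure tensors, so an additive
  property need only be checked on those.\<close>

lemma tensor_induct [consumes 3, case_names tens add neg]:
  assumes "module R M" "module R N" "t \<in> carrier (tensor R M N)"
    and tens: "\<And>x y. \<lbrakk>x \<in> carrier M; y \<in> carrier N\<rbrakk> \<Longrightarrow> P (tens R M N x y)"
    and add: "\<And>s t. \<lbrakk>s \<in> carrier (tensor R M N); t \<in> carrier (tensor R M N); P s; P t\<rbrakk>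
      \<Longrightarrow> P (s \<oplus>\<^bsub>tensor R M N\<^esub> t)"
    and neg: "\<And>t. \<lbrakk>t \<in> carrier (tensor R M N); P t\<rbrakk> \<Longrightarrow> P (\<ominus>\<^bsub>tensor R M N\<^esub> t)"
  shows "P t"
proof -
  interpret M: module R M by fact
  interpret N: module R N by fact
  interpret T: abelian_group "tensor R M N" by (rule abelian_group_tensor) fact+
  obtain c where c: "t = tensor_class R M N c" "Poly_Mapping.keys c \<subseteq> carrier M \<times> carrier N"
    using assms(3) by (auto simp: carrier_tensor)
  have cl: "tensor_class R M N c \<in> carrier (tensor R M N)"
    if "Poly_Mapping.keys c \<subseteq> carrier M \<times> carrier N" for c
    using that by (auto simp: carrier_tensor)
  have "P (tensor_class R M N c)"
  proof (rule free_Abelian_group_induct[OF c(2)])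
    \<comment> \<open>zero is \<open>0 \<otimes> 0\<close> minus itself; this avoids a separate case for it in the rule\<close>
    have "P (\<zero>\<^bsub>tensor R M N\<^esub>)"
      using add[OF _ _ tens neg[OF _ tens], of "\<zero>\<^bsub>M\<^esub>" "\<zero>\<^bsub>N\<^esub>" "\<zero>\<^bsub>M\<^esub>" "\<zero>\<^bsub>N\<^esub>"]
      by (simp add: tens_closed T.r_neg)
    then show "P (tensor_class R M N 0)" using assms(1,2) by (simp add: tensor_zero)
  next
    fix a b
    assume ab: "Poly_Mapping.keys a \<subseteq> carrier M \<times> carrier N" "Poly_Mapping.keys b \<subseteq> carrier M \<times> carrier N"
      and P: "P (tensor_class R M N a)" "P (tensor_class R M N b)"
    have "tensor_class R M N (a - b) \<oplus>\<^bsub>tensor R M N\<^esub> tensor_class R M N b = tensor_class R M N a"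
      using ab by (simp add: tensor_class_add[OF assms(1,2)] keys_diff_subset)
    then have "tensor_class R M N (a - b) =
        tensor_class R M N a \<oplus>\<^bsub>tensor R M N\<^esub> \<ominus>\<^bsub>tensor R M N\<^esub> tensor_class R M N b"
      using ab by (metis T.add.inv_solve_right cl keys_diff_subset)
    then show "P (tensor_class R M N (a - b))"
      using add[OF _ _ P(1) neg[OF _ P(2)]] ab cl by simp
  next
    fix p assume "p \<in> carrier M \<times> carrier N"
    then show "P (tensor_class R M N (frag_of p))"
      using tens by (auto simp: tens_def)
  qed
  then show ?thesis using c by simp
qed

text \<open>Additivity alone suffices, which allows the use for scalar multiplication on a tensor product
  before that is known to be a module.\<close>

lemma additive_neg:
  assumes "abelian_group M" "abelian_group N" "\<And>x. x \<in> carrier M \<Longrightarrow> f x \<in> carrier N"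
    and "\<And>x y. \<lbrakk>x \<in> carrier M; y \<in> carrier M\<rbrakk> \<Longrightarrow> f (x \<oplus>\<^bsub>M\<^esub> y) = f x \<oplus>\<^bsub>N\<^esub> f y"
    and "x \<in> carrier M"
  shows "f (\<ominus>\<^bsub>M\<^esub> x) = \<ominus>\<^bsub>N\<^esub> f x"
proof -
  interpret M: abelian_group M by fact
  interpret N: abelian_group N by fact
  have z: "f \<zero>\<^bsub>M\<^esub> = \<zero>\<^bsub>N\<^esub>"
    using assms(4)[of "\<zero>\<^bsub>M\<^esub>" "\<zero>\<^bsub>M\<^esub>"] assms(3)[of "\<zero>\<^bsub>M\<^esub>"] by (simp add: N.add.l_cancel_one')
  have "f (\<ominus>\<^bsub>M\<^esub> x) \<oplus>\<^bsub>N\<^esub> f x = \<zero>\<^bsub>N\<^esub>"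
    using assms(4)[of "\<ominus>\<^bsub>M\<^esub> x" x] assms(5) z by (simp add: M.l_neg)
  then show ?thesis using assms(3,5) by (metis M.a_inv_closed N.minus_equality)
qed

text \<open>Each module axiom equates two additive functions of a tensor, so it follows from its case of
  pure tensors.\<close>

lemma module_tensor:
  assumes "module R M" "module R N"
  shows "module R (tensor R M N)"
proof -
  let ?T = "tensor R M N"
  interpret M: module R M by fact
  interpret N: module R N by fact
  interpret T: abelian_group ?T by (rule abelian_group_tensor) fact+
  let ?e = "\<lambda>r. frag_extend (\<lambda>(x, y). frag_of (r \<odot>\<^bsub>M\<^esub> x, y))"
  have keys: "Poly_Mapping.keys (?e r u) \<subseteq> carrier M \<times> carrier N"
    if "Poly_Mapping.keys u \<subseteq> carrier M \<times> carrier N" "r \<in> carrier R" for u r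
    by (rule order_trans[OF keys_frag_extend]) (use that in \<open>auto split: prod.splits\<close>)
  have closed: "r \<odot>\<^bsub>?T\<^esub> t \<in> carrier ?T" if "r \<in> carrier R" "t \<in> carrier ?T" for r t
    using that keys by (auto simp: carrier_tensor tensor_class_smult[OF assms])
  have distr: "r \<odot>\<^bsub>?T\<^esub> (s \<oplus>\<^bsub>?T\<^esub> t) = r \<odot>\<^bsub>?T\<^esub> s \<oplus>\<^bsub>?T\<^esub> r \<odot>\<^bsub>?T\<^esub> t"
    if r: "r \<in> carrier R" and st: "s \<in> carrier ?T" "t \<in> carrier ?T" for r s t
  proof -
    obtain c d where "s = tensor_class R M N c" "Poly_Mapping.keys c \<subseteq> carrier M \<times> carrier N"
      "t = tensor_class R M N d" "Poly_Mapping.keys d \<subseteq> carrier M \<times> carrier N"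
      using st by (auto simp: carrier_tensor)
    moreover from this have "Poly_Mapping.keys (c + d) \<subseteq> carrier M \<times> carrier N"
      using Poly_Mapping.keys_add[of c d] by blast
    ultimately show ?thesis
      using r keys by (simp add: tensor_class_add[OF assms] tensor_class_smult[OF assms] frag_extend_add)
  qed
  have neg: "r \<odot>\<^bsub>?T\<^esub> (\<ominus>\<^bsub>?T\<^esub> t) = \<ominus>\<^bsub>?T\<^esub> (r \<odot>\<^bsub>?T\<^esub> t)" if "r \<in> carrier R" "t \<in> carrier ?T" for r t
    using additive_neg[OF T.abelian_group_axioms T.abelian_group_axioms, of "\<lambda>t. r \<odot>\<^bsub>?T\<^esub> t"]
      that closed distr by blast
  show ?thesis
  proof (rule moduleI[OF M.R.is_cring T.abelian_group_axioms closed _ distr])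
    fix a b t assume ab: "a \<in> carrier R" "b \<in> carrier R" and t: "t \<in> carrier ?T"
    from assms t show "(a \<oplus>\<^bsub>R\<^esub> b) \<odot>\<^bsub>?T\<^esub> t = a \<odot>\<^bsub>?T\<^esub> t \<oplus>\<^bsub>?T\<^esub> b \<odot>\<^bsub>?T\<^esub> t"
    proof (induction t rule: tensor_induct)
      case (add s t) then show ?case
        by (simp add: ab closed distr T.a_ac)
    qed (simp_all add: ab tensor_smult_tens[OF assms] M.smult_l_distr tens_add_left[OF assms] neg
        closed T.minus_add)
  next
    fix a b t assume ab: "a \<in> carrier R" "b \<in> carrier R" and t: "t \<in> carrier ?T"
    from assms t show "(a \<otimes>\<^bsub>R\<^esub> b) \<odot>\<^bsub>?T\<^esub> t = a \<odot>\<^bsub>?T\<^esub> (b \<odot>\<^bsub>?T\<^esub> t)"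
    proof (induction t rule: tensor_induct)
      case (add s t) then show ?case
        by (simp add: ab closed distr)
    qed (simp_all add: ab tensor_smult_tens[OF assms] M.smult_assoc1 neg closed)
  next
    fix t assume t: "t \<in> carrier ?T"
    from assms t show "\<one>\<^bsub>R\<^esub> \<odot>\<^bsub>?T\<^esub> t = t"
    proof (induction t rule: tensor_induct)
      case (add s t) then show ?case
        by (simp add: closed distr)
    qed (simp_all add: tensor_smult_tens[OF assms] neg closed)
  qed
qed

lemma bilinear_tens:
  assumes "module R M" "module R N"
  shows "bilinear R M N (tensor R M N) (tens R M N)"
proof -
  show ?thesis
    by (intro bilinearI linear_mapsI)
      (use assms in \<open>auto simp: tens_closed tens_add_left tens_add_right tensor_smult_tens
        tens_smult_swap\<close>)
qed


section \<open>The universal property\<close>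

lemma tensor_lift_tens:
  assumes "module R M" "module R N" "module R L" "bilinear R M N L f" "x \<in> carrier M" "y \<in> carrier N"
  shows "tensor_lift L f (tens R M N x y) = f x y"
proof -
  have L: "abelian_group L" using assms(3) by (rule module.axioms)
  show ?thesis
    unfolding tens_def using assms
    by (subst tensor_lift_class[OF assms(1,2) L bilinear_balanced[OF assms(4)]])
      (auto intro: frag_eval_frag_of[OF L] bilinear_closed)
qed

lemma tensor_lift_linear:
  assumes "module R M" "module R N" "module R L" "bilinear R M N L f"
  shows "tensor_lift L f \<in> linear_maps R (tensor R M N) L"
proof -
  let ?T = "tensor R M N"
  interpret L: module R L by fact
  interpret T: module R ?T by (rule module_tensor) fact+
  have f: "f \<in> carrier M \<rightarrow> carrier N \<rightarrow> carrier L" using assms(4) by (auto intro: bilinear_closed)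
  note cls = tensor_lift_class[OF assms(1,2) L.abelian_group_axioms bilinear_balanced[OF assms(4)]]
  have closed: "tensor_lift L f t \<in> carrier L" if "t \<in> carrier ?T" for t
    using that cls frag_eval_closed[OF L.abelian_group_axioms f] by (auto simp: carrier_tensor)
  have lift_add: "tensor_lift L f (s \<oplus>\<^bsub>?T\<^esub> t) = tensor_lift L f s \<oplus>\<^bsub>L\<^esub> tensor_lift L f t"
    if st: "s \<in> carrier ?T" "t \<in> carrier ?T" for s t
  proof -
    obtain c d where "s = tensor_class R M N c" "Poly_Mapping.keys c \<subseteq> carrier M \<times> carrier N"
      "t = tensor_class R M N d" "Poly_Mapping.keys d \<subseteq> carrier M \<times> carrier N"
      using st by (auto simp: carrier_tensor)
    moreover from this have "Poly_Mapping.keys (c + d) \<subseteq> carrier M \<times> carrier N"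
      using Poly_Mapping.keys_add[of c d] by blast
    ultimately show ?thesis
      by (simp add: tensor_class_add[OF assms(1,2)] cls frag_eval_add[OF L.abelian_group_axioms f])
  qed
  note lift_neg = additive_neg[OF T.abelian_group_axioms L.abelian_group_axioms, of "tensor_lift L f", OF
      closed lift_add]
  show ?thesis
  proof (rule linear_mapsI[OF closed lift_add])
    fix r t assume r: "r \<in> carrier R" and t: "t \<in> carrier ?T"
    from assms(1,2) t show "tensor_lift L f (r \<odot>\<^bsub>?T\<^esub> t) = r \<odot>\<^bsub>L\<^esub> tensor_lift L f t"
    proof (induction t rule: tensor_induct)
      case (tens x y)
      interpret M: module R M by fact
      have "f (r \<odot>\<^bsub>M\<^esub> x) y = r \<odot>\<^bsub>L\<^esub> f x y"
        using linear_smult[OF bilinear_left[OF assms(4) tens(2)] r tens(1)] .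
      then show ?case using tens r by (simp add: tensor_smult_tens[OF assms(1,2)] tensor_lift_tens[OF assms])
    next
      case (add s t)
      then show ?case using r by (simp add: T.smult_r_distr L.smult_r_distr lift_add closed)
    next
      case (neg t)
      then show ?case using r by (simp add: T.smult_r_minus L.smult_r_minus closed
          lift_neg)
    qed
  qed
qed

lemma tensor_ext:
  assumes "module R M" "module R N" "module R L"
    and \<phi>: "\<phi> \<in> linear_maps R (tensor R M N) L" and \<psi>: "\<psi> \<in> linear_maps R (tensor R M N) L"
    and eq: "\<And>x y. \<lbrakk>x \<in> carrier M; y \<in> carrier N\<rbrakk> \<Longrightarrow> \<phi> (tens R M N x y) = \<psi> (tens R M N x y)"
    and "t \<in> carrier (tensor R M N)"
  shows "\<phi> t = \<psi> t"
  using assms(1,2,7)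
proof (induction t rule: tensor_induct)
  case (tens x y) then show ?case by (rule eq)
next
  case (add s t) then show ?case by (simp add: linear_add[OF \<phi>] linear_add[OF \<psi>])
next
  case (neg t)
  note T = module_tensor[OF assms(1,2)]
  show ?case using neg by (simp add: linear_neg[OF T assms(3) \<phi>] linear_neg[OF T assms(3) \<psi>])
qed

lemma tensor_lift_closed:
  "\<lbrakk>module R M; module R N; module R L; bilinear R M N L f; t \<in> carrier (tensor R M N)\<rbrakk>
    \<Longrightarrow> tensor_lift L f t \<in> carrier L"
  using linear_closed[OF tensor_lift_linear] by blast

text \<open>In this form a linear map moves inside a sum \<open>\<Sum> x \<otimes> y\<close>.\<close>

lemma tensor_lift_eq:
  assumes "module R M" "module R N" "module R L" "\<phi> \<in> linear_maps R (tensor R M N) L"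
    and "t \<in> carrier (tensor R M N)"
  shows "\<phi> t = tensor_lift L (\<lambda>x y. \<phi> (tens R M N x y)) t"
proof -
  have bil: "bilinear R M N L (\<lambda>x y. \<phi> (tens R M N x y))"
    using bilinear_compose[OF assms(4) bilinear_tens[OF assms(1,2)]] .
  show ?thesis
    by (rule tensor_ext[OF assms(1-4) tensor_lift_linear[OF assms(1-3) bil] _ assms(5)])
      (simp add: tensor_lift_tens[OF assms(1-3) bil])
qed

lemma tensor_lift_natural:
  assumes "module R M" "module R N" "module R L" "module R L'" "bilinear R M N L f"
    and "\<phi> \<in> linear_maps R L L'" "t \<in> carrier (tensor R M N)"
  shows "\<phi> (tensor_lift L f t) = tensor_lift L' (\<lambda>x y. \<phi> (f x y)) t"
proof (rule tensor_ext[OF assms(1,2,4) _ _ _ assms(7)])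
  note bil = bilinear_compose[OF assms(6,5)]
  show "(\<lambda>t. \<phi> (tensor_lift L f t)) \<in> linear_maps R (tensor R M N) L'"
    by (rule linear_compose[OF assms(6) tensor_lift_linear]) fact+
  show "tensor_lift L' (\<lambda>x y. \<phi> (f x y)) \<in> linear_maps R (tensor R M N) L'"
    by (rule tensor_lift_linear[OF assms(1,2,4) bil])
  show "\<phi> (tensor_lift L f (tens R M N x y)) = tensor_lift L' (\<lambda>x y. \<phi> (f x y)) (tens R M N x y)"
    if "x \<in> carrier M" "y \<in> carrier N" for x y
    using that by (simp add: tensor_lift_tens[OF assms(1,2,3,5)] tensor_lift_tens[OF assms(1,2,4) bil])
qed

lemma bilinear_cong:
  assumes "module R M" "module R N" "bilinear R M N L f"
    and "\<And>x y. \<lbrakk>x \<in> carrier M; y \<in> carrier N\<rbrakk> \<Longrightarrow> g x y = f x y"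
  shows "bilinear R M N L g"
  using assms by (auto simp: bilinear_def intro: linear_cong)

lemma tensor_lift_cong:
  assumes "module R M" "module R N" "module R L" "bilinear R M N L f" "t \<in> carrier (tensor R M N)"
    and "\<And>x y. \<lbrakk>x \<in> carrier M; y \<in> carrier N\<rbrakk> \<Longrightarrow> f x y = g x y"
  shows "tensor_lift L f t = tensor_lift L g t"
proof -
  have g: "bilinear R M N L g" by (rule bilinear_cong[OF assms(1,2,4)]) (simp add: assms(6))
  show ?thesis
    by (rule tensor_ext[OF assms(1-3) tensor_lift_linear[OF assms(1-4)] tensor_lift_linear[OF assms(1-3) g]
        _ assms(5)])
      (simp add: tensor_lift_tens[OF assms(1-4)] tensor_lift_tens[OF assms(1-3) g] assms(6))
qed

text \<open>Together with \<open>linear_lift_arg\<close> this covers the two ways in which a variable can occur in an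
  iterated sum over coproducts, as a parameter of the summand or as the element that is expanded.\<close>

lemma linear_lift:
  assumes "module R M" "module R N" "module R L" "module R P" "t \<in> carrier (tensor R M N)"
    and bil: "\<And>x. x \<in> carrier P \<Longrightarrow> bilinear R M N L (f x)"
    and lin: "\<And>u v. \<lbrakk>u \<in> carrier M; v \<in> carrier N\<rbrakk> \<Longrightarrow> (\<lambda>x. f x u v) \<in> linear_maps R P L"
  shows "(\<lambda>x. tensor_lift L (f x) t) \<in> linear_maps R P L"
  using assms(1,2,5)
proof (induction t rule: tensor_induct)
  case (tens u v)
  show ?case
    by (rule linear_cong[OF assms(4) lin[OF tens]]) (simp add: tensor_lift_tens[OF assms(1-3) bil] tens)
next
  case (add s t)
  interpret L: module R L by fact
  interpret P: module R P by fact
  have c: "tensor_lift L (f x) s \<in> carrier L" "tensor_lift L (f x) t \<in> carrier L" if "x \<in> carrier P" for x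
    using add that by (auto intro!: tensor_lift_closed[OF assms(1-3) bil])
  have e: "tensor_lift L (f x) (s \<oplus>\<^bsub>tensor R M N\<^esub> t) = tensor_lift L (f x) s \<oplus>\<^bsub>L\<^esub> tensor_lift L (f x) t"
    if "x \<in> carrier P" for x
    using linear_add[OF tensor_lift_linear[OF assms(1-3) bil[OF that]]] add by blast
  show ?case
    using linear_add[OF add(3)] linear_add[OF add(4)] linear_smult[OF add(3)] linear_smult[OF add(4)]
    by (intro linear_mapsI) (simp_all add: e c L.a_ac L.smult_r_distr)
next
  case (neg t)
  interpret L: module R L by fact
  interpret P: module R P by fact
  have c: "tensor_lift L (f x) t \<in> carrier L" if "x \<in> carrier P" for x
    using neg that by (auto intro!: tensor_lift_closed[OF assms(1-3) bil])
  have e: "tensor_lift L (f x) (\<ominus>\<^bsub>tensor R M N\<^esub> t) = \<ominus>\<^bsub>L\<^esub> tensor_lift L (f x) t"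
    if "x \<in> carrier P" for x
    using linear_neg[OF module_tensor[OF assms(1,2)]
        assms(3) tensor_lift_linear[OF assms(1-3) bil[OF that]]] neg by blast
  show ?case
    using linear_add[OF neg(2)] linear_smult[OF neg(2)]
    by (intro linear_mapsI) (simp_all add: e c L.minus_add L.smult_r_minus)
qed

lemma linear_lift_arg:
  assumes "module R M" "module R N" "module R L" "bilinear R M N L f" "g \<in> linear_maps R P (tensor R M N)"
  shows "(\<lambda>x. tensor_lift L f (g x)) \<in> linear_maps R P L"
  using linear_compose[OF tensor_lift_linear[OF assms(1-4)] assms(5)] .

text \<open>A Fubini rule: by linearity in \<open>s\<close> it reduces to a pure tensor \<open>s\<close>, where each side is a
  single sum over \<open>t\<close>.\<close>

lemma tensor_lift_swap:
  assumes "module R M" "module R N" "module R M'" "module R N'" "module R L"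
    and "s \<in> carrier (tensor R M N)" "t \<in> carrier (tensor R M' N')"
    and b1: "\<And>x y. \<lbrakk>x \<in> carrier M; y \<in> carrier N\<rbrakk> \<Longrightarrow> bilinear R M' N' L (\<lambda>u v. f x y u v)"
    and b2: "\<And>u v. \<lbrakk>u \<in> carrier M'; v \<in> carrier N'\<rbrakk> \<Longrightarrow> bilinear R M N L (\<lambda>x y. f x y u v)"
  shows "tensor_lift L (\<lambda>x y. tensor_lift L (\<lambda>u v. f x y u v) t) s =
    tensor_lift L (\<lambda>u v. tensor_lift L (\<lambda>x y. f x y u v) s) t"
proof -
  have b: "bilinear R M N L (\<lambda>x y. tensor_lift L (\<lambda>u v. f x y u v) t)"
    by (rule bilinearI[OF linear_lift[OF assms(3-5,2,7) b1] linear_lift[OF assms(3-5,1,7) b1]])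
      (auto dest: bilinear_left[OF b2] bilinear_right[OF b2])
  have b': "bilinear R M' N' L (\<lambda>u v. tensor_lift L (\<lambda>x y. f x y u v) s)" if "s \<in> carrier (tensor R M N)" for s
    by (rule bilinearI[OF linear_lift[OF assms(1,2,5,4) that b2] linear_lift[OF assms(1,2,5,3) that b2]])
      (auto dest: bilinear_left[OF b1] bilinear_right[OF b1])
  show ?thesis
  proof (rule tensor_ext[OF assms(1,2,5) tensor_lift_linear[OF assms(1,2,5) b] _ _ assms(6)])
    show "(\<lambda>s. tensor_lift L (\<lambda>u v. tensor_lift L (\<lambda>x y. f x y u v) s) t) \<in> linear_maps R (tensor R M N) L"
      by (intro linear_lift[OF assms(3,4,5) module_tensor[OF assms(1,2)] assms(7)]
          b' tensor_lift_linear assms b2)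
  next
    fix x y assume xy: "x \<in> carrier M" "y \<in> carrier N"
    show "tensor_lift L (\<lambda>x y. tensor_lift L (\<lambda>u v. f x y u v) t) (tens R M N x y) =
      tensor_lift L (\<lambda>u v. tensor_lift L (\<lambda>x y. f x y u v) (tens R M N x y)) t"
      unfolding tensor_lift_tens[OF assms(1,2,5) b xy]
      by (rule tensor_lift_cong[OF assms(3,4,5) b1[OF xy] assms(7)])
        (simp add: tensor_lift_tens[OF assms(1,2,5) b2 xy])
  qed
qed

text \<open>Sums with values in \<open>R\<close> look only at the additive group, so it does not matter whether \<open>R\<close> is
  regarded as a ring or as a module over itself.\<close>

lemma tensor_lift_regular: "tensor_lift R = tensor_lift (regular_module R)"
  by (intro ext) (simp add: tensor_lift_def frag_eval_def finsum_def finprod_def add_pow_def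
      int_pow_def nat_pow_def m_inv_def regular_module_def cong: if_cong)

lemma module_hom_module:
  assumes "module R M" "module R N"
  shows "module R (hom_module R M N)"
proof -
  interpret M: module R M by fact
  interpret N: module R N by fact
  show ?thesis
    by (rule moduleI[OF M.R.is_cring abelian_group_hom_module[OF assms]])
      (auto simp: hom_module_def linear_maps_def Pi_iff fun_eq_iff extensional_def N.smult_l_distr
        N.smult_r_distr N.smult_assoc1 M.R.m_comm simp flip: N.smult_assoc1)
qed

lemma hom_module_apply_linear:
  "x \<in> carrier M \<Longrightarrow> (\<lambda>f. f x) \<in> linear_maps R (hom_module R M N) N"
  by (auto simp: hom_module_def linear_maps_def)


section \<open>Functoriality and associativity of the tensor product\<close>

lemma bilinear_tens_compose:
  assumes "module R P" "module R Q" "f \<in> linear_maps R M P" "g \<in> linear_maps R N Q"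
  shows "bilinear R M N (tensor R P Q) (\<lambda>x y. tens R P Q (f x) (g y))"
proof (rule bilinearI)
  note b = bilinear_tens[OF assms(1,2)]
  fix x assume "x \<in> carrier M"
  then show "(\<lambda>y. tens R P Q (f x) (g y)) \<in> linear_maps R N (tensor R P Q)"
    using linear_compose[OF bilinear_right[OF b] assms(4)] linear_closed[OF assms(3)] by blast
next
  note b = bilinear_tens[OF assms(1,2)]
  fix y assume "y \<in> carrier N"
  then show "(\<lambda>x. tens R P Q (f x) (g y)) \<in> linear_maps R M (tensor R P Q)"
    using linear_compose[OF bilinear_left[OF b] assms(3)] linear_closed[OF assms(4)] by blast
qed

lemma tensor_map_linear:
  assumes "module R M" "module R N" "module R P" "module R Q"
    and "f \<in> linear_maps R M P" "g \<in> linear_maps R N Q"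
  shows "tensor_map R P Q f g \<in> linear_maps R (tensor R M N) (tensor R P Q)"
  unfolding tensor_map_def
  by (intro tensor_lift_linear module_tensor bilinear_tens_compose assms)

lemma tensor_map_tens:
  assumes "module R M" "module R N" "module R P" "module R Q"
    and "f \<in> linear_maps R M P" "g \<in> linear_maps R N Q" "x \<in> carrier M" "y \<in> carrier N"
  shows "tensor_map R P Q f g (tens R M N x y) = tens R P Q (f x) (g y)"
  unfolding tensor_map_def
  by (rule tensor_lift_tens[OF assms(1,2) module_tensor[OF assms(3,4)] bilinear_tens_compose assms(7,8)]) fact+

lemma tensor_lift_map:
  assumes "module R M" "module R N" "module R P" "module R Q" "module R L"
    and "f \<in> linear_maps R M P" "g \<in> linear_maps R N Q" "bilinear R P Q L b" "t \<in> carrier (tensor R M N)"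
  shows "tensor_lift L b (tensor_map R P Q f g t) = tensor_lift L (\<lambda>x y. b (f x) (g y)) t"
proof -
  note lin = linear_compose[OF tensor_lift_linear[OF assms(3,4,5,8)] tensor_map_linear[OF assms(1-4,6,7)]]
  have bil: "bilinear R M N L (\<lambda>x y. tensor_lift L b (tensor_map R P Q f g (tens R M N x y)))"
    using bilinear_compose[OF lin bilinear_tens[OF assms(1,2)]] .
  show ?thesis
    unfolding tensor_lift_eq[OF assms(1,2,5) lin assms(9)]
    by (rule tensor_lift_cong[OF assms(1,2,5) bil assms(9)])
      (simp add: tensor_map_tens[OF assms(1-4,6,7)] tensor_lift_tens[OF assms(3-5,8)]
        linear_closed[OF assms(6)] linear_closed[OF assms(7)])
qed

context
  fixes R :: "('r, 'z) ring_scheme" and L :: "('r, 'l, 'w) module_scheme"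
    and M :: "('r, 'm, 'x) module_scheme" and N :: "('r, 'n, 'y) module_scheme"
  assumes L: "module R L" and M: "module R M" and N: "module R N"
begin

lemma assoc_bilinear:
  assumes "z \<in> carrier N"
  shows "bilinear R L M (tensor R L (tensor R M N)) (\<lambda>x y. tens R L (tensor R M N) x (tens R M N y z))"
  by (intro bilinear_tens_compose L module_tensor M N linear_id bilinear_left[OF bilinear_tens] assms)

lemma assoc_bilinear_outer:
  "bilinear R (tensor R L M) N (tensor R L (tensor R M N)) (\<lambda>s z. tensor_lift (tensor R L (tensor R M N))
     (\<lambda>x y. tens R L (tensor R M N) x (tens R M N y z)) s)"
proof (rule bilinearI)
  fix s assume "s \<in> carrier (tensor R L M)"
  then show "(\<lambda>z. tensor_lift (tensor R L (tensor R M N)) (\<lambda>x y. tens R L (tensor R M N) x (tens R M N y z)) s)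
      \<in> linear_maps R N (tensor R L (tensor R M N))"
    by (intro linear_lift L M N module_tensor)
      (auto intro!: assoc_bilinear intro: L M N module_tensor
        linear_compose[OF bilinear_right[OF bilinear_tens] bilinear_right[OF bilinear_tens]])
next
  fix z assume "z \<in> carrier N"
  then show "tensor_lift (tensor R L (tensor R M N)) (\<lambda>x y. tens R L (tensor R M N) x (tens R M N y z))
      \<in> linear_maps R (tensor R L M) (tensor R L (tensor R M N))"
    by (intro tensor_lift_linear L M N module_tensor assoc_bilinear)
qed

lemma tensor_assoc_linear:
  "tensor_assoc R L M N \<in> linear_maps R (tensor R (tensor R L M) N) (tensor R L (tensor R M N))"
  unfolding tensor_assoc_def Let_def
  by (intro tensor_lift_linear L M N module_tensor assoc_bilinear_outer)

lemma tensor_assoc_tens':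
  assumes "s \<in> carrier (tensor R L M)" "z \<in> carrier N"
  shows "tensor_assoc R L M N (tens R (tensor R L M) N s z) =
    tensor_lift (tensor R L (tensor R M N)) (\<lambda>x y. tens R L (tensor R M N) x (tens R M N y z)) s"
  unfolding tensor_assoc_def Let_def
  by (rule tensor_lift_tens[OF _ N _ assoc_bilinear_outer assms]) (intro L M N module_tensor)+

lemma tensor_assoc_tens:
  assumes "x \<in> carrier L" "y \<in> carrier M" "z \<in> carrier N"
  shows "tensor_assoc R L M N (tens R (tensor R L M) N (tens R L M x y) z) =
    tens R L (tensor R M N) x (tens R M N y z)"
  using assms by (simp add: tensor_assoc_tens' tens_closed
      tensor_lift_tens[OF L M module_tensor[OF L module_tensor[OF M N]] assoc_bilinear])

text \<open>Surjectivity is the half of bijectivity that transports injectivity statements from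
  \<open>(L \<otimes> M) \<otimes> N\<close> to \<open>L \<otimes> (M \<otimes> N)\<close>.\<close>

lemma tensor_assoc_surj:
  assumes "t \<in> carrier (tensor R L (tensor R M N))"
  obtains s where "s \<in> carrier (tensor R (tensor R L M) N)" "tensor_assoc R L M N s = t"
proof -
  have "\<exists>s\<in>carrier (tensor R (tensor R L M) N). tensor_assoc R L M N s = t"
    using L module_tensor[OF M N] assms
  proof (induction t rule: tensor_induct)
    case (tens x u)
    from M N tens(2) show ?case
    proof (induction u rule: tensor_induct)
      case (tens y z)
      then show ?case using \<open>x \<in> carrier L\<close>
        by (intro bexI[of _ "tens R (tensor R L M) N (tens R L M x y) z"])
            (auto simp: tensor_assoc_tens tens_closed)
    next
      case (add u v)
      then show ?case 
        by (metis linear_add[OF tensor_assoc_linear] tens_add_right[OF L module_tensor[OF M N] \<open>x \<in> carrier L\<close>]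
            abelian_monoid.a_closed[OF abelian_group.axioms(1)[OF abelian_group_tensor[OF module_tensor[OF L
                M] N]]])
    next
      case (neg u)
      then show ?case
        by (metis linear_neg[OF _ _ tensor_assoc_linear] linear_neg[OF _ _ bilinear_right[OF bilinear_tens]]
            abelian_group.a_inv_closed[OF abelian_group_tensor[OF module_tensor[OF L M] N]] \<open>x \<in> carrier L\<close>
            module_tensor L M N)
    qed
  next
    case (add s t)
    then show ?case
      by (metis linear_add[OF tensor_assoc_linear]
          abelian_monoid.a_closed[OF abelian_group.axioms(1)[OF abelian_group_tensor[OF module_tensor[OF L
              M] N]]])
  next
    case (neg t)
    then show ?case
      by (metis linear_neg[OF _ _ tensor_assoc_linear] 
          abelian_group.a_inv_closed[OF abelian_group_tensor[OF module_tensor[OF L M] N]]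
          module_tensor L M N)
  qed
  then show ?thesis using that by blast
qed

end


section \<open>Sweedler calculus\<close>

lemma linear_mult_right:
  assumes "cring R" "c \<in> carrier R" "f \<in> linear_maps R M (regular_module R)"
  shows "(\<lambda>x. c \<otimes>\<^bsub>R\<^esub> f x) \<in> linear_maps R M (regular_module R)"
  using linear_smult_right[OF module_regular[OF assms(1)] _ assms(3), of c] assms(2) by simp

lemma linear_mult_left:
  assumes "cring R" "c \<in> carrier R" "f \<in> linear_maps R M (regular_module R)"
  shows "(\<lambda>x. f x \<otimes>\<^bsub>R\<^esub> c) \<in> linear_maps R M (regular_module R)"
  using linear_smult_left[OF module_regular[OF assms(1)] _ assms(3), of c] assms(2) by simp

lemma (in coalgebra) comult_closed: "c \<in> carrier C \<Longrightarrow> comult C c \<in> carrier (tensor R C C)"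
  using linear_closed[OF comult_linear] .

lemma (in coalgebra) counit_closed: "c \<in> carrier C \<Longrightarrow> counit C c \<in> carrier R"
  using linear_closed[OF counit_linear] by simp

text \<open>In contrast to \<open>linear_lift\<close>, the two factors of the tensor product can be read off the term
  \<open>comult C c\<close>. The multilinearity of an iterated Sweedler sum can therefore be derived by
  resolution with introduction rules alone.\<close>

lemma linear_sweedler:
  assumes "coalgebra R C" "module R L" "module R P" "c \<in> carrier C"
    and "\<And>x. x \<in> carrier P \<Longrightarrow> bilinear R C C L (f x)"
    and "\<And>u v. \<lbrakk>u \<in> carrier C; v \<in> carrier C\<rbrakk> \<Longrightarrow> (\<lambda>x. f x u v) \<in> linear_maps R P L"
  shows "(\<lambda>x. tensor_lift L (f x) (comult C c)) \<in> linear_maps R P L"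
  by (rule linear_lift[OF coalgebra.module coalgebra.module assms(2,3) coalgebra.comult_closed])
    (use assms in auto)

lemma linear_sweedler_arg:
  assumes "coalgebra R C" "module R L" "bilinear R C C L f" "g \<in> linear_maps R P C"
  shows "(\<lambda>x. tensor_lift L f (comult C (g x))) \<in> linear_maps R P L"
  using linear_lift_arg[OF coalgebra.module coalgebra.module assms(2,3)
      linear_compose[OF coalgebra.comult_linear assms(4)]] assms(1) by blast

lemma sweedler_cong:
  assumes "coalgebra R C" "module R L" "bilinear R C C L f" "c \<in> carrier C"
    and "\<And>x y. \<lbrakk>x \<in> carrier C; y \<in> carrier C\<rbrakk> \<Longrightarrow> f x y = g x y"
  shows "tensor_lift L f (comult C c) = tensor_lift L g (comult C c)"
  using tensor_lift_cong[OF coalgebra.module coalgebra.module assms(2,3) coalgebra.comult_closed assms(5)]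
    assms by blast

lemma sweedler_natural:
  assumes "coalgebra R C" "module R L" "module R L'" "\<phi> \<in> linear_maps R L L'" "bilinear R C C L f"
    and "c \<in> carrier C"
  shows "\<phi> (tensor_lift L f (comult C c)) = tensor_lift L' (\<lambda>x y. \<phi> (f x y)) (comult C c)"
  using tensor_lift_natural[OF coalgebra.module coalgebra.module assms(2,3,5,4) coalgebra.comult_closed]
    assms by blast

lemma sweedler_swap:
  assumes "coalgebra R C" "coalgebra R D" "module R L" "c \<in> carrier C" "d \<in> carrier D"
    and "\<And>x y. \<lbrakk>x \<in> carrier C; y \<in> carrier C\<rbrakk> \<Longrightarrow> bilinear R D D L (\<lambda>u v. f x y u v)"
    and "\<And>u v. \<lbrakk>u \<in> carrier D; v \<in> carrier D\<rbrakk> \<Longrightarrow> bilinear R C C L (\<lambda>x y. f x y u v)"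
  shows "tensor_lift L (\<lambda>x y. tensor_lift L (\<lambda>u v. f x y u v) (comult D d)) (comult C c) =
    tensor_lift L (\<lambda>u v. tensor_lift L (\<lambda>x y. f x y u v) (comult C c)) (comult D d)"
  using tensor_lift_swap[OF coalgebra.module[OF assms(1)] coalgebra.module[OF assms(1)] 
      coalgebra.module[OF assms(2)] coalgebra.module[OF assms(2)] assms(3)
      coalgebra.comult_closed[OF assms(1,4)] coalgebra.comult_closed[OF assms(2,5)] assms(6,7)] by blast

context coalgebra
begin

text \<open>Coassociativity \<open>\<Sum> g(c\<^sub>1\<^sub>1, c\<^sub>1\<^sub>2, c\<^sub>2) = \<Sum> g(c\<^sub>1, c\<^sub>2\<^sub>1, c\<^sub>2\<^sub>2)\<close> for trilinear \<open>g\<close>: apply the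
  linear map induced by \<open>g\<close> on \<open>C \<otimes> (C \<otimes> C)\<close> to both sides of the axiom.\<close>

lemma coassoc_lift:
  assumes L: "module R L" and c: "c \<in> carrier C"
    and b1: "\<And>z. z \<in> carrier C \<Longrightarrow> bilinear R C C L (\<lambda>x y. g x y z)"
    and b2: "\<And>x. x \<in> carrier C \<Longrightarrow> bilinear R C C L (\<lambda>y z. g x y z)"
  shows "tensor_lift L (\<lambda>x y. tensor_lift L (\<lambda>u v. g u v y) (comult C x)) (comult C c) =
    tensor_lift L (\<lambda>x y. tensor_lift L (\<lambda>u v. g x u v) (comult C y)) (comult C c)"
proof -
  note C = module and T = module_tensor[OF module module]
  let ?CC = "tensor R C C"
  define G where "G = tensor_lift L (\<lambda>x s. tensor_lift L (\<lambda>u v. g x u v) s)"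
  have bG: "bilinear R C ?CC L (\<lambda>x s. tensor_lift L (\<lambda>u v. g x u v) s)"
    by (rule bilinearI[OF tensor_lift_linear[OF C C L b2] linear_lift[OF C C L C _ b2]])
      (auto intro: bilinear_left[OF b1])
  have G: "G \<in> linear_maps R (tensor R C ?CC) L"
    unfolding G_def by (rule tensor_lift_linear[OF C T L bG])
  have G_tens: "G (tens R C ?CC x s) = tensor_lift L (\<lambda>u v. g x u v) s"
    if "x \<in> carrier C" "s \<in> carrier ?CC" for x s
    unfolding G_def by (rule tensor_lift_tens[OF C T L bG that])
  have comult: "comult C x \<in> carrier ?CC" if "x \<in> carrier C" for x using comult_closed that .
  have right: "G (tensor_map R C ?CC (\<lambda>x. x) (comult C) (comult C c)) =
      tensor_lift L (\<lambda>x y. tensor_lift L (\<lambda>u v. g x u v) (comult C y)) (comult C c)"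
    unfolding G_def by (rule tensor_lift_map[OF C C C T L linear_id comult_linear bG comult[OF c]])
  define G' where "G' = (\<lambda>s. G (tensor_assoc R C C C s))"
  have G': "G' \<in> linear_maps R (tensor R ?CC C) L"
    unfolding G'_def by (rule linear_compose[OF G tensor_assoc_linear[OF C C C]])
  have G'_tens: "G' (tens R ?CC C s z) = tensor_lift L (\<lambda>u v. g u v z) s"
    if s: "s \<in> carrier ?CC" and z: "z \<in> carrier C" for s z
  proof (rule tensor_ext[OF C C L _ tensor_lift_linear[OF C C L b1[OF z]] _ s])
    show "(\<lambda>s. G' (tens R ?CC C s z)) \<in> linear_maps R ?CC L"
      using linear_compose[OF G' bilinear_left[OF bilinear_tens[OF T C] z]] .
    show "G' (tens R ?CC C (tens R C C x y) z) = tensor_lift L (\<lambda>u v. g u v z) (tens R C C x y)"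
      if "x \<in> carrier C" "y \<in> carrier C" for x y
      using that z by (simp add: G'_def tensor_assoc_tens[OF C C C] G_tens tens_closed
          tensor_lift_tens[OF C C L b1] tensor_lift_tens[OF C C L b2])
  qed
  have lin: "tensor_map R ?CC C (comult C) (\<lambda>x. x) \<in> linear_maps R ?CC (tensor R ?CC C)"
    by (rule tensor_map_linear[OF C C T C comult_linear linear_id])
  have "G' (tensor_map R ?CC C (comult C) (\<lambda>x. x) (comult C c)) =
      tensor_lift L (\<lambda>x y. G' (tensor_map R ?CC C (comult C) (\<lambda>x. x) (tens R C C x y))) (comult C c)"
    by (rule tensor_lift_eq[OF C C L linear_compose[OF G' lin] comult[OF c]])
  also have "\<dots> = tensor_lift L (\<lambda>x y. tensor_lift L (\<lambda>u v. g u v y) (comult C x)) (comult C c)"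
    by (rule tensor_lift_cong[OF C C L bilinear_compose[OF linear_compose[OF G' lin] bilinear_tens[OF C C]]
        comult[OF c]])
      (simp add: tensor_map_tens[OF C C T C comult_linear linear_id] G'_tens comult)
  finally show ?thesis
    using right coassoc[OF c] by (simp add: G'_def)
qed

lemma counit_lift_left:
  assumes L: "module R L" and c: "c \<in> carrier C" and f: "f \<in> linear_maps R C L"
  shows "tensor_lift L (\<lambda>x y. counit C x \<odot>\<^bsub>L\<^esub> f y) (comult C c) = f c"
proof -
  note C = module
  have b: "bilinear R C C C (\<lambda>x y. counit C x \<odot>\<^bsub>C\<^esub> y)"
    by (intro bilinearI linear_smult_right linear_smult_left C linear_id counit_linear counit_closed)
  have "f c = f (tensor_lift C (\<lambda>x y. counit C x \<odot>\<^bsub>C\<^esub> y) (comult C c))"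
    using counit_left[OF c] by simp
  also have "\<dots> = tensor_lift L (\<lambda>x y. f (counit C x \<odot>\<^bsub>C\<^esub> y)) (comult C c)"
    by (rule tensor_lift_natural[OF C C C L b f comult_closed[OF c]])
  also have "\<dots> = tensor_lift L (\<lambda>x y. counit C x \<odot>\<^bsub>L\<^esub> f y) (comult C c)"
    by (rule tensor_lift_cong[OF C C L bilinear_compose[OF f b] comult_closed[OF c]])
      (rule linear_smult[OF f counit_closed])
  finally show ?thesis by simp
qed

lemma counit_lift_right:
  assumes L: "module R L" and c: "c \<in> carrier C" and f: "f \<in> linear_maps R C L"
  shows "tensor_lift L (\<lambda>x y. counit C y \<odot>\<^bsub>L\<^esub> f x) (comult C c) = f c"
proof -
  note C = module
  have b: "bilinear R C C C (\<lambda>x y. counit C y \<odot>\<^bsub>C\<^esub> x)"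
    by (intro bilinearI linear_smult_right linear_smult_left C linear_id counit_linear counit_closed)
  have "f c = f (tensor_lift C (\<lambda>x y. counit C y \<odot>\<^bsub>C\<^esub> x) (comult C c))"
    using counit_right[OF c] by simp
  also have "\<dots> = tensor_lift L (\<lambda>x y. f (counit C y \<odot>\<^bsub>C\<^esub> x)) (comult C c)"
    by (rule tensor_lift_natural[OF C C C L b f comult_closed[OF c]])
  also have "\<dots> = tensor_lift L (\<lambda>x y. counit C y \<odot>\<^bsub>L\<^esub> f x) (comult C c)"
    by (rule tensor_lift_cong[OF C C L bilinear_compose[OF f b] comult_closed[OF c]])
      (rule linear_smult[OF f counit_closed])
  finally show ?thesis by simp
qed

end

section \<open>Convolution of bilinear forms\<close>

text \<open>The product of the dual algebra of the coalgebra \<open>C \<otimes> D\<close>, whose elements are the bilinear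
  forms on \<open>C \<times> D\<close>.\<close>

definition convolution ::
  "('r, 'z) ring_scheme \<Rightarrow> ('r, 'c) hopf \<Rightarrow> ('r, 'd) hopf \<Rightarrow>
   ('c \<Rightarrow> 'd \<Rightarrow> 'r) \<Rightarrow> ('c \<Rightarrow> 'd \<Rightarrow> 'r) \<Rightarrow> 'c \<Rightarrow> 'd \<Rightarrow> 'r" where
  "convolution R C D f g c d =
     tensor_lift (regular_module R) (\<lambda>c1 c2. tensor_lift (regular_module R)
       (\<lambda>d1 d2. f c1 d1 \<otimes>\<^bsub>R\<^esub> g c2 d2) (comult D d)) (comult C c)"

context
  fixes R :: "('r, 'z) ring_scheme" and C :: "('r, 'c) hopf" and D :: "('r, 'd) hopf"
  assumes R: "cring R" and C: "coalgebra R C" and D: "coalgebra R D"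
begin

interpretation R: cring R by (rule R)
interpretation C: coalgebra R C by (rule C)
interpretation D: coalgebra R D by (rule D)

abbreviation (input) reg where "reg \<equiv> regular_module R"

lemma linear_form_left: "\<lbrakk>bilinear R C D reg f; d \<in> carrier D; g \<in> linear_maps R P C\<rbrakk> \<Longrightarrow>
    (\<lambda>x. f (g x) d) \<in> linear_maps R P reg"
  by (rule linear_compose[OF bilinear_left])

lemma linear_form_right: "\<lbrakk>bilinear R C D reg f; c \<in> carrier C; g \<in> linear_maps R P D\<rbrakk> \<Longrightarrow>
    (\<lambda>x. f c (g x)) \<in> linear_maps R P reg"
  by (rule linear_compose[OF bilinear_right])

lemma form_closed: "\<lbrakk>bilinear R C D reg f; c \<in> carrier C; d \<in> carrier D\<rbrakk> \<Longrightarrow> f c d \<in> carrier R"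
  using bilinear_closed by fastforce

lemmas form_linear_intros = bilinearI linear_id linear_sweedler[OF C] linear_sweedler[OF D]
    linear_sweedler_arg[OF C]
  linear_sweedler_arg[OF D] linear_mult_left[OF R] linear_mult_right[OF R]
  C.module D.module module_regular[OF R]

lemma convolution_bilinear:
  assumes "bilinear R C D reg f" "bilinear R C D reg g"
  shows "bilinear R C D reg (convolution R C D f g)"
  unfolding convolution_def
  by (intro form_linear_intros assms R.m_closed form_closed[OF assms(1)] form_closed[OF assms(2)]
      linear_form_left[OF assms(1)] linear_form_left[OF assms(2)] linear_form_right[OF assms(1)]
      linear_form_right[OF assms(2)])


text \<open>Convolution products occur as factors inside other convolution products; this moves the other
  factor into the double sum.\<close>

lemma convolution_natural:
  assumes f: "bilinear R C D reg f" and g: "bilinear R C D reg g"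
    and c: "c \<in> carrier C" and d: "d \<in> carrier D" and \<phi>: "\<phi> \<in> linear_maps R reg reg"
  shows "\<phi> (convolution R C D f g c d) =
    tensor_lift reg (\<lambda>c1 c2. tensor_lift reg (\<lambda>d1 d2. \<phi> (f c1 d1 \<otimes>\<^bsub>R\<^esub> g c2 d2)) (comult D d)) (comult C c)"
proof -
  note lns = form_linear_intros linear_form_left[OF f] linear_form_left[OF g] linear_form_right[OF f]
    linear_form_right[OF g] R.m_closed form_closed[OF f] form_closed[OF g] d
  have b: "bilinear R C C reg
      (\<lambda>c1 c2. tensor_lift reg (\<lambda>d1 d2. f c1 d1 \<otimes>\<^bsub>R\<^esub> g c2 d2) (comult D d))"
    by (intro lns)
  have b': "bilinear R D D reg (\<lambda>d1 d2. f c1 d1 \<otimes>\<^bsub>R\<^esub> g c2 d2)"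
    if "c1 \<in> carrier C" "c2 \<in> carrier C" for c1 c2
    by (intro lns that)
  have "\<phi> (convolution R C D f g c d) = tensor_lift reg (\<lambda>c1 c2. \<phi> (tensor_lift reg
      (\<lambda>d1 d2. f c1 d1 \<otimes>\<^bsub>R\<^esub> g c2 d2) (comult D d))) (comult C c)"
    unfolding convolution_def
    by (rule sweedler_natural[OF C module_regular[OF R] module_regular[OF R] \<phi> b c])
  also have "\<dots> = tensor_lift reg (\<lambda>c1 c2. tensor_lift reg (\<lambda>d1 d2. \<phi> (f c1 d1 \<otimes>\<^bsub>R\<^esub> g c2 d2))
      (comult D d)) (comult C c)"
    by (rule sweedler_cong[OF C module_regular[OF R] bilinear_compose[OF \<phi> b] c])
      (rule sweedler_natural[OF D module_regular[OF R] module_regular[OF R] \<phi> b' d])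
  finally show ?thesis .
qed

text \<open>Both bracketings are triple sums over the iterated coproducts of \<open>c\<close> and \<open>d\<close>. Interchanging
  the sum over one element with that over the other brings the two coproducts of the same element
  next to each other, where coassociativity applies.\<close>

lemma convolution_assoc:
  assumes f: "bilinear R C D reg f" and g: "bilinear R C D reg g" and k: "bilinear R C D reg k"
    and c: "c \<in> carrier C" and d: "d \<in> carrier D"
  shows "convolution R C D (convolution R C D f g) k c d = convolution R C D f (convolution R C D g k) c d"
proof -
  let ?L = "tensor_lift reg"
  let ?G = "\<lambda>x1 x2 x3 u1 u2 u3. f x1 u1 \<otimes>\<^bsub>R\<^esub> (g x2 u2 \<otimes>\<^bsub>R\<^esub> k x3 u3)"
  note M = module_regular[OF R]
  note lns = form_linear_intros linear_form_left[OF f] linear_form_left[OF g] linear_form_left[OF k]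
    linear_form_right[OF f] linear_form_right[OF g] linear_form_right[OF k]
    R.m_closed form_closed[OF f] form_closed[OF g] form_closed[OF k] c d
  note fg = convolution_bilinear[OF f g] and gk = convolution_bilinear[OF g k]
  have "convolution R C D (convolution R C D f g) k c d =
    ?L (\<lambda>x y. ?L (\<lambda>u v. ?L (\<lambda>x1 x2. ?L (\<lambda>u1 u2. ?G x1 x2 y u1 u2 v) (comult D u)) (comult C x))
      (comult D d)) (comult C c)"
  proof -
    have e: "convolution R C D f g x u \<otimes>\<^bsub>R\<^esub> k y v =
      ?L (\<lambda>x1 x2. ?L (\<lambda>u1 u2. ?G x1 x2 y u1 u2 v) (comult D u)) (comult C x)"
      if "x \<in> carrier C" "y \<in> carrier C" "u \<in> carrier D" "v \<in> carrier D" for x y u v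
    proof -
      have *: "(\<lambda>r. r \<otimes>\<^bsub>R\<^esub> k y v) \<in> linear_maps R reg reg" by (intro lns that)
      have "bilinear R C C reg (\<lambda>x1 x2. ?L (\<lambda>u1 u2. f x1 u1 \<otimes>\<^bsub>R\<^esub> g x2 u2 \<otimes>\<^bsub>R\<^esub> k y v) (comult D u))"
        by (intro lns that)
      moreover have "bilinear R D D reg (\<lambda>u1 u2. f x1 u1 \<otimes>\<^bsub>R\<^esub> g x2 u2 \<otimes>\<^bsub>R\<^esub> k y v)"
        if "x1 \<in> carrier C" "x2 \<in> carrier C" for x1 x2
        by (intro lns that \<open>y \<in> _\<close> \<open>v \<in> _\<close>)
      ultimately show ?thesis
        unfolding convolution_natural[OF f g \<open>x \<in> _\<close> \<open>u \<in> _\<close> *] using that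
        by (auto intro!: sweedler_cong[OF C M] sweedler_cong[OF D M]
            simp: form_closed[OF f] form_closed[OF g] form_closed[OF k] R.m_assoc)
    qed
    show ?thesis
      unfolding convolution_def[of R C D "convolution R C D f g"]
      by (intro sweedler_cong[OF C M] sweedler_cong[OF D M] e lns convolution_bilinear
          linear_form_left[OF fg] linear_form_right[OF fg] form_closed[OF fg])
  qed
  also have "\<dots> = ?L (\<lambda>x y. ?L (\<lambda>x1 x2. ?L (\<lambda>u v. ?L (\<lambda>u1 u2. ?G x1 x2 y u1 u2 v) (comult D u))
      (comult D d)) (comult C x)) (comult C c)"
    by (intro sweedler_cong[OF C M] sweedler_swap[OF D C M] lns)
  also have "\<dots> = ?L (\<lambda>x y. ?L (\<lambda>x1 x2. ?L (\<lambda>u v. ?L (\<lambda>v1 v2. ?G x1 x2 y u v1 v2) (comult D v))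
      (comult D d)) (comult C x)) (comult C c)"
    by (intro sweedler_cong[OF C M] D.coassoc_lift[OF M] lns)
  also have "\<dots> = ?L (\<lambda>x y. ?L (\<lambda>y1 y2. ?L (\<lambda>u v. ?L (\<lambda>v1 v2. ?G x y1 y2 u v1 v2) (comult D v))
      (comult D d)) (comult C y)) (comult C c)"
    by (intro C.coassoc_lift[OF M] lns)
  also have "\<dots> = ?L (\<lambda>x y. ?L (\<lambda>u v. ?L (\<lambda>y1 y2. ?L (\<lambda>v1 v2. ?G x y1 y2 u v1 v2) (comult D v))
      (comult C y)) (comult D d)) (comult C c)"
    by (intro sweedler_cong[OF C M] sweedler_swap[OF C D M] lns)
  also have "\<dots> = convolution R C D f (convolution R C D g k) c d"
  proof -
    have e: "?L (\<lambda>y1 y2. ?L (\<lambda>v1 v2. ?G x y1 y2 u v1 v2) (comult D v)) (comult C y) = 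
        f x u \<otimes>\<^bsub>R\<^esub> convolution R C D g k y v"
      if "x \<in> carrier C" "y \<in> carrier C" "u \<in> carrier D" "v \<in> carrier D" for x y u v
      by (rule convolution_natural[OF g k \<open>y \<in> _\<close> \<open>v \<in> _\<close>, symmetric]) (intro lns that)
    show ?thesis
      unfolding convolution_def[of R C D f]
      by (intro sweedler_cong[OF C M] sweedler_cong[OF D M] e lns)
  qed
  finally show ?thesis .
qed

lemma convolution_unit_left:
  assumes f: "bilinear R C D reg f" and c: "c \<in> carrier C" and d: "d \<in> carrier D"
    and u: "\<And>c d. \<lbrakk>c \<in> carrier C; d \<in> carrier D\<rbrakk> \<Longrightarrow> u c d = counit C c \<otimes>\<^bsub>R\<^esub> counit D d"
  shows "convolution R C D u f c d = f c d"
proof -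
  note M = module_regular[OF R]
  note lns = form_linear_intros linear_form_left[OF f] linear_form_right[OF f] form_closed[OF f] c d
      R.m_closed C.counit_closed D.counit_closed C.counit_linear D.counit_linear
  have "convolution R C D u f c d =
    tensor_lift reg (\<lambda>c1 c2. tensor_lift reg (\<lambda>d1 d2. counit C c1 \<otimes>\<^bsub>R\<^esub> (counit D d1 \<otimes>\<^bsub>R\<^esub> f c2 d2))
        (comult D d)) (comult C c)"
    unfolding convolution_def
    by (rule sym, intro sweedler_cong[OF C M] sweedler_cong[OF D M] lns)
      (simp_all add: u R.m_assoc C.counit_closed D.counit_closed form_closed[OF f])
  also have "\<dots> = tensor_lift reg (\<lambda>c1 c2. counit C c1 \<otimes>\<^bsub>R\<^esub> f c2 d) (comult C c)"
  proof (rule sweedler_cong[OF C M _ c])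
    fix x y assume xy: "x \<in> carrier C" "y \<in> carrier C"
    have "counit C x \<otimes>\<^bsub>R\<^esub> tensor_lift reg (\<lambda>d1 d2. counit D d1 \<otimes>\<^bsub>R\<^esub> f y d2) (comult D d) =
      tensor_lift reg (\<lambda>d1 d2. counit C x \<otimes>\<^bsub>R\<^esub> (counit D d1 \<otimes>\<^bsub>R\<^esub> f y d2)) (comult D d)"
      by (rule sweedler_natural[OF D M M _ _ d]) (intro lns xy)+
    then show "tensor_lift reg (\<lambda>d1 d2. counit C x \<otimes>\<^bsub>R\<^esub> (counit D d1 \<otimes>\<^bsub>R\<^esub> f y d2)) (comult D d) =
        counit C x \<otimes>\<^bsub>R\<^esub> f y d"
      using D.counit_lift_left[OF M d bilinear_right[OF f xy(2)]] by simp
  qed (intro lns)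
  also have "\<dots> = f c d"
    using C.counit_lift_left[OF M c bilinear_left[OF f d]] by simp
  finally show ?thesis .
qed

lemma convolution_unit_right:
  assumes f: "bilinear R C D reg f" and c: "c \<in> carrier C" and d: "d \<in> carrier D"
    and u: "\<And>c d. \<lbrakk>c \<in> carrier C; d \<in> carrier D\<rbrakk> \<Longrightarrow> u c d = counit C c \<otimes>\<^bsub>R\<^esub> counit D d"
  shows "convolution R C D f u c d = f c d"
proof -
  note M = module_regular[OF R]
  note lns = form_linear_intros linear_form_left[OF f] linear_form_right[OF f] form_closed[OF f] c d
      R.m_closed C.counit_closed D.counit_closed C.counit_linear D.counit_linear
  have "convolution R C D f u c d =
    tensor_lift reg (\<lambda>c1 c2. tensor_lift reg (\<lambda>d1 d2. counit C c2 \<otimes>\<^bsub>R\<^esub> (counit D d2 \<otimes>\<^bsub>R\<^esub> f c1 d1))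
        (comult D d)) (comult C c)"
    unfolding convolution_def
    by (rule sym, intro sweedler_cong[OF C M] sweedler_cong[OF D M] lns)
      (simp_all add: u R.m_ac C.counit_closed D.counit_closed form_closed[OF f])
  also have "\<dots> = tensor_lift reg (\<lambda>c1 c2. counit C c2 \<otimes>\<^bsub>R\<^esub> f c1 d) (comult C c)"
  proof (rule sweedler_cong[OF C M _ c])
    fix x y assume xy: "x \<in> carrier C" "y \<in> carrier C"
    have "counit C y \<otimes>\<^bsub>R\<^esub> tensor_lift reg (\<lambda>d1 d2. counit D d2 \<otimes>\<^bsub>R\<^esub> f x d1) (comult D d) =
      tensor_lift reg (\<lambda>d1 d2. counit C y \<otimes>\<^bsub>R\<^esub> (counit D d2 \<otimes>\<^bsub>R\<^esub> f x d1)) (comult D d)"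
      by (rule sweedler_natural[OF D M M _ _ d]) (intro lns xy)+
    then show "tensor_lift reg (\<lambda>d1 d2. counit C y \<otimes>\<^bsub>R\<^esub> (counit D d2 \<otimes>\<^bsub>R\<^esub> f x d1)) (comult D d) =
        counit C y \<otimes>\<^bsub>R\<^esub> f x d"
      using D.counit_lift_right[OF M d bilinear_right[OF f xy(1)]] by simp
  qed (intro lns)
  also have "\<dots> = f c d"
    using C.counit_lift_right[OF M c bilinear_left[OF f d]] by simp
  finally show ?thesis .
qed

text \<open>A left inverse \<open>f\<close> and a right inverse \<open>k\<close> of \<open>g\<close> agree: \<open>f = f * (g * k) = (f * g) * k = k\<close>.\<close>

lemma convolution_inverse_unique:
  assumes f: "bilinear R C D reg f" and g: "bilinear R C D reg g" and k: "bilinear R C D reg k"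
    and fg: "\<And>c d. \<lbrakk>c \<in> carrier C; d \<in> carrier D\<rbrakk> \<Longrightarrow>
      convolution R C D f g c d = counit C c \<otimes>\<^bsub>R\<^esub> counit D d"
    and gk: "\<And>c d. \<lbrakk>c \<in> carrier C; d \<in> carrier D\<rbrakk> \<Longrightarrow>
      convolution R C D g k c d = counit C c \<otimes>\<^bsub>R\<^esub> counit D d"
    and c: "c \<in> carrier C" and d: "d \<in> carrier D"
  shows "f c d = k c d"
  using convolution_unit_left[OF k c d fg] convolution_unit_right[OF f c d gk]
    convolution_assoc[OF f g k c d] by simp

end


section \<open>Hopf pairings\<close>

lemma (in assoc_algebra) bilinear_mult: "bilinear R A A A (\<otimes>\<^bsub>A\<^esub>)"
proof -
  interpret ring A by (rule ring)
  show ?thesis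
    by (intro bilinearI linear_mapsI) (simp_all add: l_distr r_distr smult_mult_left smult_mult_right)
qed

context bialgebra_pairing
begin

lemma algebra_H: "assoc_algebra R H" and algebra_K: "assoc_algebra R K"
  and coalgebra_H: "coalgebra R H" and coalgebra_K: "coalgebra R K"
  using bialgebra_H bialgebra_K by (simp_all add: bialgebra_def)

lemmas module_H = assoc_algebra.module[OF algebra_H]
lemmas module_K = assoc_algebra.module[OF algebra_K]

lemma R_cring: "cring R"
  using module_H by (rule module.axioms)

lemma bilinear_form: "bilinear R H K (regular_module R) \<beta>"
  by (intro bilinearI linear_left linear_right)

lemma pair_closed: "\<lbrakk>h \<in> carrier H; k \<in> carrier K\<rbrakk> \<Longrightarrow> \<beta> h k \<in> carrier R"
  using bilinear_closed[OF bilinear_form] by simp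

lemma linear_pair_left: "\<lbrakk>g \<in> linear_maps R M H; k \<in> carrier K\<rbrakk> \<Longrightarrow>
    (\<lambda>x. \<beta> (g x) k) \<in> linear_maps R M (regular_module R)"
  by (rule linear_compose[OF linear_left])

lemma linear_pair_right: "\<lbrakk>h \<in> carrier H; g \<in> linear_maps R M K\<rbrakk> \<Longrightarrow>
    (\<lambda>x. \<beta> h (g x)) \<in> linear_maps R M (regular_module R)"
  by (rule linear_compose[OF linear_right])

lemmas pair_lin = bilinearI linear_id linear_mult_left[OF R_cring] linear_mult_right[OF R_cring]
  linear_pair_left linear_pair_right pair_closed

text \<open>This is the multiplicativity of \<open>h \<mapsto> \<langle>h, -\<rangle>\<close>, with the convolution product of the dual algebra
  evaluated at \<open>k\<close>.\<close>

lemma pair_mult_left: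
  assumes "h \<in> carrier H" "h' \<in> carrier H" "k \<in> carrier K"
  shows "\<beta> (h \<otimes>\<^bsub>H\<^esub> h') k =
    tensor_lift (regular_module R) (\<lambda>k1 k2. \<beta> h k1 \<otimes>\<^bsub>R\<^esub> \<beta> h' k2) (comult K k)"
proof -
  let ?f = "\<lambda>h. \<lambda>k\<in>carrier K. \<beta> h k"
  have "?f (h \<otimes>\<^bsub>H\<^esub> h') = ?f h \<otimes>\<^bsub>dual_algebra R K\<^esub> ?f h'"
    by (rule ring_hom_mult[of ?f H "dual_algebra R K", OF _ assms(1,2)])
        (use kappa_hom in \<open>simp add: algebra_homs_def\<close>)
  from fun_cong[OF this, of k] have "\<beta> (h \<otimes>\<^bsub>H\<^esub> h') k =
      tensor_lift (regular_module R) (\<lambda>x y. ?f h x \<otimes>\<^bsub>R\<^esub> ?f h' y) (comult K k)"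
    using assms(3) by (simp add: dual_algebra_def flip: tensor_lift_regular[of R])
  also have "\<dots> = tensor_lift (regular_module R) (\<lambda>k1 k2. \<beta> h k1 \<otimes>\<^bsub>R\<^esub> \<beta> h' k2) (comult K k)"
    by (rule sym, rule sweedler_cong[OF coalgebra_K module_regular[OF R_cring] _ assms(3)])
      (intro pair_lin assms, simp_all)
  finally show ?thesis .
qed

lemma pair_mult_right:
  assumes "h \<in> carrier H" "k \<in> carrier K" "k' \<in> carrier K"
  shows "\<beta> h (k \<otimes>\<^bsub>K\<^esub> k') =
    tensor_lift (regular_module R) (\<lambda>h1 h2. \<beta> h1 k \<otimes>\<^bsub>R\<^esub> \<beta> h2 k') (comult H h)"
proof -
  let ?f = "\<lambda>k. \<lambda>h\<in>carrier H. \<beta> h k"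
  have "?f (k \<otimes>\<^bsub>K\<^esub> k') = ?f k \<otimes>\<^bsub>dual_algebra R H\<^esub> ?f k'"
    by (rule ring_hom_mult[of ?f K "dual_algebra R H", OF _ assms(2,3)])
        (use chi_hom in \<open>simp add: algebra_homs_def\<close>)
  from fun_cong[OF this, of h] have "\<beta> h (k \<otimes>\<^bsub>K\<^esub> k') =
      tensor_lift (regular_module R) (\<lambda>x y. ?f k x \<otimes>\<^bsub>R\<^esub> ?f k' y) (comult H h)"
    using assms(1) by (simp add: dual_algebra_def flip: tensor_lift_regular[of R])
  also have "\<dots> = tensor_lift (regular_module R) (\<lambda>h1 h2. \<beta> h1 k \<otimes>\<^bsub>R\<^esub> \<beta> h2 k') (comult H h)"
    by (rule sym, rule sweedler_cong[OF coalgebra_H module_regular[OF R_cring] _ assms(1)])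
      (intro pair_lin assms, simp_all)
  finally show ?thesis .
qed

lemma pair_one_left: "k \<in> carrier K \<Longrightarrow> \<beta> \<one>\<^bsub>H\<^esub> k = counit K k"
  using ring_hom_one[of "\<lambda>h. \<lambda>k\<in>carrier K. \<beta> h k" H "dual_algebra R K"] kappa_hom
  by (auto simp: algebra_homs_def dual_algebra_def fun_eq_iff split: if_splits) 

lemma pair_one_right: "h \<in> carrier H \<Longrightarrow> \<beta> h \<one>\<^bsub>K\<^esub> = counit H h"
  using ring_hom_one[of "\<lambda>k. \<lambda>h\<in>carrier H. \<beta> h k" K "dual_algebra R H"] chi_hom
  by (auto simp: algebra_homs_def dual_algebra_def fun_eq_iff split: if_splits)

end

lemma bialgebra_homsD:
  assumes "f \<in> bialgebra_homs R H K"
  shows "f \<in> linear_maps R H K" "\<And>x. x \<in> carrier H \<Longrightarrow> f x \<in> carrier K"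
    "\<And>x y. \<lbrakk>x \<in> carrier H; y \<in> carrier H\<rbrakk> \<Longrightarrow> f (x \<otimes>\<^bsub>H\<^esub> y) = f x \<otimes>\<^bsub>K\<^esub> f y" "f \<one>\<^bsub>H\<^esub> = \<one>\<^bsub>K\<^esub>"
    "\<And>x. x \<in> carrier H \<Longrightarrow> comult K (f x) = tensor_map R K K f f (comult H x)"
    "\<And>x. x \<in> carrier H \<Longrightarrow> counit K (f x) = counit H x"
  using assms by (auto simp: bialgebra_homs_def algebra_homs_def ring_hom_def linear_maps_def)

text \<open>A bialgebra morphism \<open>f\<close> commutes with comultiplication, so the antipode axioms at \<open>f c\<close> pull
  back along \<open>f\<close>: \<open>S \<circ> f\<close> is the convolution inverse of \<open>f\<close>.\<close>

lemma (in hopf_algebra) antipode_convolution: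
  assumes C: "coalgebra R C" and f: "f \<in> bialgebra_homs R C H" and c: "c \<in> carrier C"
  shows "tensor_lift H (\<lambda>x y. antipode H (f x) \<otimes>\<^bsub>H\<^esub> f y) (comult C c) = counit C c \<odot>\<^bsub>H\<^esub> \<one>\<^bsub>H\<^esub>"
    and "tensor_lift H (\<lambda>x y. f x \<otimes>\<^bsub>H\<^esub> antipode H (f y)) (comult C c) = counit C c \<odot>\<^bsub>H\<^esub> \<one>\<^bsub>H\<^esub>"
proof -
  note H = assoc_algebra.module[OF assoc_algebra] and b = assoc_algebra.bilinear_mult[OF assoc_algebra]
  note fD = bialgebra_homsD[OF f] and M = coalgebra.module[OF C]
  have S: "antipode H x \<in> carrier H" if "x \<in> carrier H" for x
    using linear_closed[OF antipode_linear that] .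
  have b1: "bilinear R H H H (\<lambda>x y. antipode H x \<otimes>\<^bsub>H\<^esub> y)"
    by (intro bilinearI linear_compose[OF bilinear_left[OF b] antipode_linear] bilinear_right[OF b] S)
  have b2: "bilinear R H H H (\<lambda>x y. x \<otimes>\<^bsub>H\<^esub> antipode H y)"
    by (intro bilinearI linear_compose[OF bilinear_right[OF b] antipode_linear] bilinear_left[OF b] S)
  show "tensor_lift H (\<lambda>x y. antipode H (f x) \<otimes>\<^bsub>H\<^esub> f y) (comult C c) = counit C c \<odot>\<^bsub>H\<^esub> \<one>\<^bsub>H\<^esub>"
    using antipode_left[OF fD(2)[OF c]] c
      tensor_lift_map[OF M M H H H fD(1) fD(1) b1 coalgebra.comult_closed[OF C c]] by (simp add: fD(5,6))
  show "tensor_lift H (\<lambda>x y. f x \<otimes>\<^bsub>H\<^esub> antipode H (f y)) (comult C c) = counit C c \<odot>\<^bsub>H\<^esub> \<one>\<^bsub>H\<^esub>"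
    using antipode_right[OF fD(2)[OF c]] c
      tensor_lift_map[OF M M H H H fD(1) fD(1) b2 coalgebra.comult_closed[OF C c]] by (simp add: fD(5,6))
qed

locale coinduction =
  P: hopf_alpha_pairing R H K \<beta> + Q: hopf_alpha_pairing R Y Z \<gamma> + pairing_morphism R Y Z \<gamma> H K \<beta> \<xi> \<theta>
  for R :: "('r, 'z) ring_scheme"
    and H :: "('r, 'h) hopf" and K :: "('r, 'k) hopf" and \<beta> :: "'h \<Rightarrow> 'k \<Rightarrow> 'r"
    and Y :: "('r, 'y) hopf" and Z :: "('r, 'c) hopf" and \<gamma> :: "'y \<Rightarrow> 'c \<Rightarrow> 'r"
    and \<xi> :: "'h \<Rightarrow> 'y" and \<theta> :: "'c \<Rightarrow> 'k"
begin

lemmas xi = bialgebra_homsD[OF xi_hom]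
lemmas theta = bialgebra_homsD[OF theta_hom]

lemma antipode_Y: "antipode Y \<in> linear_maps R Y Y" "y \<in> carrier Y \<Longrightarrow> antipode Y y \<in> carrier Y"
  using hopf_algebra.antipode_linear[OF Q.hopf_H] by (auto dest: linear_closed)

lemma antipode_K: "antipode K \<in> linear_maps R K K" "k \<in> carrier K \<Longrightarrow> antipode K k \<in> carrier K"
  using hopf_algebra.antipode_linear[OF P.hopf_K] by (auto dest: linear_closed)

text \<open>Both sides are convolution inverses of \<open>(h, z) \<mapsto> \<langle>\<xi> h, z\<rangle> = \<langle>h, \<theta> z\<rangle>\<close> on \<open>H \<times> Z\<close>. For the left
  side sum over the coproduct of \<open>z\<close> first and use the antipode of \<open>Y\<close>, for the right side sum over
  that of \<open>h\<close> first and use the antipode of \<open>K\<close>.\<close>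

lemma antipode_adjoint:
  assumes "h \<in> carrier H" "z \<in> carrier Z"
  shows "\<gamma> (antipode Y (\<xi> h)) z = \<beta> h (antipode K (\<theta> z))"
proof -
  let ?R = "regular_module R"
  note R = P.R_cring
  interpret R: cring R by (rule R)
  note M = module_regular[OF R]
  let ?a = "\<lambda>h z. \<gamma> (\<xi> h) z" and ?b = "\<lambda>h z. \<beta> h (antipode K (\<theta> z))" and ?c = "\<lambda>h z. \<gamma> (antipode Y (\<xi> h)) z"
  have a: "bilinear R H Z ?R ?a"
    by (intro bilinearI Q.linear_pair_left Q.linear_pair_right xi linear_id)
  have b: "bilinear R H Z ?R ?b"
    by (intro bilinearI P.linear_pair_left P.linear_pair_right linear_compose[OF antipode_K(1)]
        antipode_K theta linear_id)
  have c: "bilinear R H Z ?R ?c"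
    by (intro bilinearI Q.linear_pair_left Q.linear_pair_right linear_compose[OF antipode_Y(1)]
        antipode_Y xi linear_id)
  note bY = assoc_algebra.bilinear_mult[OF Q.algebra_H] and bK = assoc_algebra.bilinear_mult[OF P.algebra_K]
  interpret Y: ring Y by (rule assoc_algebra.ring[OF Q.algebra_H])
  interpret K: ring K by (rule assoc_algebra.ring[OF P.algebra_K])
  show ?thesis
  proof (rule convolution_inverse_unique[OF R P.coalgebra_H Q.coalgebra_K c a b _ _ assms])
    fix h z assume h: "h \<in> carrier H" and z: "z \<in> carrier Z"
    have bil: "bilinear R H H Y (\<lambda>h1 h2. antipode Y (\<xi> h1) \<otimes>\<^bsub>Y\<^esub> \<xi> h2)"
      by (intro bilinearI linear_compose[OF bilinear_left[OF bY]] linear_compose[OF bilinear_right[OF bY]]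
          linear_compose[OF antipode_Y(1)] antipode_Y xi)
    have "convolution R H Z ?c ?a h z = tensor_lift ?R (\<lambda>h1 h2. \<gamma> (antipode Y (\<xi> h1) \<otimes>\<^bsub>Y\<^esub> \<xi> h2) z) (comult H h)"
      unfolding convolution_def
      by (rule sym, rule sweedler_cong[OF P.coalgebra_H M bilinear_compose[OF Q.linear_left[OF z] bil] h])
        (simp add: Q.pair_mult_left antipode_Y xi z)
    also have "\<dots> = \<gamma> (tensor_lift Y (\<lambda>h1 h2. antipode Y (\<xi> h1) \<otimes>\<^bsub>Y\<^esub> \<xi> h2) (comult H h)) z"
      by (rule sym, rule sweedler_natural[OF P.coalgebra_H Q.module_H M Q.linear_left[OF z] bil h])
    also have "\<dots> = counit H h \<otimes>\<^bsub>R\<^esub> counit Z z"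
      using linear_smult[OF Q.linear_left[OF z] coalgebra.counit_closed[OF P.coalgebra_H h] Y.one_closed]
      by (simp add: hopf_algebra.antipode_convolution[OF Q.hopf_H P.coalgebra_H xi_hom h] Q.pair_one_left z)
    finally show "convolution R H Z ?c ?a h z = counit H h \<otimes>\<^bsub>R\<^esub> counit Z z" .
  next
    fix h z assume h: "h \<in> carrier H" and z: "z \<in> carrier Z"
    have bil: "bilinear R Z Z K (\<lambda>z1 z2. \<theta> z1 \<otimes>\<^bsub>K\<^esub> antipode K (\<theta> z2))"
      by (intro bilinearI linear_compose[OF bilinear_left[OF bK]] linear_compose[OF bilinear_right[OF bK]]
          linear_compose[OF antipode_K(1)] antipode_K theta)
    have "convolution R H Z ?a ?b h z =
      tensor_lift ?R (\<lambda>z1 z2. tensor_lift ?R (\<lambda>h1 h2. ?a h1 z1 \<otimes>\<^bsub>R\<^esub> ?b h2 z2) (comult H h)) (comult Z z)"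
      unfolding convolution_def
      by (intro sweedler_swap[OF P.coalgebra_H Q.coalgebra_K M h z] bilinearI
          linear_mult_left[OF R] linear_mult_right[OF R] bilinear_left[OF a] bilinear_right[OF a]
          bilinear_left[OF b] bilinear_right[OF b] P.pair_closed Q.pair_closed xi antipode_K theta)
    also have "\<dots> = tensor_lift ?R (\<lambda>z1 z2. tensor_lift ?R
        (\<lambda>h1 h2. \<beta> h1 (\<theta> z1) \<otimes>\<^bsub>R\<^esub> \<beta> h2 (antipode K (\<theta> z2))) (comult H h)) (comult Z z)"
      by (rule sym, intro sweedler_cong[OF Q.coalgebra_K M] sweedler_cong[OF P.coalgebra_H M] bilinearI
          linear_sweedler[OF P.coalgebra_H M] linear_mult_left[OF R] linear_mult_right[OF R]
          P.linear_pair_left P.linear_pair_right linear_compose[OF antipode_K(1)]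
          P.pair_closed h z theta antipode_K Q.module_K linear_id)
        (simp_all add: adjoint)
    also have "\<dots> = tensor_lift ?R (\<lambda>z1 z2. \<beta> h (\<theta> z1 \<otimes>\<^bsub>K\<^esub> antipode K (\<theta> z2))) (comult Z z)"
      by (rule sym, rule sweedler_cong[OF Q.coalgebra_K M bilinear_compose[OF P.linear_right[OF h] bil] z])
        (simp add: P.pair_mult_right antipode_K theta h)
    also have "\<dots> = \<beta> h (tensor_lift K (\<lambda>z1 z2. \<theta> z1 \<otimes>\<^bsub>K\<^esub> antipode K (\<theta> z2)) (comult Z z))"
      by (rule sym, rule sweedler_natural[OF Q.coalgebra_K P.module_K M P.linear_right[OF h] bil z])
    also have "\<dots> = counit H h \<otimes>\<^bsub>R\<^esub> counit Z z"
      using linear_smult[OF P.linear_right[OF h] coalgebra.counit_closed[OF Q.coalgebra_K z] K.one_closed]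
      by (simp add: hopf_algebra.antipode_convolution[OF P.hopf_K Q.coalgebra_K theta_hom z] P.pair_one_right h
          R.m_comm coalgebra.counit_closed[OF Q.coalgebra_K z] coalgebra.counit_closed[OF P.coalgebra_H h])
    finally show "convolution R H Z ?a ?b h z = counit H h \<otimes>\<^bsub>R\<^esub> counit Z z" .
  qed
qed

end


section \<open>Quotient modules and right exactness\<close>

text \<open>The quotient \<open>M/S\<close>, on the same element type as \<open>M\<close>: a coset is represented by a chosen
  element of it, and \<open>\<pi>\<close> maps an element to the representative of its coset.\<close>

lemma module_quotient:
  fixes M :: "('r, 'm, 'x) module_scheme"
  assumes M: "module R M" and S: "submodule S R M"
  obtains Q :: "('r, 'm) module" and \<pi>
  where "module R Q" "\<pi> \<in> linear_maps R M Q" "\<pi> ` carrier M = carrier Q"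
    and "\<And>x. x \<in> carrier M \<Longrightarrow> \<pi> x = \<zero>\<^bsub>Q\<^esub> \<longleftrightarrow> x \<in> S"
proof -
  interpret M: module R M by fact
  note SE = M.submoduleE[OF S]
  have S0: "\<zero>\<^bsub>M\<^esub> \<in> S" using subgroup.one_closed[OF submodule.axioms(1)[OF S]] by simp
  define \<pi> where "\<pi> x = (SOME y. y \<in> carrier M \<and> y \<ominus>\<^bsub>M\<^esub> x \<in> S)" for x
  have rep: "\<pi> x \<in> carrier M \<and> \<pi> x \<ominus>\<^bsub>M\<^esub> x \<in> S" if "x \<in> carrier M" for x
    unfolding \<pi>_def by (rule someI[of _ x]) (use that S0 in \<open>simp add: M.minus_eq M.r_neg\<close>)
  have rc: "\<pi> x \<in> carrier M" if "x \<in> carrier M" for x using rep[OF that] ..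
  have eq: "\<pi> x = \<pi> y" if "x \<in> carrier M" "y \<in> carrier M" "x \<ominus>\<^bsub>M\<^esub> y \<in> S" for x y
  proof -
    have "u \<ominus>\<^bsub>M\<^esub> x \<in> S \<longleftrightarrow> u \<ominus>\<^bsub>M\<^esub> y \<in> S" if u: "u \<in> carrier M" for u
    proof
      assume "u \<ominus>\<^bsub>M\<^esub> x \<in> S"
      then have "(u \<ominus>\<^bsub>M\<^esub> x) \<oplus>\<^bsub>M\<^esub> (x \<ominus>\<^bsub>M\<^esub> y) \<in> S" using SE(5) that(1) \<open>x \<ominus>\<^bsub>M\<^esub> y \<in> S\<close> by blast
      moreover have "(u \<ominus>\<^bsub>M\<^esub> x) \<oplus>\<^bsub>M\<^esub> (x \<ominus>\<^bsub>M\<^esub> y) = u \<ominus>\<^bsub>M\<^esub> y"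
        using u \<open>x \<in> carrier M\<close> \<open>y \<in> carrier M\<close> by (simp add: M.minus_eq M.a_assoc M.r_neg1)
      ultimately show "u \<ominus>\<^bsub>M\<^esub> y \<in> S" by simp
    next
      assume "u \<ominus>\<^bsub>M\<^esub> y \<in> S"
      then have "(u \<ominus>\<^bsub>M\<^esub> y) \<oplus>\<^bsub>M\<^esub> \<ominus>\<^bsub>M\<^esub> (x \<ominus>\<^bsub>M\<^esub> y) \<in> S" using SE(3,5) \<open>x \<ominus>\<^bsub>M\<^esub> y \<in> S\<close> by blast
      moreover have "(u \<ominus>\<^bsub>M\<^esub> y) \<oplus>\<^bsub>M\<^esub> \<ominus>\<^bsub>M\<^esub> (x \<ominus>\<^bsub>M\<^esub> y) = u \<ominus>\<^bsub>M\<^esub> x"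
        using u \<open>x \<in> carrier M\<close> \<open>y \<in> carrier M\<close>
        by (simp add: M.minus_eq M.minus_add M.a_assoc M.a_lcomm[of "\<ominus>\<^bsub>M\<^esub> y" "\<ominus>\<^bsub>M\<^esub> x"] M.l_neg)
      ultimately show "u \<ominus>\<^bsub>M\<^esub> x \<in> S" by simp
    qed
    then show ?thesis by (auto simp: \<pi>_def intro!: arg_cong[of _ _ Eps])
  qed
  have \<pi>\<pi>: "\<pi> (\<pi> x \<oplus>\<^bsub>M\<^esub> y) = \<pi> (x \<oplus>\<^bsub>M\<^esub> y)" if "x \<in> carrier M" "y \<in> carrier M" for x y
  proof (rule eq)
    have "\<pi> x \<oplus>\<^bsub>M\<^esub> y \<ominus>\<^bsub>M\<^esub> (x \<oplus>\<^bsub>M\<^esub> y) = \<pi> x \<ominus>\<^bsub>M\<^esub> x"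
      using that rc by (simp add: M.minus_eq M.minus_add M.a_assoc M.a_lcomm[of y] M.r_neg)
    then show "\<pi> x \<oplus>\<^bsub>M\<^esub> y \<ominus>\<^bsub>M\<^esub> (x \<oplus>\<^bsub>M\<^esub> y) \<in> S" using rep that by simp
  qed (use that rc in auto)
  have \<pi>\<pi>': "\<pi> (x \<oplus>\<^bsub>M\<^esub> \<pi> y) = \<pi> (x \<oplus>\<^bsub>M\<^esub> y)" if "x \<in> carrier M" "y \<in> carrier M" for x y
    using \<pi>\<pi>[of y x] that rc by (simp add: M.a_comm)
  have \<pi>s: "\<pi> (r \<odot>\<^bsub>M\<^esub> \<pi> x) = \<pi> (r \<odot>\<^bsub>M\<^esub> x)" if "r \<in> carrier R" "x \<in> carrier M" for r x
  proof (rule eq)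
    have "r \<odot>\<^bsub>M\<^esub> \<pi> x \<ominus>\<^bsub>M\<^esub> r \<odot>\<^bsub>M\<^esub> x = r \<odot>\<^bsub>M\<^esub> (\<pi> x \<ominus>\<^bsub>M\<^esub> x)"
      using that rc by (simp add: M.minus_eq M.smult_r_distr M.smult_r_minus)
    then show "r \<odot>\<^bsub>M\<^esub> \<pi> x \<ominus>\<^bsub>M\<^esub> r \<odot>\<^bsub>M\<^esub> x \<in> S" using rep SE(4) that by simp
  qed (use that rc in auto)
  define Q :: "('r, 'm) module" where
    "Q = \<lparr>carrier = \<pi> ` carrier M, monoid.mult = undefined, monoid.one = undefined,
       ring.zero = \<pi> \<zero>\<^bsub>M\<^esub>, ring.add = (\<lambda>x y. \<pi> (x \<oplus>\<^bsub>M\<^esub> y)),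
       module.smult = (\<lambda>r x. \<pi> (r \<odot>\<^bsub>M\<^esub> x))\<rparr>"
  have sel: "carrier Q = \<pi> ` carrier M" "\<zero>\<^bsub>Q\<^esub> = \<pi> \<zero>\<^bsub>M\<^esub>"
    "x \<oplus>\<^bsub>Q\<^esub> y = \<pi> (x \<oplus>\<^bsub>M\<^esub> y)" "r \<odot>\<^bsub>Q\<^esub> x = \<pi> (r \<odot>\<^bsub>M\<^esub> x)" for x y r
    by (simp_all add: Q_def)
  have add: "\<pi> x \<oplus>\<^bsub>Q\<^esub> \<pi> y = \<pi> (x \<oplus>\<^bsub>M\<^esub> y)" if "x \<in> carrier M" "y \<in> carrier M" for x y
    using that rc by (simp add: sel \<pi>\<pi> \<pi>\<pi>')
  have smult: "r \<odot>\<^bsub>Q\<^esub> \<pi> x = \<pi> (r \<odot>\<^bsub>M\<^esub> x)" if "r \<in> carrier R" "x \<in> carrier M" for r x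
    using that by (simp add: sel \<pi>s)
  have "abelian_group Q"
  proof (rule abelian_groupI)
    fix x assume "x \<in> carrier Q"
    then obtain m where m: "m \<in> carrier M" "x = \<pi> m" by (auto simp: sel(1))
    then show "\<exists>y\<in>carrier Q. y \<oplus>\<^bsub>Q\<^esub> x = \<zero>\<^bsub>Q\<^esub>"
      by (intro bexI[of _ "\<pi> (\<ominus>\<^bsub>M\<^esub> m)"]) (simp_all add: sel(1,2) add M.l_neg)
  next
    fix x y assume "x \<in> carrier Q" "y \<in> carrier Q"
    then obtain a b where ab: "a \<in> carrier M" "b \<in> carrier M" "x = \<pi> a" "y = \<pi> b" by (auto simp: sel(1))
    then show "x \<oplus>\<^bsub>Q\<^esub> y = y \<oplus>\<^bsub>Q\<^esub> x" by (simp add: add M.a_comm[of a b])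
  qed (auto simp: sel(1,2) add M.a_assoc)
  then have Q: "module R Q"
    by (intro moduleI M.R.is_cring)
      (auto simp: sel(1) add smult M.smult_l_distr M.smult_r_distr M.smult_assoc1)
  have lin: "\<pi> \<in> linear_maps R M Q"
    by (rule linear_mapsI) (simp_all add: sel(1) add smult)
  have diff_zero: "x \<ominus>\<^bsub>M\<^esub> \<zero>\<^bsub>M\<^esub> = x" if "x \<in> carrier M" for x
    using that M.r_neg[OF M.zero_closed] by (simp add: M.minus_eq)
  have "\<pi> x = \<zero>\<^bsub>Q\<^esub> \<longleftrightarrow> x \<in> S" if x: "x \<in> carrier M" for x
  proof
    assume "\<pi> x = \<zero>\<^bsub>Q\<^esub>"
    then have S': "\<pi> x \<ominus>\<^bsub>M\<^esub> x \<in> S" "\<pi> x \<ominus>\<^bsub>M\<^esub> \<zero>\<^bsub>M\<^esub> \<in> S"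
      using rep[OF x] rep[of "\<zero>\<^bsub>M\<^esub>"] by (simp_all add: sel(2))
    then have "\<pi> x \<oplus>\<^bsub>M\<^esub> \<ominus>\<^bsub>M\<^esub> (\<pi> x \<ominus>\<^bsub>M\<^esub> x) \<in> S"
      using SE(5)[OF S'(2) SE(3)[OF S'(1)]] by (simp add: diff_zero[OF rc[OF x]])
    moreover have "\<pi> x \<oplus>\<^bsub>M\<^esub> \<ominus>\<^bsub>M\<^esub> (\<pi> x \<ominus>\<^bsub>M\<^esub> x) = x"
      using x rc[OF x] by (simp add: M.minus_eq M.minus_add M.r_neg2)
    ultimately show "x \<in> S" by simp
  next
    assume "x \<in> S"
    then have "x \<ominus>\<^bsub>M\<^esub> \<zero>\<^bsub>M\<^esub> \<in> S" by (simp add: diff_zero[OF x])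
    then show "\<pi> x = \<zero>\<^bsub>Q\<^esub>" unfolding sel(2) by (rule eq[OF x M.zero_closed])
  qed
  with Q lin show ?thesis using that sel by blast
qed

lemma submodule_image:
  assumes M: "module R M" and N: "module R N" and f: "f \<in> linear_maps R M N"
  shows "submodule (f ` carrier M) R N"
proof -
  interpret M: module R M by fact
  interpret N: module R N by fact
  show ?thesis
  proof (rule N.submoduleI)
    show "\<zero>\<^bsub>N\<^esub> \<in> f ` carrier M" using linear_zero[OF M N f] by (metis M.zero_closed image_eqI)
  next
    fix a assume "a \<in> f ` carrier M"
    then show "\<ominus>\<^bsub>N\<^esub> a \<in> f ` carrier M" by (auto simp flip: linear_neg[OF M N f])
  qed (auto simp: linear_closed[OF f] simp flip: linear_add[OF f] linear_smult[OF f])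
qed

lemma submod_module: "\<lbrakk>module R M; submodule S R M\<rbrakk> \<Longrightarrow> module R (submod M S)"
  unfolding submod_def by (rule submodule.submodule_is_module)

lemma submod_simps [simp]:
  "carrier (submod M S) = S" "x \<oplus>\<^bsub>submod M S\<^esub> y = x \<oplus>\<^bsub>M\<^esub> y" "\<zero>\<^bsub>submod M S\<^esub> = \<zero>\<^bsub>M\<^esub>"
  "r \<odot>\<^bsub>submod M S\<^esub> x = r \<odot>\<^bsub>M\<^esub> x" "submod (submod M S) S' = submod M S'"
  by (simp_all add: submod_def)

lemma submod_incl_linear: "submodule S R M \<Longrightarrow> (\<lambda>x. x) \<in> linear_maps R (submod M S) M"
  using subgroup.subset[OF submodule.axioms(1)] by (fastforce simp: linear_maps_def)

text \<open>Exactness of \<open>S \<otimes> K \<rightarrow> M \<otimes> K \<rightarrow> Q \<otimes> K\<close> in the middle. Let \<open>I\<close> be the cokernel of the first map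
  and \<open>p\<close> its projection. Since \<open>p (x \<otimes> k)\<close> depends only on \<open>\<pi> x\<close> and \<open>k\<close>, the map \<open>p\<close> factors
  through \<open>Q \<otimes> K\<close>, so it kills whatever \<open>\<pi> \<otimes> id\<close> kills.\<close>

lemma tensor_right_exact:
  fixes M :: "('r, 'm) module" and K :: "('r, 'k, 'x) module_scheme" and Q :: "('r, 'q, 'y) module_scheme"
  assumes M: "module R M" and K: "module R K" and S: "submodule S R M" and Q: "module R Q"
    and \<pi>: "\<pi> \<in> linear_maps R M Q" and onto: "\<pi> ` carrier M = carrier Q"
    and ker: "\<And>x. x \<in> carrier M \<Longrightarrow> \<pi> x = \<zero>\<^bsub>Q\<^esub> \<Longrightarrow> x \<in> S"
    and t: "t \<in> carrier (tensor R M K)" and t0: "tensor_map R Q K \<pi> (\<lambda>x. x) t = \<zero>\<^bsub>tensor R Q K\<^esub>"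
  obtains s where "s \<in> carrier (tensor R (submod M S) K)" "tensor_map R M K (\<lambda>x. x) (\<lambda>x. x) s = t"
proof -
  note S' = submod_module[OF M S] and TM = module_tensor[OF M K]
  let ?\<iota> = "tensor_map R M K (\<lambda>x. x) (\<lambda>x. x)"
  interpret M: module R M by fact
  interpret Q: module R Q by fact
  have \<iota>: "?\<iota> \<in> linear_maps R (tensor R (submod M S) K) (tensor R M K)"
    by (intro tensor_map_linear S' M K submod_incl_linear S linear_id)
  obtain I :: "('r, ('m, 'k) tensor) module" and p where I: "module R I"
      and p: "p \<in> linear_maps R (tensor R M K) I"
    and p_onto: "p ` carrier (tensor R M K) = carrier I" and p0: "\<And>x. x \<in> carrier (tensor R M K) \<Longrightarrow>
        p x = \<zero>\<^bsub>I\<^esub> \<longleftrightarrow> x \<in> ?\<iota> ` carrier (tensor R (submod M S) K)"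
    by (rule module_quotient[OF TM submodule_image[OF module_tensor[OF S' K] TM \<iota>]], rule that; assumption)
  interpret I: module R I by fact
  define \<sigma> where "\<sigma> q = (SOME x. x \<in> carrier M \<and> \<pi> x = q)" for q
  have \<sigma>: "\<sigma> q \<in> carrier M \<and> \<pi> (\<sigma> q) = q" if "q \<in> carrier Q" for q
    unfolding \<sigma>_def by (rule someI_ex) (use that in \<open>auto simp flip: onto\<close>)
  define b where "b q k = p (tens R M K (\<sigma> q) k)" for q k
  have b: "b (\<pi> x) k = p (tens R M K x k)" if x: "x \<in> carrier M" and k: "k \<in> carrier K" for x k
  proof -
    note l = linear_compose[OF p bilinear_left[OF bilinear_tens[OF M K] k]]
    have s: "\<sigma> (\<pi> x) \<in> carrier M" "\<pi> (\<sigma> (\<pi> x)) = \<pi> x" using \<sigma>[OF linear_closed[OF \<pi> x]] by auto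
    have "\<pi> (\<sigma> (\<pi> x) \<oplus>\<^bsub>M\<^esub> \<ominus>\<^bsub>M\<^esub> x) = \<zero>\<^bsub>Q\<^esub>"
      using s x by (simp add: linear_add[OF \<pi>] linear_neg[OF M Q \<pi>] linear_closed[OF \<pi>] Q.r_neg)
    then have d: "\<sigma> (\<pi> x) \<oplus>\<^bsub>M\<^esub> \<ominus>\<^bsub>M\<^esub> x \<in> S" using ker s x by auto
    have "tens R M K (\<sigma> (\<pi> x) \<oplus>\<^bsub>M\<^esub> \<ominus>\<^bsub>M\<^esub> x) k = ?\<iota> (tens R (submod M S) K (\<sigma> (\<pi> x) \<oplus>\<^bsub>M\<^esub> \<ominus>\<^bsub>M\<^esub> x) k)"
      using tensor_map_tens[OF S' K M K submod_incl_linear[OF S] linear_id, of _ k] d k by simp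
    moreover have "tens R (submod M S) K (\<sigma> (\<pi> x) \<oplus>\<^bsub>M\<^esub> \<ominus>\<^bsub>M\<^esub> x) k \<in> carrier (tensor R (submod M S) K)"
      using d k by (intro tens_closed) simp_all
    moreover have "tens R M K (\<sigma> (\<pi> x) \<oplus>\<^bsub>M\<^esub> \<ominus>\<^bsub>M\<^esub> x) k \<in> carrier (tensor R M K)"
      using s x k by (intro tens_closed) simp_all
    ultimately have "p (tens R M K (\<sigma> (\<pi> x) \<oplus>\<^bsub>M\<^esub> \<ominus>\<^bsub>M\<^esub> x) k) = \<zero>\<^bsub>I\<^esub>"
      using p0 by blast
    then have "p (tens R M K (\<sigma> (\<pi> x)) k) \<oplus>\<^bsub>I\<^esub> \<ominus>\<^bsub>I\<^esub> p (tens R M K x k) = \<zero>\<^bsub>I\<^esub>"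
      using linear_add[OF l s(1), of "\<ominus>\<^bsub>M\<^esub> x"] linear_neg[OF M I l x] x by simp
    then show ?thesis
      unfolding b_def using linear_closed[OF l s(1)] linear_closed[OF l x]
      by (metis I.a_inv_closed I.minus_equality I.minus_minus)
  qed
  have bil: "bilinear R Q K I b"
  proof (rule bilinearI)
    fix q assume "q \<in> carrier Q"
    then show "(\<lambda>k. b q k) \<in> linear_maps R K I"
      unfolding b_def using \<sigma> by (intro linear_compose[OF p bilinear_right[OF bilinear_tens[OF M K]]]) auto
  next
    fix k assume k: "k \<in> carrier K"
    note l = linear_compose[OF p bilinear_left[OF bilinear_tens[OF M K] k]]
    show "(\<lambda>q. b q k) \<in> linear_maps R Q I"
    proof (rule linear_mapsI)
      fix q assume "q \<in> carrier Q" then show "b q k \<in> carrier I"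
        unfolding b_def using \<sigma> linear_closed[OF l] by blast
    next
      fix q q' assume "q \<in> carrier Q" "q' \<in> carrier Q"
      then obtain x x' where x: "q = \<pi> x" "q' = \<pi> x'" "x \<in> carrier M" "x' \<in> carrier M"
        using onto by blast
      then have "b (q \<oplus>\<^bsub>Q\<^esub> q') k = b (\<pi> (x \<oplus>\<^bsub>M\<^esub> x')) k" by (simp add: linear_add[OF \<pi>])
      also have "\<dots> = b q k \<oplus>\<^bsub>I\<^esub> b q' k"
        using x k linear_add[OF l] by (simp add: b del: linear_add[OF \<pi>])
      finally show "b (q \<oplus>\<^bsub>Q\<^esub> q') k = b q k \<oplus>\<^bsub>I\<^esub> b q' k" .
    next
      fix r q assume r: "r \<in> carrier R" and "q \<in> carrier Q"
      then obtain x where x: "q = \<pi> x" "x \<in> carrier M" using onto by blast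
      then have "b (r \<odot>\<^bsub>Q\<^esub> q) k = b (\<pi> (r \<odot>\<^bsub>M\<^esub> x)) k" using r by (simp add: linear_smult[OF \<pi>])
      also have "\<dots> = r \<odot>\<^bsub>I\<^esub> b q k" using x k r linear_smult[OF l] by (simp add: b)
      finally show "b (r \<odot>\<^bsub>Q\<^esub> q) k = r \<odot>\<^bsub>I\<^esub> b q k" .
    qed
  qed
  have "p t = tensor_lift I b (tensor_map R Q K \<pi> (\<lambda>x. x) t)"
  proof (rule tensor_ext[OF M K I p _ _ t])
    show "(\<lambda>t. tensor_lift I b (tensor_map R Q K \<pi> (\<lambda>x. x) t)) \<in> linear_maps R (tensor R M K) I"
      by (intro linear_compose[OF tensor_lift_linear[OF Q K I bil]] tensor_map_linear M K Q \<pi> linear_id)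
    show "p (tens R M K x k) = tensor_lift I b (tensor_map R Q K \<pi> (\<lambda>x. x) (tens R M K x k))"
      if "x \<in> carrier M" "k \<in> carrier K" for x k
      using that by (simp add: tensor_map_tens[OF M K Q K \<pi> linear_id] tensor_lift_tens[OF Q K I bil]
          linear_closed[OF \<pi>] b)
  qed
  also have "\<dots> = \<zero>\<^bsub>I\<^esub>"
    unfolding t0 by (rule linear_zero[OF module_tensor[OF Q K] I tensor_lift_linear[OF Q K I bil]])
  finally show ?thesis using p0[OF t] that by blast
qed


section \<open>Evaluation of tensors and rational modules\<close>

text \<open>The value \<open>\<Sum> \<langle>h, k\<^sub>i\<rangle> n\<^sub>i\<close> at \<open>h\<close> of the map that \<open>\<alpha>\<close> assigns to \<open>\<Sum> n\<^sub>i \<otimes> k\<^sub>i\<close>. As a linear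
  map into \<open>N\<close>, without the normalisation of functions outside their domain, it combines better with
  the rules for sums.\<close>

definition tensor_eval :: "('h \<Rightarrow> 'k \<Rightarrow> 'r) \<Rightarrow> ('r, 'n, 'x) module_scheme \<Rightarrow> 'h \<Rightarrow> ('n, 'k) tensor \<Rightarrow> 'n" where
  "tensor_eval \<beta> N h = tensor_lift N (\<lambda>n k. \<beta> h k \<odot>\<^bsub>N\<^esub> n)"

lemma induced_action_eval: "induced_action \<beta> M \<rho> h m = tensor_eval \<beta> M h (\<rho> m)"
  by (simp add: induced_action_def tensor_eval_def)

context bialgebra_pairing
begin

lemma eval_bilinear:
  assumes "module R N" "h \<in> carrier H"
  shows "bilinear R N K N (\<lambda>n k. \<beta> h k \<odot>\<^bsub>N\<^esub> n)"
  using assms by (intro bilinearI linear_smult_right linear_smult_left linear_id pair_closed linear_right)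

lemma eval_linear:
  "\<lbrakk>module R N; h \<in> carrier H\<rbrakk> \<Longrightarrow> tensor_eval \<beta> N h \<in> linear_maps R (tensor R N K) N"
  unfolding tensor_eval_def by (intro tensor_lift_linear eval_bilinear module_K)

lemma eval_closed:
  "\<lbrakk>module R N; h \<in> carrier H; t \<in> carrier (tensor R N K)\<rbrakk> \<Longrightarrow> tensor_eval \<beta> N h t \<in> carrier N"
  using linear_closed[OF eval_linear] .

lemma eval_tens:
  "\<lbrakk>module R N; h \<in> carrier H; n \<in> carrier N; k \<in> carrier K\<rbrakk> \<Longrightarrow>
    tensor_eval \<beta> N h (tens R N K n k) = \<beta> h k \<odot>\<^bsub>N\<^esub> n"
  unfolding tensor_eval_def by (rule tensor_lift_tens[OF _ module_K _ eval_bilinear])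

lemma eval_linear_left:
  assumes "module R N" "t \<in> carrier (tensor R N K)"
  shows "(\<lambda>h. tensor_eval \<beta> N h t) \<in> linear_maps R H N"
  unfolding tensor_eval_def
  by (intro linear_lift[OF _ module_K _ module_H assms(2)] assms(1) eval_bilinear linear_smult_left linear_left)

lemma eval_natural:
  assumes "module R N" "module R N'" "f \<in> linear_maps R N N'" "h \<in> carrier H" "t \<in> carrier (tensor R N K)"
  shows "tensor_eval \<beta> N' h (tensor_map R N' K f (\<lambda>x. x) t) = f (tensor_eval \<beta> N h t)"
proof (rule tensor_ext[OF assms(1) module_K assms(2) _ _ _ assms(5)])
  show "(\<lambda>t. tensor_eval \<beta> N' h (tensor_map R N' K f (\<lambda>x. x) t)) \<in> linear_maps R (tensor R N K) N'"
    by (intro linear_compose[OF eval_linear[OF assms(2,4)]] tensor_map_linear assms module_K linear_id)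
  show "(\<lambda>t. f (tensor_eval \<beta> N h t)) \<in> linear_maps R (tensor R N K) N'"
    by (rule linear_compose[OF assms(3) eval_linear[OF assms(1,4)]])
  show "tensor_eval \<beta> N' h (tensor_map R N' K f (\<lambda>x. x) (tens R N K n k)) =
      f (tensor_eval \<beta> N h (tens R N K n k))"
    if "n \<in> carrier N" "k \<in> carrier K" for n k
    using that assms by (simp add: tensor_map_tens[OF assms(1) module_K assms(2) module_K assms(3) linear_id]
      eval_tens linear_closed[OF assms(3)] linear_smult[OF assms(3)] pair_closed)
qed

lemma alpha_bilinear:
  assumes N: "module R N"
  shows "bilinear R N K (hom_module R H N) (\<lambda>n k. \<lambda>h\<in>carrier H. \<beta> h k \<odot>\<^bsub>N\<^esub> n)"
proof -
  interpret N: module R N by fact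
  have c: "(\<lambda>h\<in>carrier H. \<beta> h k \<odot>\<^bsub>N\<^esub> n) \<in> carrier (hom_module R H N)" if "n \<in> carrier N" "k \<in> carrier K" for n k
  proof -
    have "(\<lambda>h\<in>carrier H. \<beta> h k \<odot>\<^bsub>N\<^esub> n) \<in> linear_maps R H N"
      using that by (intro linear_cong[OF module_H linear_smult_left[OF N that(1) linear_left[OF that(2)]]])
          auto
    then show ?thesis by (simp add: hom_module_def)
  qed
  note b = eval_bilinear[OF N]
  show ?thesis
    by (intro bilinearI linear_mapsI c; (assumption)?)
      (auto simp: hom_module_def fun_eq_iff linear_add[OF bilinear_left[OF b]]
          linear_add[OF bilinear_right[OF b]]
        linear_smult[OF bilinear_left[OF b]] linear_smult[OF bilinear_right[OF b]])
qed

lemma alpha_linear: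
  "module R N \<Longrightarrow> alpha_map R H \<beta> N \<in> linear_maps R (tensor R N K) (hom_module R H N)"
  unfolding alpha_map_def by (intro tensor_lift_linear alpha_bilinear module_K module_hom_module module_H)

lemma alpha_apply:
  assumes N: "module R N" and t: "t \<in> carrier (tensor R N K)"
  shows "alpha_map R H \<beta> N t = (\<lambda>h\<in>carrier H. tensor_eval \<beta> N h t)"
proof (rule extensionalityI[of _ "carrier H"])
  show "alpha_map R H \<beta> N t \<in> extensional (carrier H)"
    using linear_closed[OF alpha_linear[OF N] t] by (simp add: hom_module_def)
  fix h assume h: "h \<in> carrier H"
  have "alpha_map R H \<beta> N t h = tensor_lift N (\<lambda>n k. (\<lambda>h\<in>carrier H. \<beta> h k \<odot>\<^bsub>N\<^esub> n) h) t"
    unfolding alpha_map_def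
    by (rule tensor_lift_natural[OF N module_K module_hom_module[OF module_H N] N alpha_bilinear[OF N]
          hom_module_apply_linear[OF h] t])
  then show "alpha_map R H \<beta> N t h = (\<lambda>h\<in>carrier H. tensor_eval \<beta> N h t) h"
    using h by (simp add: tensor_eval_def)
qed simp

lemma cofree_bilinear:
  assumes N: "module R N"
  shows "bilinear R N K (tensor R (tensor R N K) K) (\<lambda>n z. tensor_lift (tensor R (tensor R N K) K)
    (\<lambda>z1 z2. tens R (tensor R N K) K (tens R N K n z1) z2) (comult K z))"
  and "n \<in> carrier N \<Longrightarrow> bilinear R K K (tensor R (tensor R N K) K)
    (\<lambda>z1 z2. tens R (tensor R N K) K (tens R N K n z1) z2)"
proof -
  note T = module_tensor[OF N module_K] and TT = module_tensor[OF module_tensor[OF N module_K] module_K]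
  have in1: "bilinear R K K (tensor R (tensor R N K) K) (\<lambda>z1 z2. tens R (tensor R N K) K (tens R N K n z1) z2)"
    if "n \<in> carrier N" for n
    by (intro bilinear_tens_compose T module_K bilinear_right[OF bilinear_tens[OF N module_K]] that linear_id)
  then show "n \<in> carrier N \<Longrightarrow> bilinear R K K (tensor R (tensor R N K) K)
    (\<lambda>z1 z2. tens R (tensor R N K) K (tens R N K n z1) z2)" .
  show "bilinear R N K (tensor R (tensor R N K) K) (\<lambda>n z. tensor_lift (tensor R (tensor R N K) K)
    (\<lambda>z1 z2. tens R (tensor R N K) K (tens R N K n z1) z2) (comult K z))"
    by (intro bilinearI linear_sweedler[OF coalgebra_K] linear_sweedler_arg[OF coalgebra_K] TT in1 N linear_id
        linear_compose[OF bilinear_left[OF bilinear_tens[OF T module_K]]]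
            bilinear_left[OF bilinear_tens[OF N module_K]])
      (auto intro: bilinear_left[OF in1] bilinear_right[OF in1])
qed

lemma cofree_coaction_linear:
  "module R N \<Longrightarrow> cofree_coaction R N K \<in> linear_maps R (tensor R N K) (tensor R (tensor R N K) K)"
  unfolding cofree_coaction_def Let_def
  by (intro tensor_lift_linear cofree_bilinear module_tensor module_K)

lemma cofree_action_linear:
  "\<lbrakk>module R N; h \<in> carrier H\<rbrakk> \<Longrightarrow> cofree_action R K \<beta> N h \<in> linear_maps R (tensor R N K) (tensor R N K)"
  unfolding cofree_action_def induced_action_eval[abs_def]
  by (rule linear_compose[OF eval_linear cofree_coaction_linear]) (auto intro: module_tensor module_K)

text \<open>The coproduct introduced by the cofree coaction is absorbed by
  \<open>\<langle>h' h, z\<rangle> = \<Sum> \<langle>h', z\<^sub>1\<rangle> \<langle>h, z\<^sub>2\<rangle>\<close>.\<close>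

lemma eval_cofree:
  assumes N: "module R N" and h: "h \<in> carrier H" and h': "h' \<in> carrier H" and t: "t \<in> carrier (tensor R N K)"
  shows "tensor_eval \<beta> N h' (cofree_action R K \<beta> N h t) = tensor_eval \<beta> N (h' \<otimes>\<^bsub>H\<^esub> h) t"
proof (rule tensor_ext[OF N module_K N _ _ _ t])
  note T = module_tensor[OF N module_K] and TT = module_tensor[OF module_tensor[OF N module_K] module_K]
  interpret H: ring H by (rule assoc_algebra.ring[OF algebra_H])
  interpret N: module R N by (rule N)
  show "(\<lambda>t. tensor_eval \<beta> N h' (cofree_action R K \<beta> N h t)) \<in> linear_maps R (tensor R N K) N"
    by (rule linear_compose[OF eval_linear cofree_action_linear]) fact+
  show "tensor_eval \<beta> N (h' \<otimes>\<^bsub>H\<^esub> h) \<in> linear_maps R (tensor R N K) N"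
    using N h h' by (intro eval_linear) auto
  fix n z assume n: "n \<in> carrier N" and z: "z \<in> carrier K"
  let ?\<phi> = "\<lambda>s. tensor_eval \<beta> N h' (tensor_eval \<beta> (tensor R N K) h s)"
  have \<phi>: "?\<phi> \<in> linear_maps R (tensor R (tensor R N K) K) N"
    by (rule linear_compose[OF eval_linear[OF N h'] eval_linear[OF T h]])
  have \<psi>: "(\<lambda>r. r \<odot>\<^bsub>N\<^esub> n) \<in> linear_maps R (regular_module R) N"
    by (rule linear_smult_left[OF N n linear_id])
  have bil: "bilinear R K K (regular_module R) (\<lambda>z1 z2. \<beta> h' z1 \<otimes>\<^bsub>R\<^esub> \<beta> h z2)"
    by (intro pair_lin h h')
  have "tensor_eval \<beta> N h' (cofree_action R K \<beta> N h (tens R N K n z)) =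
    ?\<phi> (tensor_lift (tensor R (tensor R N K) K) (\<lambda>z1 z2. tens R (tensor R N K) K (tens R N K n z1) z2)
        (comult K z))"
    using n z by (simp add: cofree_action_def induced_action_eval cofree_coaction_def Let_def
        tensor_lift_tens[OF N module_K TT cofree_bilinear(1)[OF N]])
  also have "\<dots> = tensor_lift N (\<lambda>z1 z2. ?\<phi> (tens R (tensor R N K) K (tens R N K n z1) z2)) (comult K z)"
    by (rule sweedler_natural[OF coalgebra_K TT N \<phi> cofree_bilinear(2)[OF N n] z])
  also have "\<dots> = tensor_lift N (\<lambda>z1 z2. (\<beta> h' z1 \<otimes>\<^bsub>R\<^esub> \<beta> h z2) \<odot>\<^bsub>N\<^esub> n) (comult K z)"
    by (rule sweedler_cong[OF coalgebra_K N bilinear_compose[OF \<phi> cofree_bilinear(2)[OF N n]] z])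
      (use n h h' in \<open>simp add: eval_tens[OF T] eval_tens[OF N]
          tens_closed linear_smult[OF eval_linear[OF N h']] pair_closed
        N.R.m_comm flip: N.smult_assoc1\<close>)
  also have "\<dots> = tensor_lift (regular_module R) (\<lambda>z1 z2. \<beta> h' z1 \<otimes>\<^bsub>R\<^esub> \<beta> h z2) (comult K z) \<odot>\<^bsub>N\<^esub> n"
    by (rule sym, rule sweedler_natural[OF coalgebra_K module_regular[OF R_cring] N \<psi> bil z])
  also have "\<dots> = tensor_eval \<beta> N (h' \<otimes>\<^bsub>H\<^esub> h) (tens R N K n z)"
    using n z h h' by (simp add: eval_tens[OF N] pair_mult_left)
  finally show "tensor_eval \<beta> N h' (cofree_action R K \<beta> N h (tens R N K n z)) =
      tensor_eval \<beta> N (h' \<otimes>\<^bsub>H\<^esub> h) (tens R N K n z)" .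
qed

end

context hopf_alpha_pairing
begin

lemma eval_inj:
  assumes N: "module R N" and "s \<in> carrier (tensor R N K)" "t \<in> carrier (tensor R N K)"
    and "\<And>h. h \<in> carrier H \<Longrightarrow> tensor_eval \<beta> N h s = tensor_eval \<beta> N h t"
  shows "s = t"
proof -
  have "alpha_map R H \<beta> N s = alpha_map R H \<beta> N t"
    using assms by (auto simp: alpha_apply fun_eq_iff)
  then show ?thesis using alpha_inj_all[OF N] assms(2,3) by (auto dest: inj_onD)
qed

text \<open>The image of \<open>t\<close> in \<open>(M/S) \<otimes> K\<close> evaluates to zero everywhere, so it vanishes by the
  \<open>\<alpha>\<close>-condition for \<open>M/S\<close>; right exactness then lifts \<open>t\<close> to \<open>S \<otimes> K\<close>.\<close>

lemma eval_in_submodule: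
  fixes M :: "('r, 'm) module"
  assumes M: "module R M" and S: "submodule S R M" and t: "t \<in> carrier (tensor R M K)"
    and ev: "\<And>h. h \<in> carrier H \<Longrightarrow> tensor_eval \<beta> M h t \<in> S"
  obtains s where "s \<in> carrier (tensor R (submod M S) K)"
    "\<And>h. h \<in> carrier H \<Longrightarrow> tensor_eval \<beta> (submod M S) h s = tensor_eval \<beta> M h t"
proof -
  obtain Q :: "('r, 'm) module" and \<pi> where Q: "module R Q" and \<pi>: "\<pi> \<in> linear_maps R M Q"
    and onto: "\<pi> ` carrier M = carrier Q"
    and ker: "\<And>x. x \<in> carrier M \<Longrightarrow> \<pi> x = \<zero>\<^bsub>Q\<^esub> \<longleftrightarrow> x \<in> S"
    by (rule module_quotient[OF M S], rule that; assumption)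
  interpret T: module R "tensor R Q K" by (rule module_tensor[OF Q module_K])
  have c: "tensor_map R Q K \<pi> (\<lambda>x. x) t \<in> carrier (tensor R Q K)"
    by (rule linear_closed[OF tensor_map_linear[OF M module_K Q module_K \<pi> linear_id] t])
  have "tensor_map R Q K \<pi> (\<lambda>x. x) t = \<zero>\<^bsub>tensor R Q K\<^esub>"
  proof (rule eval_inj[OF Q c T.zero_closed])
    fix h assume h: "h \<in> carrier H"
    show "tensor_eval \<beta> Q h (tensor_map R Q K \<pi> (\<lambda>x. x) t) = tensor_eval \<beta> Q h \<zero>\<^bsub>tensor R Q K\<^esub>"
      using ker[OF eval_closed[OF M h t]] ev[OF h]
      by (simp add: eval_natural[OF M Q \<pi> h t] linear_zero[OF T.module_axioms Q eval_linear[OF Q h]])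
  qed
  with ker obtain s where s: "s \<in> carrier (tensor R (submod M S) K)" "tensor_map R M K (\<lambda>x. x) (\<lambda>x. x) s = t"
    using tensor_right_exact[OF M module_K S Q \<pi> onto _ t] by blast
  then show ?thesis
    using that eval_natural[OF submod_module[OF M S] M submod_incl_linear[OF S] _ s(1)] by metis
qed

lemma rational_part_iff:
  assumes M: "module R M"
  shows "m \<in> rational_part R H K \<beta> M act \<longleftrightarrow> m \<in> carrier M \<and>
    (\<exists>t\<in>carrier (tensor R M K). \<forall>h\<in>carrier H. act h m = tensor_eval \<beta> M h t)"
  unfolding rational_part_def by (auto simp: alpha_apply[OF M] image_iff fun_eq_iff)

text \<open>Only the inclusion from right to left has content: the tensor that witnesses rationality in
  \<open>M\<close> has all its evaluations in the stable submodule \<open>S\<close>, so it comes from \<open>S \<otimes> K\<close>.\<close>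

lemma rational_part_submod:
  assumes M: "module R M" and S: "submodule S R M"
    and stable: "\<And>h m. h \<in> carrier H \<Longrightarrow> m \<in> S \<Longrightarrow> act h m \<in> S"
  shows "rational_part R H K \<beta> (submod M S) act = S \<inter> rational_part R H K \<beta> M act"
proof (intro equalityI subsetI)
  note S' = submod_module[OF M S]
  have sub: "S \<subseteq> carrier M" using subgroup.subset[OF submodule.axioms(1)[OF S]] by simp
  {
    fix m assume "m \<in> rational_part R H K \<beta> (submod M S) act"
    then obtain t where "m \<in> S" and t: "t \<in> carrier (tensor R (submod M S) K)"
      and e: "\<And>h. h \<in> carrier H \<Longrightarrow> act h m = tensor_eval \<beta> (submod M S) h t"
      unfolding rational_part_iff[OF S'] by auto
    moreover have "tensor_map R M K (\<lambda>x. x) (\<lambda>x. x) t \<in> carrier (tensor R M K)"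
      by (rule linear_closed[OF tensor_map_linear[OF S' module_K M module_K submod_incl_linear[OF S]
          linear_id] t])
    moreover have "act h m = tensor_eval \<beta> M h (tensor_map R M K (\<lambda>x. x) (\<lambda>x. x) t)" if "h \<in> carrier H" for h
      using eval_natural[OF S' M submod_incl_linear[OF S] that t] e[OF that] by simp
    ultimately show "m \<in> S \<inter> rational_part R H K \<beta> M act"
      unfolding Int_iff rational_part_iff[OF M] using sub by blast
  next
    fix m assume "m \<in> S \<inter> rational_part R H K \<beta> M act"
    then obtain t where "m \<in> S" and t: "t \<in> carrier (tensor R M K)"
      and e: "\<And>h. h \<in> carrier H \<Longrightarrow> act h m = tensor_eval \<beta> M h t"
      unfolding Int_iff rational_part_iff[OF M] by auto
    moreover from this stable obtain s where "s \<in> carrier (tensor R (submod M S) K)"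
      "\<And>h. h \<in> carrier H \<Longrightarrow> tensor_eval \<beta> (submod M S) h s = tensor_eval \<beta> M h t"
      using eval_in_submodule[OF M S t] by metis
    ultimately show "m \<in> rational_part R H K \<beta> (submod M S) act"
      unfolding rational_part_iff[OF S'] submod_simps(1) by (metis (no_types))
  }
qed

lemma translation_action_alpha:
  assumes N: "module R N" and t: "t \<in> carrier (tensor R N K)" and h: "h \<in> carrier H"
  shows "translation_action H h (alpha_map R H \<beta> N t) = alpha_map R H \<beta> N (cofree_action R K \<beta> N h t)"
proof -
  interpret H: ring H by (rule assoc_algebra.ring[OF algebra_H])
  show ?thesis
    using h t by (auto simp: translation_action_def alpha_apply[OF N]
        linear_closed[OF cofree_action_linear[OF N]]
        eval_cofree[OF N] fun_eq_iff)
qed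

text \<open>If \<open>f(h' h) = \<Sum> f\<^sub>i(h') \<langle>h, k\<^sub>i\<rangle>\<close>, then \<open>h' = 1\<close> gives \<open>f = \<alpha>(\<Sum> f\<^sub>i(1) \<otimes> k\<^sub>i)\<close>. Conversely the
  cofree coaction of \<open>t\<close> provides the expansion of \<open>\<alpha>(t)\<close>.\<close>

lemma rational_part_hom:
  fixes N :: "('r, 'n) module"
  assumes N: "module R N"
  shows "rational_part R H K \<beta> (hom_module R H N) (translation_action H) =
    alpha_map R H \<beta> N ` carrier (tensor R N K)"
proof (intro equalityI subsetI)
  note HN = module_hom_module[OF module_H N]
  interpret H: ring H by (rule assoc_algebra.ring[OF algebra_H])
  {
    fix f assume "f \<in> rational_part R H K \<beta> (hom_module R H N) (translation_action H)"
    then obtain s where f: "f \<in> carrier (hom_module R H N)" and s: "s \<in> carrier (tensor R (hom_module R H N) K)"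
      and e: "\<And>h. h \<in> carrier H \<Longrightarrow> translation_action H h f = tensor_eval \<beta> (hom_module R H N) h s"
      unfolding rational_part_iff[OF HN] by auto
    let ?t = "tensor_map R N K (\<lambda>f. f \<one>\<^bsub>H\<^esub>) (\<lambda>x. x) s"
    note l = hom_module_apply_linear[of "\<one>\<^bsub>H\<^esub>" H R N, OF H.one_closed]
    have t: "?t \<in> carrier (tensor R N K)"
      by (rule linear_closed[OF tensor_map_linear[OF HN module_K N module_K l linear_id] s])
    have "tensor_eval \<beta> N h ?t = f h" if h: "h \<in> carrier H" for h
      using eval_natural[OF HN N l h s] h by (simp flip: e add: translation_action_def)
    then have "f = alpha_map R H \<beta> N ?t"
      using f by (auto simp: alpha_apply[OF N t] hom_module_def extensional_def fun_eq_iff)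
    then show "f \<in> alpha_map R H \<beta> N ` carrier (tensor R N K)" using t by blast
  next
    fix f assume "f \<in> alpha_map R H \<beta> N ` carrier (tensor R N K)"
    then obtain t where t: "t \<in> carrier (tensor R N K)" and f: "f = alpha_map R H \<beta> N t" by auto
    note T = module_tensor[OF N module_K]
    note a = alpha_linear[OF N] and c = linear_closed[OF cofree_coaction_linear[OF N] t]
    let ?s = "tensor_map R (hom_module R H N) K (alpha_map R H \<beta> N) (\<lambda>x. x) (cofree_coaction R N K t)"
    have "?s \<in> carrier (tensor R (hom_module R H N) K)"
      by (rule linear_closed[OF tensor_map_linear[OF T module_K HN module_K a linear_id] c])
    moreover have "translation_action H h f = tensor_eval \<beta> (hom_module R H N) h ?s" if h: "h \<in> carrier H" for h
      unfolding f translation_action_alpha[OF N t h] eval_natural[OF T HN a h c]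
      by (simp add: cofree_action_def induced_action_eval)
    ultimately show "f \<in> rational_part R H K \<beta> (hom_module R H N) (translation_action H)"
      unfolding rational_part_iff[OF HN] using f linear_closed[OF a t] by blast
  }
qed

end


section \<open>The actions on a rational module\<close>

locale coinduction_object = coinduction R H K \<beta> Y Z \<gamma> \<xi> \<theta>
  for R :: "('r, 'z) ring_scheme"
    and H :: "('r, 'h) hopf" and K :: "('r, 'k) hopf" and \<beta> :: "'h \<Rightarrow> 'k \<Rightarrow> 'r"
    and Y :: "('r, 'y) hopf" and Z :: "('r, 'c) hopf" and \<gamma> :: "'y \<Rightarrow> 'c \<Rightarrow> 'r"
    and \<xi> :: "'h \<Rightarrow> 'y" and \<theta> :: "'c \<Rightarrow> 'k" +
  fixes N :: "('r, 'n) module" and act :: "'h \<Rightarrow> 'n \<Rightarrow> 'n"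
  assumes rational: "(N, act) \<in> rational_objects R H K \<beta>"
begin

sublocale H: ring H by (rule assoc_algebra.ring[OF P.algebra_H])
sublocale Y: ring Y by (rule assoc_algebra.ring[OF Q.algebra_H])
sublocale K: ring K by (rule assoc_algebra.ring[OF P.algebra_K])

lemma left_module_N: "left_module R H N act"
  using rational by (simp add: rational_objects_def)

lemma module_N: "module R N"
  using left_module.module[OF left_module_N] .

sublocale N: module R N by (rule module_N)

lemmas act_linear = left_module.act_linear[OF left_module_N]
lemmas act_linear_left = left_module.act_linear_left[OF left_module_N]
lemmas act_mult = left_module.act_mult[OF left_module_N]
lemmas act_one = left_module.act_one[OF left_module_N]

lemma act_closed: "\<lbrakk>h \<in> carrier H; n \<in> carrier N\<rbrakk> \<Longrightarrow> act h n \<in> carrier N"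
  using linear_closed[OF act_linear] .

abbreviation T where "T \<equiv> tensor R N Z"
abbreviation ev where "ev \<equiv> tensor_eval \<gamma> N"
abbreviation coact where "coact \<equiv> rational_coaction R H K \<beta> N act"

lemma module_T: "module R T"
  by (rule module_tensor[OF module_N Q.module_K])

sublocale T: module R T by (rule module_T)

lemma coact_closed: "n \<in> carrier N \<Longrightarrow> coact n \<in> carrier (tensor R N K)"
  and eval_coact: "\<lbrakk>n \<in> carrier N; h \<in> carrier H\<rbrakk> \<Longrightarrow> tensor_eval \<beta> N h (coact n) = act h n"
proof -
  have img: "(\<lambda>h\<in>carrier H. act h n) \<in> alpha_map R H \<beta> N ` carrier (tensor R N K)" if "n \<in> carrier N" for n
    using rational that by (auto simp: rational_objects_def rational_part_def)
  note inj = P.alpha_inj_all[OF module_N]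
  show cl: "coact n \<in> carrier (tensor R N K)" if "n \<in> carrier N" for n
    unfolding rational_coaction_def by (rule the_inv_into_into[OF inj img[OF that] subset_refl])
  show "tensor_eval \<beta> N h (coact n) = act h n" if n: "n \<in> carrier N" and h: "h \<in> carrier H"
  proof -
    have "alpha_map R H \<beta> N (coact n) = (\<lambda>h\<in>carrier H. act h n)"
      unfolding rational_coaction_def by (rule f_the_inv_into_f[OF inj img[OF n]])
    then show ?thesis using h by (metis P.alpha_apply[OF module_N cl[OF n]] restrict_apply')
  qed
qed

lemma coact_linear: "coact \<in> linear_maps R N (tensor R N K)"
proof -
  note module_NK = module_tensor[OF module_N P.module_K]
  interpret NK: module R "tensor R N K" by (rule module_NK)
  show ?thesis
  proof (rule linear_mapsI[OF coact_closed])
    fix x y assume xy: "x \<in> carrier N" "y \<in> carrier N"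
    show "coact (x \<oplus>\<^bsub>N\<^esub> y) = coact x \<oplus>\<^bsub>tensor R N K\<^esub> coact y"
      by (rule P.eval_inj[OF module_N])
        (use xy in \<open>simp_all add: coact_closed eval_coact linear_add[OF P.eval_linear[OF module_N]]
            linear_add[OF act_linear]\<close>)
  next
    fix r x assume rx: "r \<in> carrier R" "x \<in> carrier N"
    show "coact (r \<odot>\<^bsub>N\<^esub> x) = r \<odot>\<^bsub>tensor R N K\<^esub> coact x"
      by (rule P.eval_inj[OF module_N])
        (use rx in \<open>simp_all add: coact_closed eval_coact linear_smult[OF P.eval_linear[OF module_N]]
            linear_smult[OF act_linear]\<close>)
  qed
qed

lemma ev_closed: "\<lbrakk>y \<in> carrier Y; t \<in> carrier T\<rbrakk> \<Longrightarrow> ev y t \<in> carrier N"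
  by (rule Q.eval_closed[OF module_N])

lemma ev_linear: "y \<in> carrier Y \<Longrightarrow> ev y \<in> linear_maps R T N"
  by (rule Q.eval_linear[OF module_N])

lemma ev_inj: "\<lbrakk>s \<in> carrier T; t \<in> carrier T; \<And>y. y \<in> carrier Y \<Longrightarrow> ev y s = ev y t\<rbrakk> \<Longrightarrow> s = t"
  by (rule Q.eval_inj[OF module_N])

text \<open>The submodule \<open>E(N)\<close> of tensors whose associated map \<open>Y \<rightarrow> N\<close> is \<open>H\<close>-linear along \<open>\<xi>\<close>.\<close>

definition equivariant_tensors where
  "equivariant_tensors = {t \<in> carrier T. \<forall>h\<in>carrier H. \<forall>y\<in>carrier Y. act h (ev y t) = ev (\<xi> h \<otimes>\<^bsub>Y\<^esub> y) t}"


section \<open>The twisted coaction\<close>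

text \<open>The twisted action \<open>(h f)(y) = \<Sum> h\<^sub>1 f(S(\<xi> h\<^sub>2) y)\<close> on functions that need not be normalised
  outside \<open>carrier Y\<close>.\<close>

definition twisted_act where
  "twisted_act h f y = tensor_lift N (\<lambda>h1 h2. act h1 (f (antipode Y (\<xi> h2) \<otimes>\<^bsub>Y\<^esub> y))) (comult H h)"

lemma linear_act: "\<lbrakk>h \<in> carrier H; f \<in> linear_maps R M N\<rbrakk> \<Longrightarrow> (\<lambda>x. act h (f x)) \<in> linear_maps R M N"
  by (rule linear_compose[OF act_linear])

lemma linear_act_left: "\<lbrakk>n \<in> carrier N; f \<in> linear_maps R M H\<rbrakk> \<Longrightarrow> (\<lambda>x. act (f x) n) \<in> linear_maps R M N"
  by (rule linear_compose[OF act_linear_left])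

lemma linear_Y_mult_left: "\<lbrakk>y \<in> carrier Y; f \<in> linear_maps R M Y\<rbrakk> \<Longrightarrow> (\<lambda>x. f x \<otimes>\<^bsub>Y\<^esub> y) \<in> linear_maps R M Y"
  by (rule linear_compose[OF bilinear_left[OF assoc_algebra.bilinear_mult[OF Q.algebra_H]]])

lemma linear_Y_mult_right: "\<lbrakk>y \<in> carrier Y; f \<in> linear_maps R M Y\<rbrakk> \<Longrightarrow> (\<lambda>x. y \<otimes>\<^bsub>Y\<^esub> f x) \<in> linear_maps R M Y"
  by (rule linear_compose[OF bilinear_right[OF assoc_algebra.bilinear_mult[OF Q.algebra_H]]])

lemma linear_K_mult_left: "\<lbrakk>k \<in> carrier K; f \<in> linear_maps R M K\<rbrakk> \<Longrightarrow> (\<lambda>x. f x \<otimes>\<^bsub>K\<^esub> k) \<in> linear_maps R M K"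
  by (rule linear_compose[OF bilinear_left[OF assoc_algebra.bilinear_mult[OF P.algebra_K]]])

lemma linear_K_mult_right: "\<lbrakk>k \<in> carrier K; f \<in> linear_maps R M K\<rbrakk> \<Longrightarrow> (\<lambda>x. k \<otimes>\<^bsub>K\<^esub> f x) \<in> linear_maps R M K"
  by (rule linear_compose[OF bilinear_right[OF assoc_algebra.bilinear_mult[OF P.algebra_K]]])

lemmas module_scalars = module_regular[OF P.R_cring]

lemmas closed_intros = act_closed P.pair_closed Q.pair_closed H.m_closed Y.m_closed K.m_closed N.R.m_closed
  N.smult_closed xi(2) theta(2) antipode_Y(2) antipode_K(2) H.one_closed Y.one_closed K.one_closed

lemmas linear_intros = bilinearI linear_id linear_act linear_act_left linear_Y_mult_left linear_Y_mult_right
  linear_K_mult_left linear_K_mult_right linear_mult_left[OF P.R_cring] linear_mult_right[OF P.R_cring]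
  linear_smult_left[OF module_N] linear_smult_right[OF module_N] P.linear_pair_left P.linear_pair_right
  Q.linear_pair_left Q.linear_pair_right xi(1) theta(1) linear_compose[OF antipode_Y(1)]
      linear_compose[OF antipode_K(1)]
  linear_sweedler[OF P.coalgebra_H] linear_sweedler[OF Q.coalgebra_H] linear_sweedler[OF Q.coalgebra_K]
  linear_sweedler_arg[OF P.coalgebra_H] linear_sweedler_arg[OF Q.coalgebra_K]
  module_N module_scalars P.module_H P.module_K Q.module_H Q.module_K

lemma twisted_act_bilinear:
  assumes "f \<in> linear_maps R Y N" "y \<in> carrier Y"
  shows "bilinear R H H N (\<lambda>h1 h2. act h1 (f (antipode Y (\<xi> h2) \<otimes>\<^bsub>Y\<^esub> y)))"
  by (intro linear_intros linear_compose[OF assms(1)] linear_closed[OF assms(1)] closed_intros assms)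

text \<open>If \<open>f\<close> is invariant, then
  \<open>f(\<xi>(h) y) = \<Sum> \<epsilon>(h\<^sub>1) f(\<xi>(h\<^sub>2) y) = \<Sum> h\<^sub>1 f(S(\<xi> h\<^sub>2) \<xi>(h\<^sub>3) y) = h f(y)\<close>. If \<open>f\<close> is \<open>H\<close>-linear,
  then \<open>\<Sum> h\<^sub>1 f(S(\<xi> h\<^sub>2) y) = f(\<Sum> \<xi>(h\<^sub>1) S(\<xi> h\<^sub>2) y) = \<epsilon>(h) f(y)\<close>.\<close>

lemma twisted_act_invariant_iff:
  assumes f: "f \<in> linear_maps R Y N"
  shows "(\<forall>h\<in>carrier H. \<forall>y\<in>carrier Y. twisted_act h f y = counit H h \<odot>\<^bsub>N\<^esub> f y) \<longleftrightarrow>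
    (\<forall>h\<in>carrier H. \<forall>y\<in>carrier Y. f (\<xi> h \<otimes>\<^bsub>Y\<^esub> y) = act h (f y))"
proof (intro iffI ballI)
  note fc = linear_closed[OF f]
  note bil = twisted_act_bilinear[OF f]
  note H = P.coalgebra_H
  {
    fix h y
    assume inv: "\<forall>h\<in>carrier H. \<forall>y\<in>carrier Y. twisted_act h f y = counit H h \<odot>\<^bsub>N\<^esub> f y"
      and h: "h \<in> carrier H" and y: "y \<in> carrier Y"
    have inner: "tensor_lift N (\<lambda>u v. act x (f (antipode Y (\<xi> u) \<otimes>\<^bsub>Y\<^esub> (\<xi> v \<otimes>\<^bsub>Y\<^esub> y)))) (comult H x') =
        counit H x' \<odot>\<^bsub>N\<^esub> act x (f y)" if x: "x \<in> carrier H" "x' \<in> carrier H" for x x'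
    proof -
      let ?b = "\<lambda>u v. antipode Y (\<xi> u) \<otimes>\<^bsub>Y\<^esub> \<xi> v"
      have \<phi>: "(\<lambda>w. act x (f (w \<otimes>\<^bsub>Y\<^esub> y))) \<in> linear_maps R Y N"
        by (intro linear_intros linear_compose[OF f] x y)
      have b: "bilinear R H H Y ?b" by (intro linear_intros closed_intros)
      have "tensor_lift N (\<lambda>u v. act x (f (?b u v \<otimes>\<^bsub>Y\<^esub> y))) (comult H x') =
          act x (f (tensor_lift Y ?b (comult H x') \<otimes>\<^bsub>Y\<^esub> y))"
        by (rule sym, rule sweedler_natural[OF H Q.module_H module_N \<phi> b x(2)])
      also have "\<dots> = counit H x' \<odot>\<^bsub>N\<^esub> act x (f y)"
        using linear_smult[OF \<phi> coalgebra.counit_closed[OF H x(2)] Y.one_closed] y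
        by (simp add: hopf_algebra.antipode_convolution[OF Q.hopf_H H xi_hom x(2)])
      finally show ?thesis
        using sweedler_cong[OF H module_N bilinear_compose[OF \<phi> b] x(2),
            of "\<lambda>u v. act x (f (antipode Y (\<xi> u) \<otimes>\<^bsub>Y\<^esub> (\<xi> v \<otimes>\<^bsub>Y\<^esub> y)))"] y
        by (simp add: Y.m_assoc closed_intros)
    qed
    have fy: "(\<lambda>x. f (\<xi> x \<otimes>\<^bsub>Y\<^esub> y)) \<in> linear_maps R H N"
      by (intro linear_compose[OF f] linear_intros y)
    have "f (\<xi> h \<otimes>\<^bsub>Y\<^esub> y) = tensor_lift N (\<lambda>a b. counit H a \<odot>\<^bsub>N\<^esub> f (\<xi> b \<otimes>\<^bsub>Y\<^esub> y)) (comult H h)"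
      by (rule sym, rule coalgebra.counit_lift_left[OF H module_N h fy])
    also have "\<dots> = tensor_lift N (\<lambda>a b. tensor_lift N (\<lambda>u v. act u (f (antipode Y (\<xi> v) \<otimes>\<^bsub>Y\<^esub> (\<xi> b \<otimes>\<^bsub>Y\<^esub> y))))
        (comult H a)) (comult H h)"
      by (rule sweedler_cong[OF H module_N _ h])
        (use inv y in \<open>simp_all add: twisted_act_def closed_intros, intro linear_intros linear_compose[OF f] fc
            coalgebra.counit_linear[OF H] coalgebra.counit_closed[OF H] closed_intros\<close>)
    also have "\<dots> = tensor_lift N (\<lambda>a b. tensor_lift N (\<lambda>u v. act a (f (antipode Y (\<xi> u) \<otimes>\<^bsub>Y\<^esub> (\<xi> v \<otimes>\<^bsub>Y\<^esub> y))))
        (comult H b)) (comult H h)"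
      by (intro coalgebra.coassoc_lift[OF H module_N h] linear_intros linear_compose[OF f] fc closed_intros y)
    also have "\<dots> = tensor_lift N (\<lambda>a b. counit H b \<odot>\<^bsub>N\<^esub> act a (f y)) (comult H h)"
      by (intro sweedler_cong[OF H module_N] inner linear_intros linear_compose[OF f] fc closed_intros y h)
    also have "\<dots> = act h (f y)"
      by (intro coalgebra.counit_lift_right[OF H module_N h] linear_intros fc y)
    finally show "f (\<xi> h \<otimes>\<^bsub>Y\<^esub> y) = act h (f y)" .
  next
    fix h y
    assume lin: "\<forall>h\<in>carrier H. \<forall>y\<in>carrier Y. f (\<xi> h \<otimes>\<^bsub>Y\<^esub> y) = act h (f y)"
      and h: "h \<in> carrier H" and y: "y \<in> carrier Y"
    let ?b = "\<lambda>u v. \<xi> u \<otimes>\<^bsub>Y\<^esub> antipode Y (\<xi> v)"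
    have \<phi>: "(\<lambda>w. f (w \<otimes>\<^bsub>Y\<^esub> y)) \<in> linear_maps R Y N"
      by (intro linear_intros linear_compose[OF f] y)
    have b: "bilinear R H H Y ?b" by (intro linear_intros closed_intros)
    have "twisted_act h f y = tensor_lift N (\<lambda>u v. f (?b u v \<otimes>\<^bsub>Y\<^esub> y)) (comult H h)"
      unfolding twisted_act_def
      by (rule sweedler_cong[OF H module_N bil[OF y] h]) (use lin y in \<open>simp add: Y.m_assoc closed_intros\<close>)
    also have "\<dots> = f (tensor_lift Y ?b (comult H h) \<otimes>\<^bsub>Y\<^esub> y)"
      by (rule sym, rule sweedler_natural[OF H Q.module_H module_N \<phi> b h])
    also have "\<dots> = counit H h \<odot>\<^bsub>N\<^esub> f y"
      using linear_smult[OF \<phi> coalgebra.counit_closed[OF H h] Y.one_closed] y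
      by (simp add: hopf_algebra.antipode_convolution[OF Q.hopf_H H xi_hom h])
    finally show "twisted_act h f y = counit H h \<odot>\<^bsub>N\<^esub> f y" .
  }
qed

text \<open>In Sweedler notation, \<open>\<Sum> \<langle>h, n\<^sub>1 k\<rangle> n\<^sub>0 = \<Sum> \<langle>h\<^sub>1, n\<^sub>1\<rangle> \<langle>h\<^sub>2, k\<rangle> n\<^sub>0 = \<Sum> \<langle>h\<^sub>2, k\<rangle> h\<^sub>1 n\<close>.\<close>

lemma eval_coact_mult:
  assumes h: "h \<in> carrier H" and n: "n \<in> carrier N" and k: "k \<in> carrier K"
  shows "tensor_lift N (\<lambda>n0 n1. \<beta> h (n1 \<otimes>\<^bsub>K\<^esub> k) \<odot>\<^bsub>N\<^esub> n0) (coact n) =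
    tensor_lift N (\<lambda>h1 h2. \<beta> h2 k \<odot>\<^bsub>N\<^esub> act h1 n) (comult H h)"
proof -
  note H = P.coalgebra_H and c = coact_closed[OF n] and hh = coalgebra.comult_closed[OF P.coalgebra_H h]
  have e1: "\<beta> h (n1 \<otimes>\<^bsub>K\<^esub> k) \<odot>\<^bsub>N\<^esub> n0 =
      tensor_lift N (\<lambda>h1 h2. \<beta> h2 k \<odot>\<^bsub>N\<^esub> (\<beta> h1 n1 \<odot>\<^bsub>N\<^esub> n0)) (comult H h)"
    if n': "n0 \<in> carrier N" "n1 \<in> carrier K" for n0 n1
  proof -
    have b: "bilinear R H H (regular_module R) (\<lambda>h1 h2. \<beta> h1 n1 \<otimes>\<^bsub>R\<^esub> \<beta> h2 k)"
        by (intro linear_intros closed_intros n' k)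
    have \<phi>: "(\<lambda>r. r \<odot>\<^bsub>N\<^esub> n0) \<in> linear_maps R (regular_module R) N" by (intro linear_intros n')
    show ?thesis
      unfolding P.pair_mult_right[OF h n'(2) k] sweedler_natural[OF H module_scalars module_N \<phi> b h]
      by (rule sweedler_cong[OF H module_N bilinear_compose[OF \<phi> b] h])
        (use n' k in \<open>simp add: closed_intros N.R.m_comm flip: N.smult_assoc1\<close>)
  qed
  have "tensor_lift N (\<lambda>n0 n1. \<beta> h (n1 \<otimes>\<^bsub>K\<^esub> k) \<odot>\<^bsub>N\<^esub> n0) (coact n) =
    tensor_lift N (\<lambda>n0 n1. tensor_lift N (\<lambda>h1 h2. \<beta> h2 k \<odot>\<^bsub>N\<^esub> (\<beta> h1 n1 \<odot>\<^bsub>N\<^esub> n0)) (comult H h)) (coact n)"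
    by (rule tensor_lift_cong[OF module_N P.module_K module_N _ c e1]) (intro linear_intros closed_intros h k)
  also have "\<dots> = tensor_lift N (\<lambda>h1 h2. tensor_lift N (\<lambda>n0 n1. \<beta> h2 k \<odot>\<^bsub>N\<^esub> (\<beta> h1 n1 \<odot>\<^bsub>N\<^esub> n0)) (coact n))
      (comult H h)"
    by (rule tensor_lift_swap[OF module_N P.module_K P.module_H P.module_H module_N c hh])
        (intro linear_intros closed_intros h k; assumption)+
  also have "\<dots> = tensor_lift N (\<lambda>h1 h2. \<beta> h2 k \<odot>\<^bsub>N\<^esub> act h1 n) (comult H h)"
  proof (rule sym, rule sweedler_cong[OF H module_N _ h])
    fix h1 h2 assume h': "h1 \<in> carrier H" "h2 \<in> carrier H"
    show "\<beta> h2 k \<odot>\<^bsub>N\<^esub> act h1 n = tensor_lift N (\<lambda>n0 n1. \<beta> h2 k \<odot>\<^bsub>N\<^esub> (\<beta> h1 n1 \<odot>\<^bsub>N\<^esub> n0)) (coact n)"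
      unfolding eval_coact[OF n h'(1), symmetric] tensor_eval_def
      by (rule tensor_lift_natural[OF module_N P.module_K module_N module_N P.eval_bilinear[OF module_N
          h'(1)] _ c]) (intro linear_intros closed_intros h' k)
  qed (intro linear_intros closed_intros n k)
  finally show ?thesis .
qed


abbreviation TK where "TK \<equiv> tensor R T K"
abbreviation twisted where "twisted \<equiv> twisted_coaction R H K \<beta> Z \<theta> (N, act)"

lemma module_TK: "module R TK"
  by (rule module_tensor[OF module_T P.module_K])

text \<open>The innermost summand of the twisted coaction.\<close>

abbreviation twist where
  "twist n0 n1 z1 z2 \<equiv> tens R T K (tens R N Z n0 z2) (n1 \<otimes>\<^bsub>K\<^esub> antipode K (\<theta> z1))"

lemma twisted_bilinear:
  shows "\<lbrakk>n0 \<in> carrier N; n1 \<in> carrier K\<rbrakk> \<Longrightarrow>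
      bilinear R Z Z TK (twist n0 n1)" (is "_ \<Longrightarrow> _ \<Longrightarrow> ?A n0 n1")
    and "z \<in> carrier Z \<Longrightarrow> bilinear R N K TK (\<lambda>n0 n1. tensor_lift TK (twist n0 n1) (comult Z z))" (is "_ \<Longrightarrow> ?B z")
    and "bilinear R N Z TK (\<lambda>n z. tensor_lift TK (\<lambda>n0 n1. tensor_lift TK (twist n0 n1)
        (comult Z z)) (coact n))" (is ?C)
proof -
  note bT = bilinear_tens[OF module_T P.module_K] and bN = bilinear_tens[OF module_N Q.module_K]
  note tl = linear_compose[OF bilinear_left[OF bT]] linear_compose[OF bilinear_right[OF bT]]
    linear_compose[OF bilinear_left[OF bN]] linear_compose[OF bilinear_right[OF bN]] tens_closed
  show A: "?A n0 n1" if "n0 \<in> carrier N" "n1 \<in> carrier K" for n0 n1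
    by (intro linear_intros tl closed_intros that)
  show B: "?B z" if "z \<in> carrier Z" for z
    by (intro linear_intros tl closed_intros that module_TK)
  show ?C
  proof (rule bilinearI)
    fix n assume n: "n \<in> carrier N"
    show "(\<lambda>z. tensor_lift TK (\<lambda>n0 n1. tensor_lift TK (twist n0 n1)
        (comult Z z)) (coact n)) \<in> linear_maps R Z TK"
      by (intro linear_lift[OF module_N P.module_K module_TK Q.module_K coact_closed[OF n]]
          B linear_sweedler_arg[OF Q.coalgebra_K module_TK] A linear_id)
  next
    fix z assume z: "z \<in> carrier Z"
    show "(\<lambda>n. tensor_lift TK (\<lambda>n0 n1. tensor_lift TK (twist n0 n1)
        (comult Z z)) (coact n)) \<in> linear_maps R N TK"
      by (rule linear_lift_arg[OF module_N P.module_K module_TK B[OF z] coact_linear])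
  qed
qed

lemma twisted_linear: "twisted \<in> linear_maps R T TK"
  unfolding twisted_coaction_def Let_def prod.case
  by (rule tensor_lift_linear[OF module_N Q.module_K module_TK twisted_bilinear(3)])

text \<open>On \<open>n \<otimes> z\<close> the left side is
  \<open>\<Sum> \<langle>h, n\<^sub>1 S(\<theta> z\<^sub>1)\<rangle> \<langle>y, z\<^sub>2\<rangle> n\<^sub>0 = \<Sum> \<langle>h\<^sub>2, S(\<theta> z\<^sub>1)\<rangle> \<langle>y, z\<^sub>2\<rangle> h\<^sub>1 n\<close>. By \<open>antipode_adjoint\<close> the
  two scalars combine to \<open>\<langle>S(\<xi> h\<^sub>2) y, z\<rangle>\<close>.\<close>

lemma eval_twisted:
  assumes h: "h \<in> carrier H" and y: "y \<in> carrier Y" and t: "t \<in> carrier T"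
  shows "ev y (tensor_eval \<beta> T h (twisted t)) = twisted_act h (\<lambda>y. ev y t) y"
proof (rule tensor_ext[OF module_N Q.module_K module_N _ _ _ t])
  note H = P.coalgebra_H and Zc = Q.coalgebra_K
  have \<phi>: "(\<lambda>s. ev y (tensor_eval \<beta> T h s)) \<in> linear_maps R TK N" (is "?\<phi> \<in> _")
    by (rule linear_compose[OF ev_linear[OF y] P.eval_linear[OF module_T h]])
  show "(\<lambda>t. ev y (tensor_eval \<beta> T h (twisted t))) \<in> linear_maps R T N"
    by (rule linear_compose[OF \<phi> twisted_linear])
  show "(\<lambda>t. twisted_act h (\<lambda>y. ev y t) y) \<in> linear_maps R T N"
    unfolding twisted_act_def
    by (intro linear_sweedler[OF H module_N module_T h]
        twisted_act_bilinear[OF Q.eval_linear_left[OF module_N]] linear_act ev_linear closed_intros y)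
  fix n z assume n: "n \<in> carrier N" and z: "z \<in> carrier Z"
  note c = coact_closed[OF n] and dz = coalgebra.comult_closed[OF Zc z]
  have "?\<phi> (twisted (tens R N Z n z)) = ?\<phi> (tensor_lift TK (\<lambda>n0 n1. tensor_lift TK (twist n0 n1)
      (comult Z z)) (coact n))"
    unfolding twisted_coaction_def Let_def prod.case
    by (simp only: tensor_lift_tens[OF module_N Q.module_K module_TK twisted_bilinear(3) n z])
  also have "\<dots> = tensor_lift N (\<lambda>n0 n1. ?\<phi> (tensor_lift TK (twist n0 n1) (comult Z z))) (coact n)"
    by (rule tensor_lift_natural[OF module_N P.module_K module_TK module_N twisted_bilinear(2)[OF z] \<phi> c])
  also have "\<dots> = tensor_lift N (\<lambda>n0 n1. tensor_lift N (\<lambda>z1 z2.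
      \<gamma> y z2 \<odot>\<^bsub>N\<^esub> (\<beta> h (n1 \<otimes>\<^bsub>K\<^esub> antipode K (\<theta> z1)) \<odot>\<^bsub>N\<^esub> n0)) (comult Z z)) (coact n)"
  proof (rule tensor_lift_cong[OF module_N P.module_K module_N bilinear_compose[OF \<phi> twisted_bilinear(2)[OF
      z]] c])
    fix n0 n1 assume n': "n0 \<in> carrier N" "n1 \<in> carrier K"
    note b = twisted_bilinear(1)[OF n']
    show "?\<phi> (tensor_lift TK (twist n0 n1) (comult Z z)) =
      tensor_lift N (\<lambda>z1 z2. \<gamma> y z2 \<odot>\<^bsub>N\<^esub> (\<beta> h (n1 \<otimes>\<^bsub>K\<^esub> antipode K (\<theta> z1)) \<odot>\<^bsub>N\<^esub> n0)) (comult Z z)"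
      unfolding sweedler_natural[OF Zc module_TK module_N \<phi> b z]
      by (rule sweedler_cong[OF Zc module_N bilinear_compose[OF \<phi> b] z])
        (use n' h y in \<open>simp add: P.eval_tens[OF module_T] Q.eval_tens[OF module_N]
            tens_closed closed_intros linear_smult[OF ev_linear]
          N.R.m_comm flip: N.smult_assoc1\<close>)
  qed
  also have "\<dots> = tensor_lift N (\<lambda>z1 z2. tensor_lift N (\<lambda>n0 n1.
      \<gamma> y z2 \<odot>\<^bsub>N\<^esub> (\<beta> h (n1 \<otimes>\<^bsub>K\<^esub> antipode K (\<theta> z1)) \<odot>\<^bsub>N\<^esub> n0)) (coact n)) (comult Z z)"
    by (rule tensor_lift_swap[OF module_N P.module_K Q.module_K Q.module_K module_N c dz])
        (intro linear_intros closed_intros h y; assumption)+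
  also have "\<dots> = tensor_lift N (\<lambda>z1 z2. tensor_lift N (\<lambda>h1 h2.
      \<gamma> y z2 \<odot>\<^bsub>N\<^esub> (\<beta> h2 (antipode K (\<theta> z1)) \<odot>\<^bsub>N\<^esub> act h1 n)) (comult H h)) (comult Z z)"
  proof (rule sym, rule sweedler_cong[OF Zc module_N _ z])
    fix z1 z2 assume z': "z1 \<in> carrier Z" "z2 \<in> carrier Z"
    let ?k = "antipode K (\<theta> z1)"
    have k: "?k \<in> carrier K" by (intro closed_intros z')
    have \<psi>: "(\<lambda>x. \<gamma> y z2 \<odot>\<^bsub>N\<^esub> x) \<in> linear_maps R N N" by (intro linear_intros closed_intros y z')
    have b1: "bilinear R H H N (\<lambda>h1 h2. \<beta> h2 ?k \<odot>\<^bsub>N\<^esub> act h1 n)" by (intro linear_intros closed_intros k n)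
    have b2: "bilinear R N K N (\<lambda>n0 n1. \<beta> h (n1 \<otimes>\<^bsub>K\<^esub> ?k) \<odot>\<^bsub>N\<^esub> n0)" by (intro linear_intros closed_intros k h)
    show "tensor_lift N (\<lambda>h1 h2. \<gamma> y z2 \<odot>\<^bsub>N\<^esub> (\<beta> h2 ?k \<odot>\<^bsub>N\<^esub> act h1 n)) (comult H h) =
      tensor_lift N (\<lambda>n0 n1. \<gamma> y z2 \<odot>\<^bsub>N\<^esub> (\<beta> h (n1 \<otimes>\<^bsub>K\<^esub> ?k) \<odot>\<^bsub>N\<^esub> n0)) (coact n)"
      using sweedler_natural[OF H module_N module_N \<psi> b1 h]
          tensor_lift_natural[OF module_N P.module_K module_N module_N b2 \<psi> c] eval_coact_mult[OF h n k]
      by simp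
  qed (intro linear_intros closed_intros h y n)
  also have "\<dots> = tensor_lift N (\<lambda>h1 h2. tensor_lift N (\<lambda>z1 z2.
      \<gamma> y z2 \<odot>\<^bsub>N\<^esub> (\<beta> h2 (antipode K (\<theta> z1)) \<odot>\<^bsub>N\<^esub> act h1 n)) (comult Z z)) (comult H h)"
    by (rule sweedler_swap[OF Zc H module_N z h]) (intro linear_intros closed_intros y n; assumption)+
  also have "\<dots> = twisted_act h (\<lambda>y. ev y (tens R N Z n z)) y"
    unfolding twisted_act_def
  proof (rule sweedler_cong[OF H module_N _ h])
    fix h1 h2 assume h': "h1 \<in> carrier H" "h2 \<in> carrier H"
    let ?y = "antipode Y (\<xi> h2)"
    have a: "act h1 n \<in> carrier N" by (intro closed_intros n h')
    have \<psi>: "(\<lambda>r. r \<odot>\<^bsub>N\<^esub> act h1 n) \<in> linear_maps R (regular_module R) N" by (intro linear_intros a)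
    have b: "bilinear R Z Z (regular_module R) (\<lambda>z1 z2. \<gamma> ?y z1 \<otimes>\<^bsub>R\<^esub> \<gamma> y z2)"
      by (intro linear_intros closed_intros h' y)
    have "act h1 (ev (?y \<otimes>\<^bsub>Y\<^esub> y) (tens R N Z n z)) = \<gamma> (?y \<otimes>\<^bsub>Y\<^esub> y) z \<odot>\<^bsub>N\<^esub> act h1 n"
      using h' y n z by (simp add: Q.eval_tens[OF module_N] closed_intros linear_smult[OF act_linear])
    also have "\<dots> = tensor_lift N (\<lambda>z1 z2. (\<gamma> ?y z1 \<otimes>\<^bsub>R\<^esub> \<gamma> y z2) \<odot>\<^bsub>N\<^esub> act h1 n) (comult Z z)"
      using sweedler_natural[OF Zc module_scalars module_N \<psi> b z] h' y z
          by (simp add: Q.pair_mult_left closed_intros)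
    also have "\<dots> = tensor_lift N (\<lambda>z1 z2. \<gamma> y z2 \<odot>\<^bsub>N\<^esub> (\<beta> h2 (antipode K (\<theta> z1)) \<odot>\<^bsub>N\<^esub> act h1 n)) (comult Z z)"
      by (rule sweedler_cong[OF Zc module_N bilinear_compose[OF \<psi> b] z])
        (use h' y n in \<open>simp add: closed_intros antipode_adjoint N.R.m_comm flip: N.smult_assoc1\<close>)
    finally show "tensor_lift N (\<lambda>z1 z2. \<gamma> y z2 \<odot>\<^bsub>N\<^esub> (\<beta> h2 (antipode K (\<theta> z1)) \<odot>\<^bsub>N\<^esub> act h1 n)) (comult Z z) =
        act h1 (ev (?y \<otimes>\<^bsub>Y\<^esub> y) (tens R N Z n z))" ..
  qed (intro linear_intros closed_intros h y n z)
  finally show "?\<phi> (twisted (tens R N Z n z)) = twisted_act h (\<lambda>y. ev y (tens R N Z n z)) y" .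
qed

lemma ev_linear_left: "t \<in> carrier T \<Longrightarrow> (\<lambda>y. ev y t) \<in> linear_maps R Y N"
  by (rule Q.eval_linear_left[OF module_N])

lemma invariants_twisted:
  "invariants H T (induced_action \<beta> T twisted) = equivariant_tensors"
proof -
  have "(\<forall>h\<in>carrier H. tensor_eval \<beta> T h (twisted t) = counit H h \<odot>\<^bsub>T\<^esub> t) \<longleftrightarrow>
      (\<forall>h\<in>carrier H. \<forall>y\<in>carrier Y. act h (ev y t) = ev (\<xi> h \<otimes>\<^bsub>Y\<^esub> y) t)" if t: "t \<in> carrier T" for t
  proof -
    have c: "tensor_eval \<beta> T h (twisted t) \<in> carrier T" "counit H h \<odot>\<^bsub>T\<^esub> t \<in> carrier T" if "h \<in> carrier H" for h
      using that t linear_closed[OF twisted_linear t] coalgebra.counit_closed[OF P.coalgebra_H]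
      by (auto intro: P.eval_closed[OF module_T])
    have "(\<forall>h\<in>carrier H. tensor_eval \<beta> T h (twisted t) = counit H h \<odot>\<^bsub>T\<^esub> t) \<longleftrightarrow>
      (\<forall>h\<in>carrier H. \<forall>y\<in>carrier Y. ev y (tensor_eval \<beta> T h (twisted t)) = ev y (counit H h \<odot>\<^bsub>T\<^esub> t))"
      using ev_inj c by metis
    also have "\<dots> \<longleftrightarrow> (\<forall>h\<in>carrier H. \<forall>y\<in>carrier Y. twisted_act h (\<lambda>y. ev y t) y = counit H h \<odot>\<^bsub>N\<^esub> ev y t)"
      using t by (simp add: eval_twisted linear_smult[OF ev_linear] coalgebra.counit_closed[OF P.coalgebra_H])
    finally show ?thesis
      unfolding twisted_act_invariant_iff[OF ev_linear_left[OF t]] by metis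
  qed
  then show ?thesis
    by (auto simp: invariants_def equivariant_tensors_def induced_action_eval)
qed

text \<open>Evaluating \<open>t \<otimes> 1\<close> at \<open>h\<close> gives \<open>\<epsilon>(h) t\<close>, so the \<open>\<alpha>\<close>-condition for \<open>(H, K)\<close> turns coinvariance
  into invariance.\<close>

lemma coinvariants_twisted: "coinvariants R K T twisted = invariants H T (induced_action \<beta> T twisted)"
proof -
  have "twisted t = tens R T K t \<one>\<^bsub>K\<^esub> \<longleftrightarrow>
      (\<forall>h\<in>carrier H. tensor_eval \<beta> T h (twisted t) = counit H h \<odot>\<^bsub>T\<^esub> t)" if t: "t \<in> carrier T" for t
  proof -
    have e: "tensor_eval \<beta> T h (tens R T K t \<one>\<^bsub>K\<^esub>) = counit H h \<odot>\<^bsub>T\<^esub> t" if "h \<in> carrier H" for h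
      using that t by (simp add: P.eval_tens[OF module_T] P.pair_one_right)
    show ?thesis
      using P.eval_inj[OF module_T linear_closed[OF twisted_linear t], of "tens R T K t \<one>\<^bsub>K\<^esub>"] e t
      by (auto intro: tens_closed)
  qed
  then show ?thesis
    by (auto simp: invariants_def coinvariants_def induced_action_eval)
qed


section \<open>The cotensor product\<close>

abbreviation KZ where "KZ \<equiv> tensor R K Z"
abbreviation NK where "NK \<equiv> tensor R N K"

lemma module_KZ: "module R KZ" and module_NK: "module R NK"
  by (rule module_tensor[OF P.module_K Q.module_K], rule module_tensor[OF module_N P.module_K])

definition pair_KZ where
  "pair_KZ h y = tensor_lift (regular_module R) (\<lambda>k z. \<beta> h k \<otimes>\<^bsub>R\<^esub> \<gamma> y z)"

text \<open>Evaluation on \<open>N \<otimes> (K \<otimes> Z)\<close> at a pair \<open>(h, y)\<close>: the map \<open>n \<otimes> (k \<otimes> z) \<mapsto> \<langle>h, k\<rangle> \<langle>y, z\<rangle> n\<close>.\<close>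

definition eval_KZ where
  "eval_KZ h y = tensor_lift N (\<lambda>n s. pair_KZ h y s \<odot>\<^bsub>N\<^esub> n)"

context
  fixes h y assumes h: "h \<in> carrier H" and y: "y \<in> carrier Y"
begin

lemma pair_KZ_bilinear: "bilinear R K Z (regular_module R) (\<lambda>k z. \<beta> h k \<otimes>\<^bsub>R\<^esub> \<gamma> y z)"
  by (intro linear_intros closed_intros h y)

lemma pair_KZ_linear: "pair_KZ h y \<in> linear_maps R KZ (regular_module R)"
  unfolding pair_KZ_def by (rule tensor_lift_linear[OF P.module_K Q.module_K module_scalars pair_KZ_bilinear])

lemma pair_KZ_tens: "\<lbrakk>k \<in> carrier K; z \<in> carrier Z\<rbrakk> \<Longrightarrow> pair_KZ h y (tens R K Z k z) = \<beta> h k \<otimes>\<^bsub>R\<^esub> \<gamma> y z"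
  unfolding pair_KZ_def by (rule tensor_lift_tens[OF P.module_K Q.module_K module_scalars pair_KZ_bilinear])

lemma pair_KZ_closed: "s \<in> carrier KZ \<Longrightarrow> pair_KZ h y s \<in> carrier R"
  using linear_closed[OF pair_KZ_linear, of s] by simp

lemma eval_KZ_bilinear: "bilinear R N KZ N (\<lambda>n s. pair_KZ h y s \<odot>\<^bsub>N\<^esub> n)"
  by (intro linear_intros pair_KZ_linear pair_KZ_closed)

lemma eval_KZ_linear: "eval_KZ h y \<in> linear_maps R (tensor R N KZ) N"
  unfolding eval_KZ_def by (rule tensor_lift_linear[OF module_N module_KZ module_N eval_KZ_bilinear])

lemma eval_KZ_tens: "\<lbrakk>n \<in> carrier N; s \<in> carrier KZ\<rbrakk> \<Longrightarrow> eval_KZ h y (tens R N KZ n s) = pair_KZ h y s \<odot>\<^bsub>N\<^esub> n"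
  unfolding eval_KZ_def by (rule tensor_lift_tens[OF module_N module_KZ module_N eval_KZ_bilinear])

lemma eval_KZ_assoc:
  assumes "s \<in> carrier (tensor R NK Z)"
  shows "eval_KZ h y (tensor_assoc R N K Z s) = tensor_eval \<beta> N h (tensor_eval \<gamma> NK y s)"
proof (rule tensor_ext[OF module_NK Q.module_K module_N _ _ _ assms])
  show l1: "(\<lambda>s. eval_KZ h y (tensor_assoc R N K Z s)) \<in> linear_maps R (tensor R NK Z) N"
    by (rule linear_compose[OF eval_KZ_linear tensor_assoc_linear[OF module_N P.module_K Q.module_K]])
  show l2: "(\<lambda>s. tensor_eval \<beta> N h (tensor_eval \<gamma> NK y s)) \<in> linear_maps R (tensor R NK Z) N"
    by (rule linear_compose[OF P.eval_linear[OF module_N h] Q.eval_linear[OF module_NK y]])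
  fix w z assume w: "w \<in> carrier NK" and z: "z \<in> carrier Z"
  note b = bilinear_left[OF bilinear_tens[OF module_NK Q.module_K] z]
  show "eval_KZ h y (tensor_assoc R N K Z (tens R NK Z w z)) =
      tensor_eval \<beta> N h (tensor_eval \<gamma> NK y (tens R NK Z w z))"
  proof (rule tensor_ext[OF module_N P.module_K module_N linear_compose[OF l1 b] linear_compose[OF l2 b] _ w])
    fix n k assume "n \<in> carrier N" "k \<in> carrier K"
    then show "eval_KZ h y (tensor_assoc R N K Z (tens R NK Z (tens R N K n k) z)) =
        tensor_eval \<beta> N h (tensor_eval \<gamma> NK y (tens R NK Z (tens R N K n k) z))"
      using h y z by (simp add: tensor_assoc_tens[OF module_N P.module_K Q.module_K]
          eval_KZ_tens pair_KZ_tens tens_closed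
          Q.eval_tens[OF module_NK] P.eval_tens[OF module_N] linear_smult[OF P.eval_linear[OF module_N]]
              closed_intros N.R.m_comm
          flip: N.smult_assoc1)
  qed
qed

end

text \<open>After reassociation, evaluation at \<open>(h, y)\<close> is evaluation at \<open>y\<close> for the module \<open>N \<otimes> K\<close>
  followed by evaluation at \<open>h\<close> for \<open>N\<close>; both steps are injective by the \<open>\<alpha>\<close>-conditions.\<close>

lemma eval_KZ_inj:
  assumes "u \<in> carrier (tensor R N KZ)" "v \<in> carrier (tensor R N KZ)"
    and eq: "\<And>h y. \<lbrakk>h \<in> carrier H; y \<in> carrier Y\<rbrakk> \<Longrightarrow> eval_KZ h y u = eval_KZ h y v"
  shows "u = v"
proof -
  obtain s where s: "s \<in> carrier (tensor R NK Z)" "tensor_assoc R N K Z s = u"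
    by (rule tensor_assoc_surj[OF module_N P.module_K Q.module_K assms(1)])
  obtain t where t: "t \<in> carrier (tensor R NK Z)" "tensor_assoc R N K Z t = v"
    by (rule tensor_assoc_surj[OF module_N P.module_K Q.module_K assms(2)])
  have "s = t"
  proof (rule Q.eval_inj[OF module_NK s(1) t(1)])
    fix y assume y: "y \<in> carrier Y"
    show "tensor_eval \<gamma> NK y s = tensor_eval \<gamma> NK y t"
    proof (rule P.eval_inj[OF module_N])
      show "tensor_eval \<gamma> NK y s \<in> carrier NK" "tensor_eval \<gamma> NK y t \<in> carrier NK"
        using Q.eval_closed[OF module_NK y] s t by auto
      show "tensor_eval \<beta> N h (tensor_eval \<gamma> NK y s) = tensor_eval \<beta> N h (tensor_eval \<gamma> NK y t)"
        if "h \<in> carrier H" for h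
        using eq[OF that y] s t by (simp add: eval_KZ_assoc[OF that y, symmetric])
    qed
  qed
  then show ?thesis using s t by simp
qed

text \<open>The two maps whose equaliser is the cotensor product evaluate to \<open>h (ev y t)\<close> and
  \<open>\<Sum> \<langle>h, \<theta> z\<^sub>1\<rangle> \<langle>y, z\<^sub>2\<rangle> n = ev (\<xi>(h) y) t\<close>.\<close>

lemma cotensor_equivariant: "cotensor R H K \<beta> Z \<theta> (N, act) = equivariant_tensors"
proof -
  let ?A = "\<lambda>t. tensor_assoc R N K Z (tensor_map R NK Z coact (\<lambda>x. x) t)"
  let ?r = "\<lambda>z. tensor_map R K Z \<theta> (\<lambda>x. x) (comult Z z)"
  let ?B = "\<lambda>t. tensor_map R N KZ (\<lambda>x. x) ?r t"
  note Zc = Q.coalgebra_K and dz = coalgebra.comult_closed[OF Q.coalgebra_K]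
  interpret NKZ: module R "tensor R N KZ" by (rule module_tensor[OF module_N module_KZ])
  have m: "tensor_map R NK Z coact (\<lambda>x. x) \<in> linear_maps R T (tensor R NK Z)"
    by (rule tensor_map_linear[OF module_N Q.module_K module_NK Q.module_K coact_linear linear_id])
  have A: "?A \<in> linear_maps R T (tensor R N KZ)"
    by (rule linear_compose[OF tensor_assoc_linear[OF module_N P.module_K Q.module_K] m])
  have r: "?r \<in> linear_maps R Z KZ"
    by (rule linear_compose[OF tensor_map_linear[OF Q.module_K Q.module_K P.module_K Q.module_K theta(1)
        linear_id]
          coalgebra.comult_linear[OF Zc]])
  have B: "?B \<in> linear_maps R T (tensor R N KZ)"
    by (rule tensor_map_linear[OF module_N Q.module_K module_N module_KZ linear_id r])
  have eA: "eval_KZ h y (?A t) = act h (ev y t)" if "h \<in> carrier H" "y \<in> carrier Y" "t \<in> carrier T" for h y t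
    using that by (simp add: eval_KZ_assoc linear_closed[OF m]
        Q.eval_natural[OF module_N module_NK coact_linear] eval_coact ev_closed)
  have eB: "eval_KZ h y (?B t) = ev (\<xi> h \<otimes>\<^bsub>Y\<^esub> y) t"
    if h: "h \<in> carrier H" and y: "y \<in> carrier Y" and t: "t \<in> carrier T" for h y t
  proof (rule tensor_ext[OF module_N Q.module_K module_N linear_compose[OF eval_KZ_linear[OF h y] B]
      ev_linear _ t])
    show "\<xi> h \<otimes>\<^bsub>Y\<^esub> y \<in> carrier Y" by (intro closed_intros h y)
    fix n z assume n: "n \<in> carrier N" and z: "z \<in> carrier Z"
    have "pair_KZ h y (?r z) = tensor_lift (regular_module R) (\<lambda>z1 z2. \<beta> h (\<theta> z1) \<otimes>\<^bsub>R\<^esub> \<gamma> y z2) (comult Z z)"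
      unfolding pair_KZ_def
      by (rule tensor_lift_map[OF Q.module_K Q.module_K P.module_K Q.module_K module_scalars theta(1)
          linear_id pair_KZ_bilinear[OF h y] dz[OF z]])
    also have "\<dots> = tensor_lift (regular_module R) (\<lambda>z1 z2. \<gamma> (\<xi> h) z1 \<otimes>\<^bsub>R\<^esub> \<gamma> y z2) (comult Z z)"
      by (rule sweedler_cong[OF Zc module_scalars _ z], intro linear_intros closed_intros h y)
          (simp_all add: adjoint h z)
    also have "\<dots> = \<gamma> (\<xi> h \<otimes>\<^bsub>Y\<^esub> y) z"
      by (rule Q.pair_mult_left[symmetric]) (intro closed_intros h y z)+
    finally show "eval_KZ h y (?B (tens R N Z n z)) = ev (\<xi> h \<otimes>\<^bsub>Y\<^esub> y) (tens R N Z n z)"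
      using n z h y by (simp add: tensor_map_tens[OF module_N Q.module_K module_N module_KZ linear_id r]
          eval_KZ_tens linear_closed[OF r]
          Q.eval_tens[OF module_N] closed_intros)
  qed
  have "?A t \<ominus>\<^bsub>tensor R N KZ\<^esub> ?B t = \<zero>\<^bsub>tensor R N KZ\<^esub> \<longleftrightarrow>
      (\<forall>h\<in>carrier H. \<forall>y\<in>carrier Y. act h (ev y t) = ev (\<xi> h \<otimes>\<^bsub>Y\<^esub> y) t)" if t: "t \<in> carrier T" for t
  proof -
    note c = linear_closed[OF A t] linear_closed[OF B t]
    have "?A t \<ominus>\<^bsub>tensor R N KZ\<^esub> ?B t = \<zero>\<^bsub>tensor R N KZ\<^esub> \<longleftrightarrow> ?A t = ?B t"
      using c by (metis NKZ.a_inv_closed NKZ.minus_eq NKZ.minus_equality NKZ.minus_minus NKZ.r_neg)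
    also have "\<dots> \<longleftrightarrow> (\<forall>h\<in>carrier H. \<forall>y\<in>carrier Y. eval_KZ h y (?A t) = eval_KZ h y (?B t))"
      using eval_KZ_inj[OF c] by metis
    finally show ?thesis using t by (simp add: eA eB)
  qed
  then show ?thesis
    by (auto simp: cotensor_def equivariant_tensors_def a_kernel_def' Let_def)
qed


section \<open>Bimodule homomorphisms\<close>

text \<open>The action of the single element \<open>h \<otimes> h'\<close> of the enveloping algebra on \<open>N \<otimes> Z\<close>.\<close>

definition bi_act where
  "bi_act h h' = tensor_lift T (\<lambda>n z. tens R N Z (act h n)
     (tensor_lift Z (\<lambda>z1 z2. \<gamma> (\<xi> h') z1 \<odot>\<^bsub>Z\<^esub> z2) (comult Z z)))"

lemma hit_bilinear: "h' \<in> carrier H \<Longrightarrow> bilinear R Z Z Z (\<lambda>z1 z2. \<gamma> (\<xi> h') z1 \<odot>\<^bsub>Z\<^esub> z2)"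
  by (intro linear_intros linear_smult_left[OF Q.module_K] linear_smult_right[OF Q.module_K] closed_intros)

lemma hit_linear: "h' \<in> carrier H \<Longrightarrow>
    (\<lambda>z. tensor_lift Z (\<lambda>z1 z2. \<gamma> (\<xi> h') z1 \<odot>\<^bsub>Z\<^esub> z2) (comult Z z)) \<in> linear_maps R Z Z"
  by (intro linear_sweedler_arg[OF Q.coalgebra_K Q.module_K] hit_bilinear linear_id)

lemma hit_linear_left: "z \<in> carrier Z \<Longrightarrow>
    (\<lambda>h'. tensor_lift Z (\<lambda>z1 z2. \<gamma> (\<xi> h') z1 \<odot>\<^bsub>Z\<^esub> z2) (comult Z z)) \<in> linear_maps R H Z"
  by (intro linear_sweedler[OF Q.coalgebra_K Q.module_K]
      hit_bilinear linear_intros linear_smult_left[OF Q.module_K])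

lemma bi_act_bilinear:
  assumes "h \<in> carrier H" "h' \<in> carrier H"
  shows "bilinear R N Z T (\<lambda>n z. tens R N Z (act h n)
     (tensor_lift Z (\<lambda>z1 z2. \<gamma> (\<xi> h') z1 \<odot>\<^bsub>Z\<^esub> z2) (comult Z z)))"
  using assms by (intro bilinear_tens_compose module_N Q.module_K act_linear hit_linear)

lemma bi_act_linear: "\<lbrakk>h \<in> carrier H; h' \<in> carrier H\<rbrakk> \<Longrightarrow> bi_act h h' \<in> linear_maps R T T"
  unfolding bi_act_def by (rule tensor_lift_linear[OF module_N Q.module_K module_T bi_act_bilinear])

lemma bi_act_closed: "\<lbrakk>h \<in> carrier H; h' \<in> carrier H; t \<in> carrier T\<rbrakk> \<Longrightarrow> bi_act h h' t \<in> carrier T"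
  using linear_closed[OF bi_act_linear] .

lemma bi_act_bilinear_left: "t \<in> carrier T \<Longrightarrow> bilinear R H H T (\<lambda>h h'. bi_act h h' t)"
  unfolding bi_act_def
  by (intro bilinearI linear_lift[OF module_N Q.module_K module_T P.module_H] bi_act_bilinear
      linear_compose[OF bilinear_left[OF bilinear_tens[OF module_N Q.module_K]] act_linear_left]
      linear_compose[OF bilinear_right[OF bilinear_tens[OF module_N Q.module_K]] hit_linear_left] act_closed
      linear_closed[OF hit_linear])

lemma ev_bi_act:
  assumes h: "h \<in> carrier H" and h': "h' \<in> carrier H" and y: "y \<in> carrier Y" and t: "t \<in> carrier T"
  shows "ev y (bi_act h h' t) = act h (ev (\<xi> h' \<otimes>\<^bsub>Y\<^esub> y) t)"
proof (rule tensor_ext[OF module_N Q.module_K module_N linear_compose[OF ev_linear[OF y] bi_act_linear[OF h h']]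
      linear_compose[OF act_linear[OF h] ev_linear] _ t])
  note Zc = Q.coalgebra_K
  show "\<xi> h' \<otimes>\<^bsub>Y\<^esub> y \<in> carrier Y" by (intro closed_intros h' y)
  fix n z assume n: "n \<in> carrier N" and z: "z \<in> carrier Z"
  have "\<gamma> y (tensor_lift Z (\<lambda>z1 z2. \<gamma> (\<xi> h') z1 \<odot>\<^bsub>Z\<^esub> z2) (comult Z z)) =
      tensor_lift (regular_module R) (\<lambda>z1 z2. \<gamma> (\<xi> h') z1 \<otimes>\<^bsub>R\<^esub> \<gamma> y z2) (comult Z z)"
    unfolding sweedler_natural[OF Zc Q.module_K module_scalars Q.linear_right[OF y] hit_bilinear[OF h'] z]
    by (rule sweedler_cong[OF Zc module_scalars bilinear_compose[OF Q.linear_right[OF y]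
        hit_bilinear[OF h']] z])
      (use y h' in \<open>simp add: linear_smult[OF Q.linear_right] closed_intros\<close>)
  also have "\<dots> = \<gamma> (\<xi> h' \<otimes>\<^bsub>Y\<^esub> y) z"
    by (rule Q.pair_mult_left[symmetric]) (intro closed_intros h' y z)+
  finally show "ev y (bi_act h h' (tens R N Z n z)) = act h (ev (\<xi> h' \<otimes>\<^bsub>Y\<^esub> y) (tens R N Z n z))"
    using n z h h' y
    by (simp add: bi_act_def tensor_lift_tens[OF module_N Q.module_K module_T bi_act_bilinear]
        Q.eval_tens[OF module_N] closed_intros
        linear_closed[OF hit_linear] linear_smult[OF act_linear])
qed

text \<open>The tensor product of modules does not see the multiplication of its factors.\<close>

lemma tensor_opposite: "tensor R M (opposite A) = tensor R M A"
  for A :: "('r, 'a, 'x) module_scheme"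
proof -
  have sel: "carrier (opposite A) = carrier A" "x \<oplus>\<^bsub>opposite A\<^esub> y = x \<oplus>\<^bsub>A\<^esub> y"
    "r \<odot>\<^bsub>opposite A\<^esub> x = r \<odot>\<^bsub>A\<^esub> x" for x y r
    by (simp_all add: opposite_def)
  show ?thesis
    by (simp add: tensor_def tensor_class_def tensor_null_def tensor_relators_def sel)
qed

lemma carrier_enveloping: "carrier (enveloping_algebra R H) = carrier (tensor R H H)"
  by (simp add: enveloping_algebra_def tensor_algebra_def tensor_opposite Let_def)

abbreviation env_act where "env_act \<equiv> enveloping_tensor_action R Z \<gamma> \<xi> (N, act)"

lemma env_act_alt: "env_act e t = tensor_lift T (\<lambda>h h'. bi_act h h' t) e"
  by (simp add: enveloping_tensor_action_def bi_act_def Let_def)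

lemma env_act_tens: "\<lbrakk>h \<in> carrier H; h' \<in> carrier H; t \<in> carrier T\<rbrakk> \<Longrightarrow>
    env_act (tens R H H h h') t = bi_act h h' t"
  unfolding env_act_alt by (rule tensor_lift_tens[OF P.module_H P.module_H module_T bi_act_bilinear_left])

lemma env_act_linear_left: "t \<in> carrier T \<Longrightarrow> (\<lambda>e. env_act e t) \<in> linear_maps R (tensor R H H) T"
  unfolding env_act_alt by (rule tensor_lift_linear[OF P.module_H P.module_H module_T bi_act_bilinear_left])

lemma enveloping_action_bilinear:
  assumes "x \<in> carrier H"
  shows "bilinear R H H H (\<lambda>h h'. h \<otimes>\<^bsub>H\<^esub> x \<otimes>\<^bsub>H\<^esub> h')"
proof -
  note b = assoc_algebra.bilinear_mult[OF P.algebra_H]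
  show ?thesis
    by (intro bilinearI bilinear_right[OF b] linear_compose[OF bilinear_left[OF b] bilinear_left[OF b]]
        H.m_closed assms)
qed

lemma enveloping_action_tens: "\<lbrakk>h \<in> carrier H; h' \<in> carrier H; x \<in> carrier H\<rbrakk> \<Longrightarrow>
    enveloping_action H (tens R H H h h') x = h \<otimes>\<^bsub>H\<^esub> x \<otimes>\<^bsub>H\<^esub> h'"
  unfolding enveloping_action_def
  by (rule tensor_lift_tens[OF P.module_H P.module_H P.module_H enveloping_action_bilinear])

lemma enveloping_action_linear_left:
  "x \<in> carrier H \<Longrightarrow> (\<lambda>e. enveloping_action H e x) \<in> linear_maps R (tensor R H H) H"
  unfolding enveloping_action_def
  by (rule tensor_lift_linear[OF P.module_H P.module_H P.module_H enveloping_action_bilinear])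

abbreviation bimod_homs where
  "bimod_homs \<equiv> equivariant_maps R (enveloping_algebra R H) H (enveloping_action H)
      T env_act \<inter> extensional (carrier H)"

text \<open>A linear map out of \<open>H\<close> is a bimodule map as soon as it respects the pure tensors of the
  enveloping algebra.\<close>

lemma bimod_homs_iff:
  "g \<in> bimod_homs \<longleftrightarrow> g \<in> linear_maps R H T \<and> g \<in> extensional (carrier H) \<and>
     (\<forall>h\<in>carrier H. \<forall>x\<in>carrier H. \<forall>h'\<in>carrier H. g (h \<otimes>\<^bsub>H\<^esub> x \<otimes>\<^bsub>H\<^esub> h') = bi_act h h' (g x))"
proof -
  have "(\<forall>e\<in>carrier (tensor R H H). \<forall>x\<in>carrier H. g (enveloping_action H e x) = env_act e (g x)) \<longleftrightarrow>
      (\<forall>h\<in>carrier H. \<forall>x\<in>carrier H. \<forall>h'\<in>carrier H. g (h \<otimes>\<^bsub>H\<^esub> x \<otimes>\<^bsub>H\<^esub> h') = bi_act h h' (g x))" (is "?l \<longleftrightarrow> ?r")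
    if g: "g \<in> linear_maps R H T"
  proof
    assume l: ?l
    show ?r
    proof (intro ballI)
      fix h x h' assume "h \<in> carrier H" "x \<in> carrier H" "h' \<in> carrier H"
      with bspec[OF bspec[OF l, of "tens R H H h h'"], of x]
      show "g (h \<otimes>\<^bsub>H\<^esub> x \<otimes>\<^bsub>H\<^esub> h') = bi_act h h' (g x)"
        by (simp add: tens_closed enveloping_action_tens env_act_tens linear_closed[OF g])
    qed
  next
    assume r: ?r
    show ?l
    proof (intro ballI)
      fix e x assume e: "e \<in> carrier (tensor R H H)" and x: "x \<in> carrier H"
      show "g (enveloping_action H e x) = env_act e (g x)"
        by (rule tensor_ext[OF P.module_H P.module_H module_T
            linear_compose[OF g enveloping_action_linear_left[OF x]]
              env_act_linear_left[OF linear_closed[OF g x]] _ e])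
          (use r x in \<open>simp add: enveloping_action_tens env_act_tens linear_closed[OF g]\<close>)
    qed
  qed
  then show ?thesis
    by (auto simp: equivariant_maps_def carrier_enveloping)
qed

text \<open>The candidate bimodule map \<open>x \<mapsto> (x \<otimes> 1) t\<close> with value \<open>t\<close> at \<open>1\<close>.\<close>

definition bimod_hom_of where
  "bimod_hom_of t = (\<lambda>x\<in>carrier H. bi_act x \<one>\<^bsub>H\<^esub> t)"

lemma ev_xi_one: "\<lbrakk>y \<in> carrier Y\<rbrakk> \<Longrightarrow> \<xi> \<one>\<^bsub>H\<^esub> \<otimes>\<^bsub>Y\<^esub> y = y"
  by (simp add: xi(4))

lemma ev_bimod_hom_of: "\<lbrakk>t \<in> carrier T; x \<in> carrier H; y \<in> carrier Y\<rbrakk> \<Longrightarrow>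
    ev y (bimod_hom_of t x) = act x (ev y t)"
  by (simp add: bimod_hom_of_def ev_bi_act ev_xi_one)

lemma bimod_hom_of_linear: "t \<in> carrier T \<Longrightarrow> bimod_hom_of t \<in> linear_maps R H T"
  unfolding bimod_hom_of_def
  by (rule linear_cong[OF P.module_H bilinear_left[OF bi_act_bilinear_left H.one_closed]]) simp_all

lemma bimod_hom_of_mem:
  assumes t: "t \<in> equivariant_tensors"
  shows "bimod_hom_of t \<in> bimod_homs"
  unfolding bimod_homs_iff
proof (intro conjI ballI)
  have tT: "t \<in> carrier T" using t by (simp add: equivariant_tensors_def)
  show lin: "bimod_hom_of t \<in> linear_maps R H T" by (rule bimod_hom_of_linear[OF tT])
  show "bimod_hom_of t \<in> extensional (carrier H)" by (simp add: bimod_hom_of_def)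
  fix h x h' assume hx: "h \<in> carrier H" "x \<in> carrier H" "h' \<in> carrier H"
  show "bimod_hom_of t (h \<otimes>\<^bsub>H\<^esub> x \<otimes>\<^bsub>H\<^esub> h') = bi_act h h' (bimod_hom_of t x)"
  proof (rule ev_inj)
    fix y assume y: "y \<in> carrier Y"
    show "ev y (bimod_hom_of t (h \<otimes>\<^bsub>H\<^esub> x \<otimes>\<^bsub>H\<^esub> h')) = ev y (bi_act h h' (bimod_hom_of t x))"
      using t tT hx y
      by (simp add: ev_bimod_hom_of ev_bi_act linear_closed[OF lin]
          closed_intros act_mult ev_closed equivariant_tensors_def
          xi(3) Y.m_assoc)
  qed (use hx tT in \<open>auto intro: linear_closed[OF lin] bi_act_closed\<close>)
qed

text \<open>\<open>g\<close> sends \<open>h\<close> both to \<open>(h \<otimes> 1) g(1)\<close> and to \<open>(1 \<otimes> h) g(1)\<close>; after evaluation this is the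
  equation that defines \<open>E(N)\<close>.\<close>

lemma bimod_hom_at_one:
  assumes g: "g \<in> bimod_homs"
  shows "g \<one>\<^bsub>H\<^esub> \<in> equivariant_tensors" "bimod_hom_of (g \<one>\<^bsub>H\<^esub>) = g"
proof -
  have lin: "g \<in> linear_maps R H T" and ext: "g \<in> extensional (carrier H)"
    and eq: "\<And>h x h'. \<lbrakk>h \<in> carrier H; x \<in> carrier H; h' \<in> carrier H\<rbrakk> \<Longrightarrow> g (h \<otimes>\<^bsub>H\<^esub> x \<otimes>\<^bsub>H\<^esub> h') = bi_act h h' (g x)"
    using g unfolding bimod_homs_iff by blast+
  have g1: "g \<one>\<^bsub>H\<^esub> \<in> carrier T" by (rule linear_closed[OF lin H.one_closed])
  have e: "bi_act h \<one>\<^bsub>H\<^esub> (g \<one>\<^bsub>H\<^esub>) = g h" "bi_act \<one>\<^bsub>H\<^esub> h (g \<one>\<^bsub>H\<^esub>) = g h" if "h \<in> carrier H" for h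
    using eq[of h "\<one>\<^bsub>H\<^esub>" "\<one>\<^bsub>H\<^esub>"] eq[of "\<one>\<^bsub>H\<^esub>" "\<one>\<^bsub>H\<^esub>" h] that by simp_all
  show "g \<one>\<^bsub>H\<^esub> \<in> equivariant_tensors"
    unfolding equivariant_tensors_def
  proof (intro CollectI conjI ballI g1)
    fix h y assume hy: "h \<in> carrier H" "y \<in> carrier Y"
    have "act h (ev y (g \<one>\<^bsub>H\<^esub>)) = ev y (g h)"
      using hy g1 ev_bi_act[of h "\<one>\<^bsub>H\<^esub>" y "g \<one>\<^bsub>H\<^esub>"] by (simp add: e ev_xi_one)
    also have "\<dots> = ev (\<xi> h \<otimes>\<^bsub>Y\<^esub> y) (g \<one>\<^bsub>H\<^esub>)"
      using hy g1 ev_bi_act[of "\<one>\<^bsub>H\<^esub>" h y "g \<one>\<^bsub>H\<^esub>"] by (simp add: e act_one ev_closed closed_intros)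
    finally show "act h (ev y (g \<one>\<^bsub>H\<^esub>)) = ev (\<xi> h \<otimes>\<^bsub>Y\<^esub> y) (g \<one>\<^bsub>H\<^esub>)" .
  qed
  show "bimod_hom_of (g \<one>\<^bsub>H\<^esub>) = g"
    using ext e by (auto simp: bimod_hom_of_def fun_eq_iff extensional_def)
qed

lemma bimod_hom_of_one: "t \<in> carrier T \<Longrightarrow> bimod_hom_of t \<one>\<^bsub>H\<^esub> = t"
  by (rule ev_inj) (auto simp: ev_bimod_hom_of act_one ev_closed linear_closed[OF bimod_hom_of_linear])

end


section \<open>The values of the functors\<close>

lemma lmod_homsI:
  assumes "f \<in> linear_maps R M N"
    and "\<And>a m. \<lbrakk>a \<in> carrier A; m \<in> carrier M\<rbrakk> \<Longrightarrow> f (actM a m) = actN a (f m)"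
  shows "f \<in> lmod_homs R A (M, actM) (N, actN)"
  using assms by (simp add: lmod_homs_def equivariant_maps_def)

context coinduction_object
begin

abbreviation HomYN where "HomYN \<equiv> hom_module R Y N"
abbreviation alpha where "alpha \<equiv> alpha_map R Y \<gamma> N"
abbreviation cofree where "cofree \<equiv> cofree_action R Z \<gamma> N"
abbreviation transl where "transl \<equiv> translation_action Y"
abbreviation obj where "obj \<equiv> (N, act)"

lemma module_HomYN: "module R HomYN"
  by (rule module_hom_module[OF Q.module_H module_N])

lemma equivariant_tensorsD:
  "t \<in> equivariant_tensors \<Longrightarrow> t \<in> carrier T"
  "\<lbrakk>t \<in> equivariant_tensors; h \<in> carrier H; y \<in> carrier Y\<rbrakk> \<Longrightarrow> act h (ev y t) = ev (\<xi> h \<otimes>\<^bsub>Y\<^esub> y) t"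
  by (auto simp: equivariant_tensors_def)

lemma equivariant_tensors_submodule: "submodule equivariant_tensors R T"
proof (rule T.submoduleI)
  show "\<zero>\<^bsub>T\<^esub> \<in> equivariant_tensors"
    by (simp add: equivariant_tensors_def linear_zero[OF module_T module_N ev_linear]
        linear_zero[OF module_N module_N act_linear] closed_intros)
next
  fix a assume "a \<in> equivariant_tensors"
  then show "\<ominus>\<^bsub>T\<^esub> a \<in> equivariant_tensors"
    by (simp add: equivariant_tensors_def linear_neg[OF module_T module_N ev_linear]
        linear_neg[OF module_N module_N act_linear] closed_intros ev_closed)
next
  fix a b assume "a \<in> equivariant_tensors" "b \<in> equivariant_tensors"
  then show "a \<oplus>\<^bsub>T\<^esub> b \<in> equivariant_tensors"
    by (simp add: equivariant_tensors_def linear_add[OF ev_linear] linear_add[OF act_linear]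
        closed_intros ev_closed)
next
  fix r x assume "r \<in> carrier R" "x \<in> equivariant_tensors"
  then show "r \<odot>\<^bsub>T\<^esub> x \<in> equivariant_tensors"
    by (simp add: equivariant_tensors_def linear_smult[OF ev_linear] linear_smult[OF act_linear]
        closed_intros ev_closed)
qed (auto simp: equivariant_tensors_def)

lemma cofree_closed: "\<lbrakk>y \<in> carrier Y; t \<in> carrier T\<rbrakk> \<Longrightarrow> cofree y t \<in> carrier T"
  using linear_closed[OF Q.cofree_action_linear[OF module_N]] .

lemma cofree_equivariant: "\<lbrakk>y \<in> carrier Y; t \<in> equivariant_tensors\<rbrakk> \<Longrightarrow> cofree y t \<in> equivariant_tensors"
  by (simp add: equivariant_tensors_def cofree_closed Q.eval_cofree[OF module_N] closed_intros Y.m_assoc)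

lemma alpha_inj: "inj_on alpha (carrier T)"
  by (rule Q.alpha_inj_all[OF module_N])

lemma alpha_ev: "t \<in> carrier T \<Longrightarrow> alpha t = (\<lambda>y\<in>carrier Y. ev y t)"
  by (rule Q.alpha_apply[OF module_N])

lemma alpha_closed: "t \<in> carrier T \<Longrightarrow> alpha t \<in> carrier HomYN"
  by (rule linear_closed[OF Q.alpha_linear[OF module_N]])

text \<open>The carrier of \<open>Hom\<^bsub>H-\<^esub>(Y, N)\<close>, which is also that of the invariants of the twisted action on
  \<open>Hom\<^sub>R(Y, N)\<close>.\<close>

definition H_linear where
  "H_linear = {f \<in> carrier HomYN. \<forall>h\<in>carrier H. \<forall>y\<in>carrier Y. f (\<xi> h \<otimes>\<^bsub>Y\<^esub> y) = act h (f y)}"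

lemma HomYN_D:
  "f \<in> carrier HomYN \<Longrightarrow> f \<in> linear_maps R Y N" "f \<in> carrier HomYN \<Longrightarrow> f \<in> extensional (carrier Y)"
  by (auto simp: hom_module_def)

lemma H_linear_alpha: "H_linear \<inter> alpha ` carrier T = alpha ` equivariant_tensors"
proof -
  have "alpha t \<in> H_linear \<longleftrightarrow> t \<in> equivariant_tensors" if "t \<in> carrier T" for t
    using that alpha_closed[OF that] by (auto simp: H_linear_def equivariant_tensors_def alpha_ev closed_intros)
  then show ?thesis by (auto simp: equivariant_tensorsD(1))
qed

lemma H_linear_equivariant:
  "equivariant_maps R H Y (\<lambda>h y. \<xi> h \<otimes>\<^bsub>Y\<^esub> y) N act \<inter> extensional (carrier Y) = H_linear"
  by (auto simp: equivariant_maps_def H_linear_def hom_module_def)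

lemma H_linear_submodule: "submodule H_linear R HomYN"
proof -
  interpret Hom: module R HomYN by (rule module_HomYN)
  have z: "f \<oplus>\<^bsub>HomYN\<^esub> g = (\<lambda>y\<in>carrier Y. f y \<oplus>\<^bsub>N\<^esub> g y)" "\<zero>\<^bsub>HomYN\<^esub> = (\<lambda>y\<in>carrier Y. \<zero>\<^bsub>N\<^esub>)"
    "r \<odot>\<^bsub>HomYN\<^esub> f = (\<lambda>y\<in>carrier Y. r \<odot>\<^bsub>N\<^esub> f y)" for f g r by (simp_all add: hom_module_def)
  have c: "f y \<in> carrier N" if "f \<in> carrier HomYN" "y \<in> carrier Y" for f y
    using linear_closed[OF HomYN_D(1)] that by blast
  have neg: "(\<ominus>\<^bsub>HomYN\<^esub> f) y = \<ominus>\<^bsub>N\<^esub> f y" if "f \<in> carrier HomYN" "y \<in> carrier Y" for f y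
    using linear_neg[OF module_HomYN module_N hom_module_apply_linear] that by blast
  show ?thesis
  proof (rule Hom.submoduleI)
    show "\<zero>\<^bsub>HomYN\<^esub> \<in> H_linear"
      using Hom.zero_closed by (simp add: H_linear_def z closed_intros
          linear_zero[OF module_N module_N act_linear])
  next
    fix a assume "a \<in> H_linear"
    then show "\<ominus>\<^bsub>HomYN\<^esub> a \<in> H_linear"
      by (simp add: H_linear_def neg closed_intros linear_neg[OF module_N module_N act_linear] c)
  next
    fix a b assume "a \<in> H_linear" "b \<in> H_linear"
    then show "a \<oplus>\<^bsub>HomYN\<^esub> b \<in> H_linear"
      using Hom.a_closed by (simp add: H_linear_def z(1) closed_intros linear_add[OF act_linear]
          c del: Hom.a_closed)
  next
    fix r x assume "r \<in> carrier R" "x \<in> H_linear"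
    then show "r \<odot>\<^bsub>HomYN\<^esub> x \<in> H_linear"
      using Hom.smult_closed by (simp add: H_linear_def z(3) closed_intros linear_smult[OF act_linear]
          c del: Hom.smult_closed)
  qed (auto simp: H_linear_def)
qed

lemma transl_closed: "\<lbrakk>y \<in> carrier Y; f \<in> carrier HomYN\<rbrakk> \<Longrightarrow> transl y f \<in> carrier HomYN"
proof -
  assume y: "y \<in> carrier Y" and f: "f \<in> carrier HomYN"
  have "transl y f \<in> linear_maps R Y N"
    unfolding translation_action_def
    by (rule linear_cong[OF Q.module_H linear_compose[OF HomYN_D(1)[OF f]
        linear_Y_mult_left[OF y linear_id]]]) simp
  then show ?thesis by (simp add: hom_module_def translation_action_def)
qed

lemma H_linear_transl: "\<lbrakk>y \<in> carrier Y; f \<in> H_linear\<rbrakk> \<Longrightarrow> transl y f \<in> H_linear"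
  by (auto simp: H_linear_def transl_closed) (simp add: translation_action_def closed_intros Y.m_assoc)

lemma twisted_hom_action_eq: "twisted_hom_action H Y \<xi> obj h f = (\<lambda>y\<in>carrier Y. twisted_act h f y)"
  by (simp add: twisted_hom_action_def twisted_act_def)

lemma invariants_hom: "invariants H HomYN (twisted_hom_action H Y \<xi> obj) = H_linear"
proof -
  have "(\<forall>h\<in>carrier H. twisted_hom_action H Y \<xi> obj h f = counit H h \<odot>\<^bsub>HomYN\<^esub> f) \<longleftrightarrow>
      (\<forall>h\<in>carrier H. \<forall>y\<in>carrier Y. f (\<xi> h \<otimes>\<^bsub>Y\<^esub> y) = act h (f y))" if f: "f \<in> carrier HomYN" for f
    unfolding twisted_act_invariant_iff[OF HomYN_D(1)[OF f], symmetric]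
    by (auto simp: twisted_hom_action_eq hom_module_def fun_eq_iff)
  then show ?thesis by (auto simp: invariants_def H_linear_def)
qed

abbreviation inv_T where "inv_T \<equiv> submod T equivariant_tensors"
abbreviation coind_N where "coind_N \<equiv> submod HomYN (alpha ` equivariant_tensors)"

text \<open>All natural transformations of the theorem start from these values: the functors on the tensor
  side are equal, and so are those on the \<open>Hom\<close> side, as modules with a \<open>Y\<close>-action and not merely up
  to isomorphism.\<close>

lemma functor_values:
  "coinv_tensor_fun R H K \<beta> Z \<gamma> \<theta> obj = (inv_T, cofree)"
  "inv_tensor_fun R H K \<beta> Z \<gamma> \<theta> obj = (inv_T, cofree)"
  "cotensor_fun R H K \<beta> Z \<gamma> \<theta> obj = (inv_T, cofree)"
  "coind R H Y Z \<gamma> \<xi> obj = (coind_N, transl)"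
  "HOM_R_inv_fun R H Y Z \<gamma> \<xi> obj = (coind_N, transl)"
  "Rat_Hom_inv_fun R H Y Z \<gamma> \<xi> obj = (coind_N, transl)"
  "bimod_hom_fun R H Z \<gamma> \<xi> obj =
    (submod (hom_module R H T) bimod_homs, \<lambda>y g. \<lambda>x\<in>carrier H. cofree y (g x))"
proof -
  have rat: "rational_part R Y Z \<gamma> (submod HomYN H_linear) transl = alpha ` equivariant_tensors"
    using Q.rational_part_submod[OF module_HomYN H_linear_submodule H_linear_transl]
    by (simp add: Q.rational_part_hom[OF module_N] H_linear_alpha)
  show "coinv_tensor_fun R H K \<beta> Z \<gamma> \<theta> obj = (inv_T, cofree)"
    by (simp add: coinv_tensor_fun_def Let_def coinvariants_twisted invariants_twisted)
  show "inv_tensor_fun R H K \<beta> Z \<gamma> \<theta> obj = (inv_T, cofree)"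
    by (simp add: inv_tensor_fun_def Let_def invariants_twisted)
  show "cotensor_fun R H K \<beta> Z \<gamma> \<theta> obj = (inv_T, cofree)"
    by (simp add: cotensor_fun_def cotensor_equivariant)
  show "coind R H Y Z \<gamma> \<xi> obj = (coind_N, transl)"
    by (simp add: coind_def Let_def equivariant_hom_module_def H_linear_equivariant rat)
  show "Rat_Hom_inv_fun R H Y Z \<gamma> \<xi> obj = (coind_N, transl)"
    by (simp add: Rat_Hom_inv_fun_def Let_def invariants_hom rat)
  have "invariants H (submod HomYN (alpha ` carrier T)) (twisted_hom_action H Y \<xi> obj) =
      invariants H HomYN (twisted_hom_action H Y \<xi> obj) \<inter> alpha ` carrier T"
    using alpha_closed by (auto simp: invariants_def)
  then show "HOM_R_inv_fun R H Y Z \<gamma> \<xi> obj = (coind_N, transl)"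
    by (simp add: HOM_R_inv_fun_def Let_def Q.rational_part_hom[OF module_N] invariants_hom H_linear_alpha)
  show "bimod_hom_fun R H Z \<gamma> \<xi> obj =
    (submod (hom_module R H T) bimod_homs, \<lambda>y g. \<lambda>x\<in>carrier H. cofree y (g x))"
    by (simp add: bimod_hom_fun_def equivariant_hom_module_def)
qed

lemma coind_submodule: "submodule (alpha ` equivariant_tensors) R HomYN"
proof -
  have "alpha \<in> linear_maps R inv_T HomYN"
    using linear_compose[OF Q.alpha_linear[OF module_N] submod_incl_linear[OF equivariant_tensors_submodule]] .
  from submodule_image[OF submod_module[OF module_T equivariant_tensors_submodule] module_HomYN this]
  show ?thesis by simp
qed

lemma alpha_transl: "\<lbrakk>y \<in> carrier Y; t \<in> carrier T\<rbrakk> \<Longrightarrow> transl y (alpha t) = alpha (cofree y t)"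
  by (rule Q.translation_action_alpha[OF module_N])

text \<open>The carrier is contained in the rational part of \<open>Hom\<^sub>R(Y, N)\<close>, hence equal to its own
  rational part by \<open>rational_part_submod\<close>.\<close>

lemma coind_rational:
  "(coind_N, transl) \<in> rational_objects R Y Z \<gamma>"
proof -
  let ?C = "alpha ` equivariant_tensors" and ?M = "coind_N"
  have stable: "transl y f \<in> ?C" if "y \<in> carrier Y" "f \<in> ?C" for y f
    using that by (auto simp: alpha_transl equivariant_tensorsD(1) cofree_equivariant)
  have sub: "f \<in> linear_maps R Y N" "f \<in> extensional (carrier Y)" if "f \<in> ?C" for f
    using that HomYN_D[OF alpha_closed[OF equivariant_tensorsD(1)]] by auto
  have "left_module R Y ?M transl"
  proof (rule left_module.intro)
    show "module R ?M" by (rule submod_module[OF module_HomYN coind_submodule])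
    show "transl y \<in> linear_maps R ?M ?M" if y: "y \<in> carrier Y" for y
      by (rule linear_mapsI) (use y stable[OF y] in \<open>auto
          simp: translation_action_def hom_module_def fun_eq_iff closed_intros\<close>)
    show "(\<lambda>y. transl y f) \<in> linear_maps R Y ?M" if "f \<in> carrier ?M" for f
    proof -
      from that have f: "f \<in> ?C" by simp
      show ?thesis
        by (rule linear_mapsI) (use stable[OF _ f]
            in \<open>auto simp: translation_action_def hom_module_def fun_eq_iff
          linear_add[OF linear_compose[OF sub(1)[OF f] linear_Y_mult_right[OF _ linear_id]]]
          linear_smult[OF linear_compose[OF sub(1)[OF f] linear_Y_mult_right[OF _ linear_id]]]\<close>)
    qed
    show "transl (a \<otimes>\<^bsub>Y\<^esub> b) f = transl a (transl b f)"
      if "a \<in> carrier Y" "b \<in> carrier Y" "f \<in> carrier ?M" for a b f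
      using that by (auto simp: translation_action_def fun_eq_iff Y.m_assoc)
    show "transl \<one>\<^bsub>Y\<^esub> f = f" if "f \<in> carrier ?M" for f
      using that sub(2)[of f] by (auto simp: translation_action_def fun_eq_iff extensional_def)
  qed
  moreover have "rational_part R Y Z \<gamma> ?M transl = carrier ?M"
    using Q.rational_part_submod[OF module_HomYN coind_submodule stable]
    by (auto simp: Q.rational_part_hom[OF module_N] equivariant_tensorsD(1))
  ultimately show ?thesis by (simp add: rational_objects_def)
qed

lemma alpha_iso:
  "alpha \<in> lmod_homs R Y (inv_T, cofree) (coind_N, transl)"
  "bij_betw alpha equivariant_tensors (alpha ` equivariant_tensors)"
proof -
  show "alpha \<in> lmod_homs R Y (inv_T, cofree) (coind_N, transl)"
    by (rule lmod_homsI linear_mapsI)+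
      (simp_all add: equivariant_tensorsD(1) alpha_transl linear_add[OF Q.alpha_linear[OF module_N]]
        linear_smult[OF Q.alpha_linear[OF module_N]])
  show "bij_betw alpha equivariant_tensors (alpha ` equivariant_tensors)"
    by (rule inj_on_imp_bij_betw[OF inj_on_subset[OF alpha_inj]]) (rule subsetI, rule equivariant_tensorsD(1))
qed

abbreviation alpha_inv where "alpha_inv \<equiv> the_inv_into (carrier T) alpha"

lemma alpha_inv: "t \<in> carrier T \<Longrightarrow> alpha_inv (alpha t) = t"
  by (rule the_inv_into_f_f[OF alpha_inj])

lemma alpha_inv_iso:
  "alpha_inv \<in> lmod_homs R Y (coind_N, transl) (inv_T, cofree)"
  "bij_betw alpha_inv (alpha ` equivariant_tensors) equivariant_tensors"
proof -
  have lin: "alpha_inv \<in> linear_maps R coind_N inv_T"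
  proof (rule linear_mapsI)
    fix x y assume "x \<in> carrier coind_N"
      "y \<in> carrier coind_N"
    then obtain s t where "x = alpha s" "y = alpha t" "s \<in> carrier T" "t \<in> carrier T"
      using equivariant_tensorsD(1) by auto
    then show "alpha_inv (x \<oplus>\<^bsub>coind_N\<^esub> y) =
        alpha_inv x \<oplus>\<^bsub>inv_T\<^esub> alpha_inv y"
      by (simp add: alpha_inv flip: linear_add[OF Q.alpha_linear[OF module_N]])
  next
    fix r x assume "r \<in> carrier R" "x \<in> carrier coind_N"
    then obtain t where "x = alpha t" "t \<in> carrier T" "r \<in> carrier R"
      using equivariant_tensorsD(1) by auto
    then show "alpha_inv (r \<odot>\<^bsub>coind_N\<^esub> x) =
        r \<odot>\<^bsub>inv_T\<^esub> alpha_inv x"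
      by (simp add: alpha_inv flip: linear_smult[OF Q.alpha_linear[OF module_N]])
  qed (auto simp: alpha_inv equivariant_tensorsD(1))
  then show "alpha_inv \<in> lmod_homs R Y (coind_N, transl) (inv_T, cofree)"
    by (rule lmod_homsI) (auto simp: alpha_transl equivariant_tensorsD(1) alpha_inv cofree_closed)
  show "bij_betw alpha_inv (alpha ` equivariant_tensors) equivariant_tensors"
    by (rule bij_betw_byWitness[where f' = alpha]) (auto simp: alpha_inv equivariant_tensorsD(1))
qed

lemma bimod_iso:
  "bimod_hom_of \<in> lmod_homs R Y (inv_T, cofree)
    (submod (hom_module R H T) bimod_homs, \<lambda>y g. \<lambda>x\<in>carrier H. cofree y (g x))"
  "bij_betw bimod_hom_of equivariant_tensors bimod_homs"
proof -
  have l: "bimod_hom_of \<in> linear_maps R inv_T (submod (hom_module R H T) bimod_homs)"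
  proof (rule linear_mapsI)
    fix t assume "t \<in> carrier inv_T"
    then show "bimod_hom_of t \<in> carrier (submod (hom_module R H T) bimod_homs)"
      using bimod_hom_of_mem by simp
  next
    fix s t assume "s \<in> carrier inv_T" "t \<in> carrier inv_T"
    then show "bimod_hom_of (s \<oplus>\<^bsub>inv_T\<^esub> t) =
        bimod_hom_of s \<oplus>\<^bsub>submod (hom_module R H T) bimod_homs\<^esub> bimod_hom_of t"
      by (auto simp: bimod_hom_of_def hom_module_def fun_eq_iff linear_add[OF bi_act_linear]
          equivariant_tensorsD(1))
  next
    fix r t assume "r \<in> carrier R" "t \<in> carrier inv_T"
    then show "bimod_hom_of (r \<odot>\<^bsub>inv_T\<^esub> t) =
        r \<odot>\<^bsub>submod (hom_module R H T) bimod_homs\<^esub> bimod_hom_of t"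
      by (auto simp: bimod_hom_of_def hom_module_def fun_eq_iff linear_smult[OF bi_act_linear]
          equivariant_tensorsD(1))
  qed
  have e: "bimod_hom_of (cofree y t) = (\<lambda>x\<in>carrier H. cofree y (bimod_hom_of t x))"
    if y: "y \<in> carrier Y" and t: "t \<in> carrier T" for y t
  proof (rule extensionalityI[of _ "carrier H"])
    fix x assume x: "x \<in> carrier H"
    note c = linear_closed[OF bimod_hom_of_linear]
    have "bimod_hom_of (cofree y t) x = cofree y (bimod_hom_of t x)"
      by (rule ev_inj) (use x y t in \<open>simp_all add: c cofree_closed ev_bimod_hom_of Q.eval_cofree[OF
          module_N] closed_intros\<close>)
    then show "bimod_hom_of (cofree y t) x = (\<lambda>x\<in>carrier H. cofree y (bimod_hom_of t x)) x" using x by simp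
  qed (simp_all add: bimod_hom_of_def)
  show "bimod_hom_of \<in> lmod_homs R Y (inv_T, cofree)
    (submod (hom_module R H T) bimod_homs, \<lambda>y g. \<lambda>x\<in>carrier H. cofree y (g x))"
    by (rule lmod_homsI[OF l]) (use e equivariant_tensorsD(1) in simp)
  show "bij_betw bimod_hom_of equivariant_tensors bimod_homs"
    by (rule bij_betw_byWitness[where f' = "\<lambda>g. g \<one>\<^bsub>H\<^esub>"])
      (use bimod_hom_at_one bimod_hom_of_mem in \<open>auto simp: bimod_hom_of_one equivariant_tensorsD(1)\<close>)
qed

end


section \<open>Naturality\<close>

context coinduction
begin

lemma object: "(N, act) \<in> rational_objects R H K \<beta> \<Longrightarrow> coinduction_object R H K \<beta> Y Z \<gamma> \<xi> \<theta> N act"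
  by (intro coinduction_object.intro coinduction_object_axioms.intro coinduction_axioms)

context
  fixes N N' :: "('r, 'n) module" and act act' :: "'h \<Rightarrow> 'n \<Rightarrow> 'n" and f :: "'n \<Rightarrow> 'n"
  assumes o: "(N, act) \<in> rational_objects R H K \<beta>" and o': "(N', act') \<in> rational_objects R H K \<beta>"
    and f: "f \<in> lmod_homs R H (N, act) (N', act')"
begin

interpretation A: coinduction_object R H K \<beta> Y Z \<gamma> \<xi> \<theta> N act by (rule object[OF o])
interpretation B: coinduction_object R H K \<beta> Y Z \<gamma> \<xi> \<theta> N' act' by (rule object[OF o'])

abbreviation fT where "fT \<equiv> tensor_mor R Z (N, act) (N', act') f"
abbreviation fY where "fY \<equiv> hom_mor Y (N, act) (N', act') f"

lemma f_linear: "f \<in> linear_maps R N N'"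
  and f_act: "\<lbrakk>h \<in> carrier H; n \<in> carrier N\<rbrakk> \<Longrightarrow> f (act h n) = act' h (f n)"
  using f by (auto simp: lmod_homs_def equivariant_maps_def)

lemma tensor_mor_linear: "fT \<in> linear_maps R A.T B.T"
  unfolding tensor_mor_def fst_conv
  by (rule tensor_map_linear[OF A.module_N Q.module_K B.module_N Q.module_K f_linear linear_id])

lemma ev_tensor_mor: "\<lbrakk>y \<in> carrier Y; t \<in> carrier A.T\<rbrakk> \<Longrightarrow>
    B.ev y (fT t) = f (A.ev y t)"
  unfolding tensor_mor_def fst_conv by (rule Q.eval_natural[OF A.module_N B.module_N f_linear])

lemma tensor_mor_equivariant:
  "t \<in> A.equivariant_tensors \<Longrightarrow> fT t \<in> B.equivariant_tensors"
  using A.equivariant_tensorsD(1)[of t] A.equivariant_tensorsD(2)[of t]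
  by (simp add: B.equivariant_tensors_def linear_closed[OF tensor_mor_linear] ev_tensor_mor A.closed_intros
      A.ev_closed flip: f_act)

lemma alpha_tensor_mor:
  "t \<in> carrier A.T \<Longrightarrow> B.alpha (fT t) = fY (A.alpha t)"
  by (auto simp: hom_mor_def compose_def A.alpha_ev B.alpha_ev linear_closed[OF tensor_mor_linear]
      ev_tensor_mor fun_eq_iff)

lemma coind_mor:
  "fY \<in> lmod_homs R Y (coind R H Y Z \<gamma> \<xi> (N, act)) (coind R H Y Z \<gamma> \<xi> (N', act'))"
  unfolding A.functor_values B.functor_values
proof (rule lmod_homsI, rule linear_mapsI)
  fix g assume "g \<in> carrier A.coind_N"
  then show "fY g \<in> carrier B.coind_N"
    by (auto simp: tensor_mor_equivariant A.equivariant_tensorsD(1) simp flip: alpha_tensor_mor)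
next
  fix g g' assume "g \<in> carrier A.coind_N"
    "g' \<in> carrier A.coind_N"
  then have "g \<in> linear_maps R Y N" "g' \<in> linear_maps R Y N"
    using A.HomYN_D(1)[OF A.alpha_closed[OF A.equivariant_tensorsD(1)]] by auto
  then show "fY (g \<oplus>\<^bsub>A.coind_N\<^esub> g') =
      fY g \<oplus>\<^bsub>B.coind_N\<^esub> fY g'"
    by (auto simp: hom_mor_def compose_def hom_module_def fun_eq_iff linear_closed linear_add[OF f_linear])
next
  fix r g assume "r \<in> carrier R" "g \<in> carrier A.coind_N"
  then have "r \<in> carrier R" "g \<in> linear_maps R Y N"
    using A.HomYN_D(1)[OF A.alpha_closed[OF A.equivariant_tensorsD(1)]] by auto
  then show "fY (r \<odot>\<^bsub>A.coind_N\<^esub> g) =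
      r \<odot>\<^bsub>B.coind_N\<^esub> fY g"
    by (auto simp: hom_mor_def compose_def hom_module_def fun_eq_iff linear_closed linear_smult[OF f_linear])
next
  fix y g assume "y \<in> carrier Y"
  then show "fY (translation_action Y y g) =
      translation_action Y y (fY g)"
    by (auto simp: hom_mor_def compose_def translation_action_def fun_eq_iff A.closed_intros)
qed

lemma alpha_inv_tensor_mor:
  assumes "g \<in> A.alpha ` A.equivariant_tensors"
  shows "B.alpha_inv (fY g) = fT (A.alpha_inv g)"
  using assms
  by (auto simp: A.alpha_inv B.alpha_inv A.equivariant_tensorsD(1) linear_closed[OF tensor_mor_linear]
      simp flip: alpha_tensor_mor)

text \<open>Both sides evaluate at \<open>x\<close> and \<open>y\<close> to \<open>f (x (ev y t))\<close>, because \<open>f\<close> is \<open>H\<close>-linear.\<close>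

lemma bimod_tensor_mor:
  assumes t: "t \<in> A.equivariant_tensors"
  shows "B.bimod_hom_of (fT t) =
    bimod_hom_mor R H Z (N, act) (N', act') f (A.bimod_hom_of t)"
proof (rule extensionalityI[of _ "carrier H"])
  fix x assume x: "x \<in> carrier H"
  note tT = A.equivariant_tensorsD(1)[OF t] and c = linear_closed[OF tensor_mor_linear]
  have "B.bimod_hom_of (fT t) x =
      fT (A.bimod_hom_of t x)"
    by (rule B.ev_inj) (use x tT in \<open>simp_all add: c linear_closed[OF A.bimod_hom_of_linear]
        linear_closed[OF B.bimod_hom_of_linear] A.ev_bimod_hom_of B.ev_bimod_hom_of ev_tensor_mor f_act
            A.ev_closed\<close>)
  then show "B.bimod_hom_of (fT t) x =
      bimod_hom_mor R H Z (N, act) (N', act') f (A.bimod_hom_of t) x"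
    using x by (simp add: bimod_hom_mor_def compose_def)
qed (simp_all add: B.bimod_hom_of_def bimod_hom_mor_def compose_def)

end

end

lemma natural_isoI:
  assumes "\<And>N act. (N, act) \<in> \<C> \<Longrightarrow> \<eta> (N, act) \<in> lmod_homs R B (F (N, act)) (G (N, act))"
    and "\<And>N act. (N, act) \<in> \<C> \<Longrightarrow> bij_betw (\<eta> (N, act)) (carrier (fst (F (N, act)))) (carrier (fst (G (N, act))))"
    and "\<And>N act N' act' f x. \<lbrakk>(N, act) \<in> \<C>; (N', act') \<in> \<C>; f \<in> lmod_homs R A (N, act) (N', act');
      x \<in> carrier (fst (F (N, act)))\<rbrakk> \<Longrightarrow>
      \<eta> (N', act') (Fm (N, act) (N', act') f x) = Gm (N, act) (N', act') f (\<eta> (N, act) x)"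
  shows "natural_iso R A \<C> B F Fm G Gm"
  unfolding natural_iso_def using assms by (intro exI[of _ \<eta>]) (simp add: split_paired_all)

lemma natural_iso_refl:
  assumes "\<And>N act. (N, act) \<in> \<C> \<Longrightarrow> F (N, act) = G (N, act)"
  shows "natural_iso R A \<C> B F Fm G Fm"
  by (rule natural_isoI[of _ "\<lambda>_ x. x"]) (auto simp: assms lmod_homs_def equivariant_maps_def linear_id
      bij_betw_def)

theorem mainTheorem2:
  fixes R :: "('r, 'z) ring_scheme"
    and H :: "('r, 'h) hopf" and K :: "('r, 'k) hopf" and \<beta> :: "'h \<Rightarrow> 'k \<Rightarrow> 'r"
    and Y :: "('r, 'y) hopf" and Z :: "('r, 'c) hopf" and \<gamma> :: "'y \<Rightarrow> 'c \<Rightarrow> 'r"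
    and \<xi> :: "'h \<Rightarrow> 'y" and \<theta> :: "'c \<Rightarrow> 'k"
    and \<C> :: "('r, 'h, 'n) lmod set"
  assumes "cring R"
    and "hopf_alpha_pairing R H K \<beta>"
    and "hopf_alpha_pairing R Y Z \<gamma>"
    and "pairing_morphism R Y Z \<gamma> H K \<beta> \<xi> \<theta>"
    and "\<C> = rational_objects R H K \<beta>"
  shows "lmod_functor R H \<C> Y (rational_objects R Y Z \<gamma>) (coind R H Y Z \<gamma> \<xi>) (hom_mor Y) \<and>
    natural_iso R H \<C> Y
      (coinv_tensor_fun R H K \<beta> Z \<gamma> \<theta>) (tensor_mor R Z)
      (inv_tensor_fun R H K \<beta> Z \<gamma> \<theta>) (tensor_mor R Z) \<and>
    natural_iso R H \<C> Y
      (inv_tensor_fun R H K \<beta> Z \<gamma> \<theta>) (tensor_mor R Z)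
      (HOM_R_inv_fun R H Y Z \<gamma> \<xi>) (hom_mor Y) \<and>
    (\<forall>N\<in>\<C>. HOM_R_inv_fun R H Y Z \<gamma> \<xi> N = Rat_Hom_inv_fun R H Y Z \<gamma> \<xi> N \<and>
            Rat_Hom_inv_fun R H Y Z \<gamma> \<xi> N = coind R H Y Z \<gamma> \<xi> N) \<and>
    natural_iso R H \<C> Y
      (coind R H Y Z \<gamma> \<xi>) (hom_mor Y)
      (cotensor_fun R H K \<beta> Z \<gamma> \<theta>) (tensor_mor R Z) \<and>
    natural_iso R H \<C> Y
      (cotensor_fun R H K \<beta> Z \<gamma> \<theta>) (tensor_mor R Z)
      (bimod_hom_fun R H Z \<gamma> \<xi>) (bimod_hom_mor R H Z)"
proof (intro conjI)
  interpret coinduction R H K \<beta> Y Z \<gamma> \<xi> \<theta>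
    using assms by (intro coinduction.intro)
  have obj: "coinduction_object R H K \<beta> Y Z \<gamma> \<xi> \<theta> N act" if "(N, act) \<in> \<C>" for N act
    using that object by (simp add: assms(5))
  note vals = coinduction_object.functor_values[OF obj]
  have ts: "t \<in> carrier (tensor R N Z)"
    if "(N, act) \<in> \<C>" "t \<in> coinduction_object.equivariant_tensors R H Y Z \<gamma> \<xi> N act" for N act t
    using coinduction_object.equivariant_tensorsD(1)[OF obj] that by blast
  show "lmod_functor R H \<C> Y (rational_objects R Y Z \<gamma>) (coind R H Y Z \<gamma> \<xi>) (hom_mor Y)"
    unfolding lmod_functor_def
  proof (intro conjI ballI)
    fix M assume "M \<in> \<C>"
    then show "coind R H Y Z \<gamma> \<xi> M \<in> rational_objects R Y Z \<gamma>"
      by (cases M) (simp add: vals coinduction_object.coind_rational[OF obj])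
  next
    fix M M' f assume "M \<in> \<C>" "M' \<in> \<C>" "f \<in> lmod_homs R H M M'"
    then show "hom_mor Y M M' f \<in> lmod_homs R Y (coind R H Y Z \<gamma> \<xi> M) (coind R H Y Z \<gamma> \<xi> M')"
      using coind_mor assms(5) by (cases M; cases M') blast
  next
    fix M x assume "M \<in> \<C>" "x \<in> carrier (fst (coind R H Y Z \<gamma> \<xi> M))"
    then have "x \<in> extensional (carrier Y)"
      by (cases M) (auto simp: coind_def Let_def equivariant_hom_module_def rational_part_def)
    then show "hom_mor Y M M (\<lambda>m. m) x = x"
      by (auto simp: hom_mor_def compose_def extensional_def fun_eq_iff)
  next
    fix M M' M'' f g x
    show "hom_mor Y M M'' (g \<circ> f) x = hom_mor Y M' M'' g (hom_mor Y M M' f x)"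
      by (auto simp: hom_mor_def compose_def fun_eq_iff)
  qed
  show "natural_iso R H \<C> Y (coinv_tensor_fun R H K \<beta> Z \<gamma> \<theta>) (tensor_mor R Z)
      (inv_tensor_fun R H K \<beta> Z \<gamma> \<theta>) (tensor_mor R Z)"
    by (rule natural_iso_refl) (simp add: vals)
  show "natural_iso R H \<C> Y (inv_tensor_fun R H K \<beta> Z \<gamma> \<theta>) (tensor_mor R Z)
      (HOM_R_inv_fun R H Y Z \<gamma> \<xi>) (hom_mor Y)"
    by (rule natural_isoI[of _ "\<lambda>M. alpha_map R Y \<gamma> (fst M)"])
      (simp_all add: vals coinduction_object.alpha_iso[OF obj] ts alpha_tensor_mor assms(5))
  show "natural_iso R H \<C> Y (coind R H Y Z \<gamma> \<xi>) (hom_mor Y)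
      (cotensor_fun R H K \<beta> Z \<gamma> \<theta>) (tensor_mor R Z)"
    by (rule natural_isoI[of _ "\<lambda>M. the_inv_into (carrier (tensor R (fst M) Z)) (alpha_map R Y \<gamma> (fst M))"])
      (simp_all add: vals coinduction_object.alpha_inv_iso[OF obj] alpha_inv_tensor_mor assms(5))
  show "\<forall>N\<in>\<C>. HOM_R_inv_fun R H Y Z \<gamma> \<xi> N = Rat_Hom_inv_fun R H Y Z \<gamma> \<xi> N \<and>
      Rat_Hom_inv_fun R H Y Z \<gamma> \<xi> N = coind R H Y Z \<gamma> \<xi> N"
    by (auto simp: vals)
  show "natural_iso R H \<C> Y (cotensor_fun R H K \<beta> Z \<gamma> \<theta>) (tensor_mor R Z)
      (bimod_hom_fun R H Z \<gamma> \<xi>) (bimod_hom_mor R H Z)"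
    by (rule natural_isoI[of _ "\<lambda>(N, act). coinduction_object.bimod_hom_of R H Z \<gamma> \<xi> N act"])
      (simp_all add: vals coinduction_object.bimod_iso[OF obj] bimod_tensor_mor assms(5))
qed

end
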